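(* Let $c,p\in\omega\setminus\{0,1\}$, where $p$ is a prime with $p>\max(2,c)$. Then the space $\mathcal{G}_{c_{nil}p}$ of (enumerated) nilpotent groups of degree $c$ and of exponent $p$ is a closed subspace of $\mathcal{G}$ which has a generic group.
   Context: An enumerated group is the set $\omega$ together with a multiplication function $\cdot:\omega\times\omega\to\omega$, an inversion function ${}^{-1}:\omega\to\omega$ and an identity element $e\in\omega$ defining a group. The space $\mathcal{G}$ of enumerated groups is the (closed) subset of $\omega^{\omega\times\omega}\times\omega^{\omega}\times\omega$ consisting of all such triples, where the product carries the product topology ($\omega$ discrete) and $\mathcal{G}$ the subspace topology; it is a Polish space. $\mathcal{G}_{c_{nil}p}\subseteq\mathcal{G}$ is the set of all enumerated groups lying in the variety of nilpotent groups of degree $c$ and exponent $p$ (i.e. nilpotent of class at most $c$ and satisfying the identity $x^p=1$). For a Polish subspace $\mathcal{G}_P\subseteq\mathcal{G}$ determined by an isomorphism-invariant property $P$, a group $G\in\mathcal{G}_P$ is generic if the set of all members of $\mathcal{G}_P$ isomorphic to $G$ is comeagre in $\mathcal{G}_P$. *)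

theory Defs
  imports
    "HOL-Analysis.Analysis"
    "HOL-Algebra.Generated_Groups"
    "HOL-Computational_Algebra.Primes"
begin

section \<open>The space of enumerated groups\<close>

text \<open>
  Triples (multiplication, inversion, identity) on the natural numbers. The library's
  topology on this type is the product topology with \<^typ>\<open>nat\<close> discrete.
\<close>
type_synonym enum_structure = "(nat \<times> nat \<Rightarrow> nat) \<times> (nat \<Rightarrow> nat) \<times> nat"

fun enum_mult :: "enum_structure \<Rightarrow> nat \<Rightarrow> nat \<Rightarrow> nat" where
  "enum_mult (m, i, e) x y = m (x, y)"

fun enum_inv :: "enum_structure \<Rightarrow> nat \<Rightarrow> nat" where
  "enum_inv (m, i, e) x = i x"

fun enum_one :: "enum_structure \<Rightarrow> nat" where
  "enum_one (m, i, e) = e"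

definition group_of :: "enum_structure \<Rightarrow> nat monoid" where
  "group_of G = \<lparr>carrier = UNIV, monoid.mult = enum_mult G, one = enum_one G\<rparr>"

text \<open>The record \<^typ>\<open>nat monoid\<close> has no inversion component, so that part of the triple is
  required separately to be the inversion of the group.\<close>
definition enum_groups :: "enum_structure set" where
  "enum_groups = {G. group (group_of G) \<and> (\<forall>x. enum_inv G x = m_inv (group_of G) x)}"

section \<open>Nilpotent groups of class at most \<open>c\<close> and exponent \<open>p\<close>\<close>

text \<open>Indexed from 0: \<open>lower_central_series G n\<close> is the term usually written \<open>\<gamma>\<close> with
  index \<open>n + 1\<close>. Commutators follow the convention of \<^const>\<open>derived\<close>.\<close>
primrec lower_central_series :: "('a, 'b) monoid_scheme \<Rightarrow> nat \<Rightarrow> 'a set" where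
  "lower_central_series G 0 = carrier G"
| "lower_central_series G (Suc n) =
     generate G (\<Union>x \<in> lower_central_series G n. \<Union>y \<in> carrier G.
       {x \<otimes>\<^bsub>G\<^esub> y \<otimes>\<^bsub>G\<^esub> inv\<^bsub>G\<^esub> x \<otimes>\<^bsub>G\<^esub> inv\<^bsub>G\<^esub> y})"

definition nilpotent_of_class_le :: "('a, 'b) monoid_scheme \<Rightarrow> nat \<Rightarrow> bool" where
  "nilpotent_of_class_le G c \<longleftrightarrow> group G \<and> lower_central_series G c = {\<one>\<^bsub>G\<^esub>}"

text \<open>Varietal sense: the identity holds, so the trivial group is included.\<close>
definition satisfies_exponent :: "('a, 'b) monoid_scheme \<Rightarrow> nat \<Rightarrow> bool" where
  "satisfies_exponent G p \<longleftrightarrow> (\<forall>x \<in> carrier G. x [^]\<^bsub>G\<^esub> p = \<one>\<^bsub>G\<^esub>)"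

definition enum_nil_groups :: "nat \<Rightarrow> nat \<Rightarrow> enum_structure set" where
  "enum_nil_groups c p =
     {G \<in> enum_groups. nilpotent_of_class_le (group_of G) c \<and> satisfies_exponent (group_of G) p}"

section \<open>Baire category and generic groups\<close>

definition nowhere_dense_in :: "'a topology \<Rightarrow> 'a set \<Rightarrow> bool" where
  "nowhere_dense_in X S \<longleftrightarrow> S \<subseteq> topspace X \<and> X interior_of (X closure_of S) = {}"

definition meagre_in :: "'a topology \<Rightarrow> 'a set \<Rightarrow> bool" where
  "meagre_in X S \<longleftrightarrow> (\<exists>F :: nat \<Rightarrow> 'a set. (\<forall>n. nowhere_dense_in X (F n)) \<and> S = (\<Union>n. F n))"

definition comeagre_in :: "'a topology \<Rightarrow> 'a set \<Rightarrow> bool" where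
  "comeagre_in X S \<longleftrightarrow> S \<subseteq> topspace X \<and> meagre_in X (topspace X - S)"

text \<open>Intended for \<open>P\<close> an isomorphism-invariant subset of \<^const>\<open>enum_groups\<close> that is Polish in
  the subspace topology.\<close>
definition generic_group_in :: "enum_structure set \<Rightarrow> enum_structure \<Rightarrow> bool" where
  "generic_group_in P G \<longleftrightarrow>
     G \<in> P \<and> comeagre_in (top_of_set P) {H \<in> P. group_of H \<cong> group_of G}"

end

theory Submission
  imports Defs "HOL-Library.Function_Algebras"
begin

text \<open>
  The space is closed because membership is expressed by identities: a group is nilpotent of class
  at most \<open>c\<close> exactly when all left-normed commutators of length \<open>c + 1\<close> vanish, and the value of a
  word at given numbers depends on finitely many entries of the multiplication table.

  The generic group is found by back and forth. Finitely generated groups of the variety are finite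
  (\<open>generate_finite\<close>), so a basic open set only prescribes the multiplication on a finite subgroup,
  and every finite group of the variety, with part of it already enumerated, is realized inside some
  enumerated group (\<open>exists_enumerated_supergroup\<close>). Hence any countable list of requirements
  that this or that finite extension is realized holds on a comeagre set as soon as each of them is dense. Call
  an enumerated group rich if it realizes all the extensions that it should. Any two rich groups are
  isomorphic, so the isomorphism class of one of them is comeagre. What makes the requirements dense is
  weak amalgamation: every finite \<open>A\<close> has a finite extension \<open>B\<close> such that all further extensions of \<open>B\<close>
  can be amalgamated over \<open>A\<close>.

  Plain amalgamation fails: an element may lie in the last nontrivial term of the lower central series
  of one extension and be noncentral in another. This is the only obstruction. If two finite extensions of
  \<open>A\<close> induce the same filtration on \<open>A\<close> by their lower central series, then they amalgamate over \<open>A\<close>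
  (\<open>amalgamation\<close>). Passing to an extension can only enlarge the induced filtration of the finite group
  \<open>A\<close>, so some extension \<open>B\<close> makes it maximal, and then all extensions of \<open>B\<close> induce the same one. This
  is \<open>weak_amalgamation\<close>.

  The amalgam is a group of operators. Let \<open>W\<close> be a flag of length \<open>c + 1\<close> of abelian groups of exponent
  \<open>p\<close>. The additive bijections \<open>d\<close> for which \<open>d - 1\<close> raises the flag form a nilpotent group of class at
  most \<open>c\<close>, and \<open>d ^ p = (1 + (d - 1)) ^ p = 1 + (d - 1) ^ p = 1\<close> because \<open>p > c\<close>. It is thus enough to make both
  extensions of \<open>A\<close> act faithfully on one flag in such a way that \<open>A\<close> acts in the same way through both.
  A finite group \<open>G\<close> of the variety acts by translations on its functions with values of order \<open>p\<close>. Those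
  functions that are polynomial of bounded degree, where a difference operator along an element of the \<open>k\<close>-th
  term of the filtration lowers the degree by \<open>k\<close>, form such a flag. If the subgroup \<open>A\<close> is enlarged by
  one element \<open>g\<close> of weight \<open>w\<close> and order \<open>p\<close>, then a function on the larger group expands uniquely as
  \<open>f (a g\<^sup>t) = (\<Sum>i < p. (t choose i) f\<^sub>i a)\<close>, and \<open>f\<close> has degree less than \<open>n\<close> exactly when every coefficient
  \<open>f\<^sub>i\<close> has degree less than \<open>n - i w\<close> on \<open>A\<close> (\<open>deg_B_iff\<close>). So the functions on \<open>G\<close>, as a filtered
  representation of \<open>A\<close>, are a product of shifted copies of the functions on \<open>A\<close>. In a product with
  infinitely many copies for each degree bound the shifts can no longer be seen: its restriction to \<open>A\<close> is
  isomorphic to the corresponding product for \<open>A\<close> (\<open>degree_flag_restrict\<close>), and this product depends only on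
  \<open>A\<close> and the induced filtration. Both extensions therefore act on it
  (\<open>exists_unipotent_representation\<close>).
\<close>

section \<open>Commutators and central series\<close>

definition commutator :: "('a, 'b) monoid_scheme \<Rightarrow> 'a \<Rightarrow> 'a \<Rightarrow> 'a" where
  "commutator G x y = x \<otimes>\<^bsub>G\<^esub> y \<otimes>\<^bsub>G\<^esub> inv\<^bsub>G\<^esub> x \<otimes>\<^bsub>G\<^esub> inv\<^bsub>G\<^esub> y"

primrec upper_central_series :: "('a, 'b) monoid_scheme \<Rightarrow> nat \<Rightarrow> 'a set" where
  "upper_central_series G 0 = {\<one>\<^bsub>G\<^esub>}"
| "upper_central_series G (Suc n) =
     {x \<in> carrier G. \<forall>y \<in> carrier G. commutator G x y \<in> upper_central_series G n}"

text \<open>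
  The recursive equation spells out the commutator as a product; the proofs use the version in terms of
  \<^const>\<open>commutator\<close> instead.
\<close>

declare lower_central_series.simps(2) [simp del]

context group begin

lemma cancel_left: "\<lbrakk>x \<in> carrier G; y \<in> carrier G\<rbrakk> \<Longrightarrow> inv x \<otimes> (x \<otimes> y) = y"
  by (simp add: m_assoc [symmetric])

lemma cancel_left': "\<lbrakk>x \<in> carrier G; y \<in> carrier G\<rbrakk> \<Longrightarrow> x \<otimes> (inv x \<otimes> y) = y"
  by (simp add: m_assoc [symmetric])

lemmas word_simps = m_assoc inv_mult_group cancel_left cancel_left'

lemma commutator_closed [simp, intro]:
  "\<lbrakk>x \<in> carrier G; y \<in> carrier G\<rbrakk> \<Longrightarrow> commutator G x y \<in> carrier G"
  by (simp add: commutator_def)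

lemma inv_commutator:
  "\<lbrakk>x \<in> carrier G; y \<in> carrier G\<rbrakk> \<Longrightarrow> inv (commutator G x y) = commutator G y x"
  by (simp add: commutator_def word_simps)

lemma commutator_one [simp]: "y \<in> carrier G \<Longrightarrow> commutator G \<one> y = \<one>"
  "y \<in> carrier G \<Longrightarrow> commutator G y \<one> = \<one>"
  by (simp_all add: commutator_def)

lemma commutator_mult_left:
  "\<lbrakk>x \<in> carrier G; y \<in> carrier G; z \<in> carrier G\<rbrakk> \<Longrightarrow>
   commutator G (x \<otimes> y) z = x \<otimes> commutator G y z \<otimes> inv x \<otimes> commutator G x z"
  by (simp add: commutator_def word_simps)

lemma commutator_mult_right:
  "\<lbrakk>x \<in> carrier G; y \<in> carrier G; z \<in> carrier G\<rbrakk> \<Longrightarrow>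
   commutator G x (y \<otimes> z) = commutator G x y \<otimes> (y \<otimes> commutator G x z \<otimes> inv y)"
  by (simp add: commutator_def word_simps)

lemma commutator_inv_left:
  "\<lbrakk>x \<in> carrier G; y \<in> carrier G\<rbrakk> \<Longrightarrow>
   commutator G (inv x) y = inv x \<otimes> inv (commutator G x y) \<otimes> x"
  by (simp add: commutator_def word_simps)

lemma commutator_inv_right:
  "\<lbrakk>x \<in> carrier G; y \<in> carrier G\<rbrakk> \<Longrightarrow>
   commutator G x (inv y) = inv y \<otimes> inv (commutator G x y) \<otimes> y"
  by (simp add: commutator_def word_simps)

lemma conj_eq_commutator_mult:
  "\<lbrakk>x \<in> carrier G; z \<in> carrier G\<rbrakk> \<Longrightarrow> z \<otimes> x \<otimes> inv z = commutator G z x \<otimes> x"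
  by (simp add: commutator_def word_simps)

text \<open>
  The group analogue of the Jacobi identity; it holds already in free groups.
\<close>

lemma Hall_Witt:
  assumes "x \<in> carrier G" "y \<in> carrier G" "z \<in> carrier G"
  shows "(y \<otimes> commutator G x (commutator G (inv y) z) \<otimes> inv y) \<otimes>
         (z \<otimes> commutator G y (commutator G (inv z) x) \<otimes> inv z) \<otimes>
         (x \<otimes> commutator G z (commutator G (inv x) y) \<otimes> inv x) = \<one>"
  using assms by (simp add: commutator_def word_simps)

lemma normalI_conj:
  assumes "subgroup N G" "\<And>x z. \<lbrakk>x \<in> N; z \<in> carrier G\<rbrakk> \<Longrightarrow> z \<otimes> x \<otimes> inv z \<in> N"
  shows "N \<lhd> G"
  using assms normal_inv_iff by blast

lemma upper_central_series_normal: "upper_central_series G n \<lhd> G"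
proof (induction n)
  case 0
  show ?case by (simp add: one_is_normal)
next
  case (Suc n)
  let ?Z = "upper_central_series G n"
  interpret N: normal ?Z G by (rule Suc)
  have conj: "\<And>x z. \<lbrakk>x \<in> ?Z; z \<in> carrier G\<rbrakk> \<Longrightarrow> z \<otimes> x \<otimes> inv z \<in> ?Z"
    "\<And>x z. \<lbrakk>x \<in> ?Z; z \<in> carrier G\<rbrakk> \<Longrightarrow> inv z \<otimes> x \<otimes> z \<in> ?Z"
    by (auto simp: N.inv_op_closed2 N.inv_op_closed1)
  show ?case
  proof (rule normalI_conj)
    show "subgroup (upper_central_series G (Suc n)) G"
      by (rule subgroupI) (auto simp: commutator_mult_left commutator_inv_left conj intro: exI [of _ \<one>])
    fix x z assume x: "x \<in> upper_central_series G (Suc n)" and z: "z \<in> carrier G"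
    then have xc: "x \<in> carrier G" by simp
    show "z \<otimes> x \<otimes> inv z \<in> upper_central_series G (Suc n)"
    proof (simp add: xc z, intro ballI)
      fix y assume y: "y \<in> carrier G"
      have "z \<otimes> commutator G x (inv z \<otimes> y \<otimes> z) \<otimes> inv z = commutator G (z \<otimes> x \<otimes> inv z) y"
        using xc y z by (simp add: commutator_def word_simps)
      moreover have "commutator G x (inv z \<otimes> y \<otimes> z) \<in> ?Z" using x y z by simp
      ultimately show "commutator G (z \<otimes> x \<otimes> inv z) y \<in> ?Z" using conj(1) z by metis
    qed
  qed
qed

lemma lower_central_series_Suc_commutator:
  "lower_central_series G (Suc n) =
     generate G {commutator G x y |x y. x \<in> lower_central_series G n \<and> y \<in> carrier G}"
  unfolding commutator_def lower_central_series.simps by (rule arg_cong [where f = "generate G"]) blast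

lemma lower_central_series_subset: "lower_central_series G n \<subseteq> carrier G"
proof (induction n)
  case (Suc n)
  then show ?case
    unfolding lower_central_series_Suc_commutator by (intro generate_incl) auto
qed simp


lemma lower_central_series_commutator:
  assumes "x \<in> lower_central_series G n" "y \<in> carrier G"
  shows "commutator G x y \<in> lower_central_series G (Suc n)"
  unfolding lower_central_series_Suc_commutator using assms by (blast intro: generate.incl)

lemma lower_central_series_subgroup: "subgroup (lower_central_series G n) G"
proof (cases n)
  case (Suc m)
  show ?thesis
    unfolding Suc lower_central_series_Suc_commutator
    using lower_central_series_subset by (intro generate_is_subgroup) auto
qed (simp add: subgroup_self)

lemma lower_central_series_antimono: "lower_central_series G (Suc n) \<subseteq> lower_central_series G n"
  and lower_central_series_normal: "lower_central_series G n \<lhd> G"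
proof (induction n)
  case 0
  case 1
  show ?case using lower_central_series_subset by simp
  case 2
  show ?case by (simp add: normal_invI subgroup_self)
next
  case (Suc n)
  let ?L = "lower_central_series G"
  interpret L: normal "?L n" G by (rule Suc)
  have step: "?L (Suc m) \<subseteq> ?L m" if "?L m \<lhd> G" for m
  proof -
    interpret M: normal "?L m" G by (rule that)
    have "commutator G x y \<in> ?L m" if "x \<in> ?L m" "y \<in> carrier G" for x y
    proof -
      have "x \<otimes> (y \<otimes> inv x \<otimes> inv y) \<in> ?L m" using that by (intro M.m_closed M.inv_op_closed2) auto
      then show ?thesis using that M.mem_carrier by (simp add: commutator_def m_assoc)
    qed
    then show ?thesis
      unfolding lower_central_series_Suc_commutator by (intro generate_subgroup_incl M.subgroup_axioms) auto
  qed
  have N: "?L (Suc n) \<lhd> G"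
    unfolding normal_inv_iff
  proof (intro conjI ballI)
    show "subgroup (?L (Suc n)) G" by (rule lower_central_series_subgroup)
    fix z h assume z: "z \<in> carrier G" and h: "h \<in> ?L (Suc n)"
    have hn: "h \<in> ?L n" using h step [OF Suc(2)] by blast
    have "z \<otimes> h \<otimes> inv z = inv (commutator G h z) \<otimes> h"
      using z L.mem_carrier [OF hn] by (simp add: commutator_def word_simps)
    then show "z \<otimes> h \<otimes> inv z \<in> ?L (Suc n)"
      using lower_central_series_commutator [OF hn z] h lower_central_series_subgroup [of "Suc n"]
      by (simp add: subgroup.m_closed subgroup.m_inv_closed)
  qed
  case 1
  show ?case by (rule step [OF N])
  case 2
  show ?case by (rule N)
qed

text \<open>
  Modulo the normal subgroup on the right the elements \<open>u\<close> with \<open>[x, u]\<close> trivial for all \<open>x\<close> in the \<open>i\<close>-th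
  term form a subgroup, so only generators \<open>u = [y, z]\<close> of the next term have to be considered. For these
  the Hall-Witt identity, applied to \<open>x\<close>, the inverse of \<open>y\<close>, and \<open>z\<close>, expresses a conjugate of
  \<open>[x, [y, z]]\<close> through two commutators that are covered by the induction hypothesis for \<open>j\<close>. The index
  is shifted by one against the usual numbering, which accounts for the successor.
\<close>

lemma lower_central_series_commutator_le:
  "\<lbrakk>x \<in> lower_central_series G i; y \<in> lower_central_series G j\<rbrakk>
   \<Longrightarrow> commutator G x y \<in> lower_central_series G (Suc (i + j))"
proof (induction j arbitrary: i x y)
  case 0
  then show ?case using lower_central_series_commutator [of x i y] by simp
next
  case (Suc j)
  let ?L = "lower_central_series G"
  interpret N: normal "?L (Suc (i + Suc j))" G by (rule lower_central_series_normal)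
  have Lc: "\<And>u n. u \<in> ?L n \<Longrightarrow> u \<in> carrier G" using lower_central_series_subset by blast
  have Linv: "\<And>u n. u \<in> ?L n \<Longrightarrow> inv u \<in> ?L n"
    by (rule subgroup.m_inv_closed [OF lower_central_series_subgroup])
  have swap: "commutator G u v \<in> ?L n" if "commutator G v u \<in> ?L n" "u \<in> carrier G" "v \<in> carrier G" for u v n
    using Linv [OF that(1)] inv_commutator [OF that(3,2)] by simp
  define C where "C = {u \<in> carrier G. \<forall>x \<in> ?L i. commutator G x u \<in> ?L (Suc (i + Suc j))}"
  have conj: "z \<otimes> u \<otimes> inv z \<in> ?L (Suc (i + Suc j))" "inv z \<otimes> u \<otimes> z \<in> ?L (Suc (i + Suc j))"
    if "u \<in> ?L (Suc (i + Suc j))" "z \<in> carrier G" for u z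
    using N.inv_op_closed2 [OF that(2,1)] N.inv_op_closed1 [OF that(2,1)] by simp_all
  have "subgroup C G"
  proof (rule subgroupI)
    show "C \<subseteq> carrier G" unfolding C_def by auto
    show "C \<noteq> {}" unfolding C_def using Lc N.one_closed by (auto intro!: exI [of _ \<one>])
    fix u assume u: "u \<in> C"
    then show "inv u \<in> C"
      unfolding C_def by (simp add: commutator_inv_right conj [simplified] N.m_inv_closed [simplified] Lc)
    fix v assume "v \<in> C"
    then show "u \<otimes> v \<in> C"
      using u unfolding C_def by (simp add: commutator_mult_right conj [simplified] N.m_closed [simplified] Lc)
  qed
  moreover have "commutator G y z \<in> C" if y: "y \<in> ?L j" and z: "z \<in> carrier G" for y z
  proof -
    have "commutator G x (commutator G y z) \<in> ?L (Suc (i + Suc j))" if x: "x \<in> ?L i" for x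
    proof -
      note c = Lc [OF x] Lc [OF y] z
      define a where "a = commutator G x (commutator G y z)"
      define b where "b = z \<otimes> commutator G (inv y) (commutator G (inv z) x) \<otimes> inv z"
      define d where "d = x \<otimes> commutator G z (commutator G (inv x) (inv y)) \<otimes> inv x"
      have "commutator G (inv z) x \<in> ?L (Suc i)"
        using x c by (intro swap [OF lower_central_series_commutator]) simp_all
      then have "commutator G (inv y) (commutator G (inv z) x) \<in> ?L (Suc (Suc i + j))"
        using c by (intro swap [OF Suc.IH [OF _ Linv [OF y]]]) simp_all
      then have "commutator G (inv y) (commutator G (inv z) x) \<in> ?L (Suc (i + Suc j))" by simp
      then have b: "b \<in> ?L (Suc (i + Suc j))" unfolding b_def using c by (intro conj)
      have "commutator G (inv x) (inv y) \<in> ?L (Suc (i + j))"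
        using Suc.IH [OF Linv [OF x] Linv [OF y]] .
      then have "commutator G z (commutator G (inv x) (inv y)) \<in> ?L (Suc (i + Suc j))"
        using c by (intro swap [OF lower_central_series_commutator [of _ "i + Suc j" z]]) simp_all
      then have d: "d \<in> ?L (Suc (i + Suc j))" unfolding d_def using c by (intro conj)
      have ac: "a \<in> carrier G" unfolding a_def using c by simp
      have bc: "b \<in> carrier G" "d \<in> carrier G" using b d Lc by blast+
      have "(inv y \<otimes> a \<otimes> y) \<otimes> b \<otimes> d = \<one>"
        using Hall_Witt [of x "inv y" z] c unfolding a_def b_def d_def by simp
      then have "inv y \<otimes> a \<otimes> y = inv (b \<otimes> d)"
        using ac bc c by (metis inv_equality inv_closed m_assoc m_closed inv_inv)
      then have "a = y \<otimes> inv (b \<otimes> d) \<otimes> inv y"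
        using ac bc c by (metis cancel_left' inv_closed m_assoc m_closed r_inv r_one)
      moreover have "y \<otimes> inv (b \<otimes> d) \<otimes> inv y \<in> ?L (Suc (i + Suc j))"
        using b d c by (intro conj N.m_inv_closed N.m_closed)
      ultimately show ?thesis by (simp add: a_def)
    qed
    then show ?thesis unfolding C_def using Lc [OF y] z by auto
  qed
  ultimately have "?L (Suc j) \<subseteq> C"
    unfolding lower_central_series_Suc_commutator by (intro generate_subgroup_incl) auto
  then show ?case using Suc.prems unfolding C_def by blast
qed

lemma upper_central_series_iff:
  "x \<in> upper_central_series G n \<longleftrightarrow>
   x \<in> carrier G \<and> (\<forall>ys. set ys \<subseteq> carrier G \<and> length ys = n \<longrightarrow> foldl (commutator G) x ys = \<one>)"
proof (induction n arbitrary: x)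
  case 0
  show ?case by auto
next
  case (Suc n)
  have "(\<forall>ys. set ys \<subseteq> carrier G \<and> length ys = Suc n \<longrightarrow> foldl (commutator G) x ys = \<one>) \<longleftrightarrow>
     (\<forall>y \<in> carrier G. \<forall>ys. set ys \<subseteq> carrier G \<and> length ys = n \<longrightarrow> foldl (commutator G) (commutator G x y) ys = \<one>)"
    (is "?l \<longleftrightarrow> ?r")
  proof
    assume ?l
    show ?r
    proof (intro ballI allI impI)
      fix y ys assume "y \<in> carrier G" "set ys \<subseteq> carrier G \<and> length ys = n"
      then show "foldl (commutator G) (commutator G x y) ys = \<one>" using \<open>?l\<close> [rule_format, of "y # ys"] by simp
    qed
  next
    assume ?r
    show ?l
    proof (intro allI impI)
      fix ys assume "set ys \<subseteq> carrier G \<and> length ys = Suc n"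
      then show "foldl (commutator G) x ys = \<one>" using \<open>?r\<close> by (cases ys) auto
    qed
  qed
  then show ?case using Suc.IH by auto
qed

text \<open>
  One may move steps from the lower to the upper central series because membership of all generating
  commutators in a subgroup decides the inclusion. For \<open>m = 0\<close> this turns nilpotency into the vanishing of
  commutator words.
\<close>

lemma lower_central_series_subset_upper_central_series:
  "lower_central_series G k \<subseteq> upper_central_series G m \<longleftrightarrow>
   carrier G \<subseteq> upper_central_series G (m + k)"
proof (induction k arbitrary: m)
  case (Suc k)
  have Lc: "\<And>u n. u \<in> lower_central_series G n \<Longrightarrow> u \<in> carrier G" using lower_central_series_subset by blast
  have "subgroup (upper_central_series G m) G"
    using upper_central_series_normal normal_imp_subgroup by blast
  then have "lower_central_series G (Suc k) \<subseteq> upper_central_series G m \<longleftrightarrow>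
     {commutator G x y |x y. x \<in> lower_central_series G k \<and> y \<in> carrier G} \<subseteq> upper_central_series G m"
    unfolding lower_central_series_Suc_commutator
    by (metis (no_types, lifting) generate.incl generate_subgroup_incl subset_iff)
  also have "\<dots> \<longleftrightarrow> lower_central_series G k \<subseteq> upper_central_series G (Suc m)"
    unfolding upper_central_series.simps using Lc by blast
  finally show ?case using Suc.IH [of "Suc m"] by simp
qed simp

end

section \<open>The variety and embeddings\<close>

text \<open>
  Nilpotency is stated through words, since identities pass to subgroups and products and define closed sets.
\<close>

definition in_variety :: "nat \<Rightarrow> nat \<Rightarrow> ('a, 'b) monoid_scheme \<Rightarrow> bool" where
  "in_variety c p G \<longleftrightarrow> group G \<and>
     (\<forall>x ys. x \<in> carrier G \<and> set ys \<subseteq> carrier G \<and> length ys = c \<longrightarrow> foldl (commutator G) x ys = \<one>\<^bsub>G\<^esub>) \<and>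
     (\<forall>x \<in> carrier G. x [^]\<^bsub>G\<^esub> p = \<one>\<^bsub>G\<^esub>)"

lemma in_variety_iff: "in_variety c p G \<longleftrightarrow> nilpotent_of_class_le G c \<and> satisfies_exponent G p"
proof (cases "group G")
  case True
  then interpret group G .
  have "lower_central_series G c = {\<one>\<^bsub>G\<^esub>} \<longleftrightarrow> lower_central_series G c \<subseteq> upper_central_series G 0"
    using lower_central_series_subgroup [THEN subgroup.one_closed, of c] by auto
  also have "\<dots> \<longleftrightarrow> carrier G \<subseteq> upper_central_series G c"
    using lower_central_series_subset_upper_central_series [of c 0] by simp
  finally show ?thesis
    using True unfolding in_variety_def nilpotent_of_class_le_def satisfies_exponent_def
    by (auto simp: upper_central_series_iff subset_iff)
qed (auto simp: in_variety_def nilpotent_of_class_le_def)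


lemma in_varietyD:
  assumes "in_variety c p G"
  shows in_variety_group: "group G"
    and in_variety_exponent: "x \<in> carrier G \<Longrightarrow> x [^]\<^bsub>G\<^esub> p = \<one>\<^bsub>G\<^esub>"
    and in_variety_lower_central_series: "lower_central_series G c = {\<one>\<^bsub>G\<^esub>}"
  using assms unfolding in_variety_iff nilpotent_of_class_le_def satisfies_exponent_def by auto

definition embedding :: "('a \<Rightarrow> 'b) \<Rightarrow> ('a, 'c) monoid_scheme \<Rightarrow> ('b, 'd) monoid_scheme \<Rightarrow> bool" where
  "embedding f G H \<longleftrightarrow> f \<in> hom G H \<and> inj_on f (carrier G)"

lemma embedding_mult:
  "\<lbrakk>embedding f G H; x \<in> carrier G; y \<in> carrier G\<rbrakk> \<Longrightarrow> f (x \<otimes>\<^bsub>G\<^esub> y) = f x \<otimes>\<^bsub>H\<^esub> f y"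
  by (simp add: embedding_def hom_mult)

lemma embedding_closed: "\<lbrakk>embedding f G H; x \<in> carrier G\<rbrakk> \<Longrightarrow> f x \<in> carrier H"
  unfolding embedding_def by (auto simp: hom_def)

lemma embedding_eq_iff:
  "\<lbrakk>embedding f G H; x \<in> carrier G; y \<in> carrier G\<rbrakk> \<Longrightarrow> f x = f y \<longleftrightarrow> x = y"
  unfolding embedding_def by (metis inj_onD)

lemma embedding_comp:
  assumes "embedding f G H" "embedding g H K"
  shows "embedding (g \<circ> f) G K"
proof -
  have "f ` carrier G \<subseteq> carrier H" using embedding_closed [OF assms(1)] by blast
  then have "inj_on (g \<circ> f) (carrier G)"
    using assms unfolding embedding_def by (meson comp_inj_on inj_on_subset)
  moreover have "g \<circ> f \<in> hom G K"
    using assms unfolding embedding_def by (auto simp: hom_def Pi_iff)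
  ultimately show ?thesis by (simp add: embedding_def)
qed

lemma embedding_one: "\<lbrakk>embedding f G H; group G; group H\<rbrakk> \<Longrightarrow> f \<one>\<^bsub>G\<^esub> = \<one>\<^bsub>H\<^esub>"
  by (simp add: embedding_def hom_one)

lemma embedding_inv:
  "\<lbrakk>embedding f G H; group G; group H; x \<in> carrier G\<rbrakk> \<Longrightarrow> f (inv\<^bsub>G\<^esub> x) = inv\<^bsub>H\<^esub> f x"
  by (simp add: embedding_def group_hom.hom_inv group_hom.intro group_hom_axioms.intro)

lemma embedding_commutator:
  assumes "embedding f G H" "group G" "group H" "x \<in> carrier G" "y \<in> carrier G"
  shows "f (commutator G x y) = commutator H (f x) (f y)"
proof -
  interpret G: group G by fact
  show ?thesis using assms unfolding commutator_def
    by (simp add: embedding_mult embedding_inv)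
qed

lemma embedding_foldl_commutator:
  assumes "embedding f G H" "group G" "group H" "x \<in> carrier G" "set ys \<subseteq> carrier G"
  shows "f (foldl (commutator G) x ys) = foldl (commutator H) (f x) (map f ys)"
  using assms(4,5)
proof (induction ys arbitrary: x)
  case (Cons y ys)
  then show ?case using group.commutator_closed [OF assms(2)]
    by (simp add: embedding_commutator [OF assms(1-3)])
qed simp

lemma (in group) foldl_commutator_closed:
  "\<lbrakk>x \<in> carrier G; set ys \<subseteq> carrier G\<rbrakk> \<Longrightarrow> foldl (commutator G) x ys \<in> carrier G"
  by (induction ys arbitrary: x) auto

lemma embedding_pow:
  assumes "embedding f G H" "group G" "group H" "x \<in> carrier G"
  shows "f (x [^]\<^bsub>G\<^esub> (n::nat)) = f x [^]\<^bsub>H\<^esub> n"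
  by (rule sym, rule group_hom.hom_nat_pow [symmetric])
     (use assms in \<open>auto simp: embedding_def group_hom_def group_hom_axioms_def\<close>)

lemma in_variety_embedding:
  assumes e: "embedding f G H" and G: "group G" and H: "in_variety c p H"
  shows "in_variety c p G"
proof -
  interpret G: group G by fact
  have H': "group H" using H by (rule in_variety_group)
  have one: "u = \<one>\<^bsub>G\<^esub>" if "f u = \<one>\<^bsub>H\<^esub>" "u \<in> carrier G" for u
    using that embedding_eq_iff [OF e that(2) G.one_closed] embedding_one [OF e G H'] by simp
  show ?thesis unfolding in_variety_def
  proof (intro conjI allI impI ballI G)
    fix x ys assume "x \<in> carrier G \<and> set ys \<subseteq> carrier G \<and> length ys = c"
    then have a: "x \<in> carrier G" "set ys \<subseteq> carrier G" "length ys = c" by auto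
    have "f ` set ys \<subseteq> carrier H" using a embedding_closed [OF e] by auto
    then have "foldl (commutator H) (f x) (map f ys) = \<one>\<^bsub>H\<^esub>"
      using H embedding_closed [OF e a(1)] a(3) unfolding in_variety_def by auto
    then show "foldl (commutator G) x ys = \<one>\<^bsub>G\<^esub>"
      using embedding_foldl_commutator [OF e G H' a(1,2)] G.foldl_commutator_closed [OF a(1,2)] by (intro one) auto
  next
    fix x assume x: "x \<in> carrier G"
    then show "x [^]\<^bsub>G\<^esub> p = \<one>\<^bsub>G\<^esub>"
      using embedding_pow [OF e G H' x, of p] in_variety_exponent [OF H embedding_closed [OF e x]]
      by (intro one) auto
  qed
qed

lemma embedding_subgroup: "subgroup S G \<Longrightarrow> embedding id (G\<lparr>carrier := S\<rparr>) G"
  by (auto simp: embedding_def hom_def dest: subgroup.mem_carrier)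

lemma in_variety_subgroup:
  assumes "in_variety c p G" "subgroup S G"
  shows "in_variety c p (G\<lparr>carrier := S\<rparr>)"
  using in_variety_embedding [OF embedding_subgroup [OF assms(2)]] assms
    group.subgroup_imp_group in_variety_group by blast

lemma lower_central_series_embedding:
  assumes e: "embedding f G H" and G: "group G" and H: "group H"
  shows "x \<in> lower_central_series G n \<Longrightarrow> f x \<in> lower_central_series H n"
proof (induction n arbitrary: x)
  case 0
  then show ?case using embedding_closed [OF e] by simp
next
  case (Suc n)
  interpret G: group G by fact
  interpret H: group H by fact
  have "x \<in> generate G {commutator G x y |x y. x \<in> lower_central_series G n \<and> y \<in> carrier G}"
    using Suc.prems unfolding G.lower_central_series_Suc_commutator .
  then show ?case
  proof (induction rule: generate.induct)
    case one
    show ?case using embedding_one [OF e G H] H.lower_central_series_subgroup [THEN subgroup.one_closed] by simp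
  next
    case (incl h)
    then show ?case
    proof -
      obtain u v where uv: "h = commutator G u v" "u \<in> lower_central_series G n" "v \<in> carrier G"
        using incl by auto
      then have "u \<in> carrier G" using G.lower_central_series_subset by blast
      with uv show ?thesis
        using embedding_commutator [OF e G H, of u v] Suc.IH [of u]
          H.lower_central_series_commutator [of "f u" n "f v"] embedding_closed [OF e] by simp
    qed
  next
    case (inv h)
    then obtain u v where uv: "h = commutator G u v" "u \<in> lower_central_series G n" "v \<in> carrier G" by auto
    have uc: "u \<in> carrier G" using uv G.lower_central_series_subset by blast
    have "f (inv\<^bsub>G\<^esub> h) = inv\<^bsub>H\<^esub> (commutator H (f u) (f v))"
      using uv uc embedding_inv [OF e G H] embedding_commutator [OF e G H] by simp
    moreover have "commutator H (f u) (f v) \<in> lower_central_series H (Suc n)"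
      using uv Suc.IH H.lower_central_series_commutator embedding_closed [OF e] by blast
    ultimately show ?case using H.lower_central_series_subgroup subgroup.m_inv_closed by metis
  next
    case (eng h1 h2)
    have "{commutator G x y |x y. x \<in> lower_central_series G n \<and> y \<in> carrier G} \<subseteq> carrier G"
      using G.lower_central_series_subset by blast
    then have "h1 \<in> carrier G" "h2 \<in> carrier G" using eng.hyps G.generate_in_carrier by blast+
    then show ?case
      using eng.IH embedding_mult [OF e] H.lower_central_series_subgroup subgroup.m_closed by metis
  qed
qed


section \<open>Local finiteness\<close>

text \<open>
  If the elements of \<open>Y\<close> are central modulo \<open>N\<close>, then the subgroup they generate is abelian of finite
  exponent modulo \<open>N\<close>; the set \<open>E\<close> contains representatives of its elements.
\<close>

lemma (in group) finite_span_modulo: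
  assumes N: "N \<lhd> G" and Y: "finite Y" "Y \<subseteq> carrier G"
    and comm: "\<And>y g. \<lbrakk>y \<in> Y; g \<in> carrier G\<rbrakk> \<Longrightarrow> commutator G y g \<in> N"
    and exponent: "\<And>x. x \<in> carrier G \<Longrightarrow> x [^] (p::nat) = \<one>" and p: "p > 0"
  shows "\<exists>E. finite E \<and> E \<subseteq> carrier G \<and> \<one> \<in> E \<and> (\<forall>y \<in> Y. \<forall>e \<in> E. \<exists>e' \<in> E. \<exists>z \<in> N. y \<otimes> e = e' \<otimes> z)"
  using Y comm
proof (induction Y rule: finite_induct)
  case empty
  show ?case by (rule exI [of _ "{\<one>}"]) auto
next
  case (insert y Y)
  interpret N: normal N G by (rule N)
  have "\<exists>E. finite E \<and> E \<subseteq> carrier G \<and> \<one> \<in> E \<and> (\<forall>y \<in> Y. \<forall>e \<in> E. \<exists>e' \<in> E. \<exists>z \<in> N. y \<otimes> e = e' \<otimes> z)"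
    by (rule insert.IH) (use insert.prems in simp_all)
  then obtain E where E': "finite E \<and> E \<subseteq> carrier G \<and> \<one> \<in> E \<and>
      (\<forall>y \<in> Y. \<forall>e \<in> E. \<exists>e' \<in> E. \<exists>z \<in> N. y \<otimes> e = e' \<otimes> z)"
    by (rule exE)
  then have E: "finite E" "E \<subseteq> carrier G" "\<one> \<in> E"
    "\<And>v e. \<lbrakk>v \<in> Y; e \<in> E\<rbrakk> \<Longrightarrow> \<exists>e' \<in> E. \<exists>z \<in> N. v \<otimes> e = e' \<otimes> z"
    by blast+
  have y: "y \<in> carrier G" using insert by auto
  \<comment> \<open>Left multiplication by \<open>y\<close> raises the exponent cyclically; another generator is moved past the power of \<open>y\<close>.\<close>
  define E' where "E' = (\<lambda>(k, e). y [^] k \<otimes> e) ` ({..<p} \<times> E)"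
  have E'I: "y [^] k \<otimes> e \<in> E'" if "k < p" "e \<in> E" for k e
    using that unfolding E'_def by auto
  have "\<exists>e' \<in> E'. \<exists>z \<in> N. v \<otimes> (y [^] k \<otimes> e) = e' \<otimes> z"
    if v: "v \<in> insert y Y" and k: "k < p" and e: "e \<in> E" for v k e
  proof (cases "v = y")
    case True
    have ec: "e \<in> carrier G" using e E by auto
    have eq: "v \<otimes> (y [^] k \<otimes> e) = y [^] Suc k \<otimes> e"
      using y True ec by (metis m_assoc nat_pow_Suc2 nat_pow_closed)
    show ?thesis
    proof (cases "Suc k = p")
      case True
      then have "v \<otimes> (y [^] k \<otimes> e) = (y [^] (0::nat) \<otimes> e) \<otimes> \<one>"
        using eq exponent [OF y] ec by simp
      then show ?thesis using E'I [of 0 e] p e N.one_closed by blast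
    next
      case False
      then have "v \<otimes> (y [^] k \<otimes> e) = (y [^] Suc k \<otimes> e) \<otimes> \<one>"
        using eq ec y by simp
      then show ?thesis using E'I [of "Suc k" e] False k e N.one_closed by (metis Suc_lessI)
    qed
  next
    case False
    then have vY: "v \<in> Y" using v by auto
    have vc: "v \<in> carrier G" using vY insert by auto
    obtain e' z where e': "e' \<in> E" "z \<in> N" "v \<otimes> e = e' \<otimes> z" using E(4) [OF vY e] by blast
    have ec: "e \<in> carrier G" "e' \<in> carrier G" "z \<in> carrier G" using e e' E N.mem_carrier by auto
    define q where "q = y [^] k"
    have qc: "q \<in> carrier G" using y by (simp add: q_def)
    \<comment> \<open>The correction that arises when \<open>v\<close> is moved past \<open>q\<close>.\<close>
    define w where "w = inv e \<otimes> (inv v \<otimes> (inv q \<otimes> commutator G v q \<otimes> q) \<otimes> v) \<otimes> e"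
    have "commutator G v q \<in> N" using insert.prems(2) vY qc by auto
    then have wN: "w \<in> N" unfolding w_def
      using qc vc ec by (intro N.inv_op_closed1) auto
    have "v \<otimes> (q \<otimes> e) = q \<otimes> (v \<otimes> e) \<otimes> w"
      unfolding w_def commutator_def using qc vc ec by (simp add: word_simps)
    also have "\<dots> = (q \<otimes> e') \<otimes> (z \<otimes> w)"
      unfolding e'(3) using qc ec wN N.mem_carrier by (simp add: m_assoc)
    finally show ?thesis using E'I [OF k e'(1)] e'(2) wN unfolding q_def by (metis N.m_closed)
  qed
  moreover have "finite E'" "E' \<subseteq> carrier G"
    unfolding E'_def using E y by auto
  moreover have "\<one> \<in> E'" using E'I [of 0 \<one>] E p by simp
  moreover have "\<exists>k e. x = y [^] k \<otimes> e \<and> k < p \<and> e \<in> E" if "x \<in> E'" for x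
    using that unfolding E'_def by auto
  ultimately show ?case by (intro exI [of _ E'] conjI ballI) blast+
qed

text \<open>
  By descending induction \<open>G\<close> is covered by finitely many cosets of each term of the upper central series;
  the last term is trivial. If \<open>T\<close> represents the cosets of one term, then multiplying \<open>T\<close> by generators
  from the left produces only finitely many corrections, which lie in that term and are therefore
  central modulo the next one. Since they span a finite group modulo the next term, the set \<open>M\<close> of products
  is stable under the generators, hence equal to \<open>G\<close>.
\<close>

lemma (in group) finitely_generated_finite:
  assumes V: "in_variety c p G" and p: "p > 0" and S: "finite S" "carrier G = generate G S"
  shows "finite (carrier G)"
proof -
  have exponent: "\<And>x. x \<in> carrier G \<Longrightarrow> x [^] p = \<one>" using in_variety_exponent [OF V] .
  let ?Z = "upper_central_series G"
  have Sc: "S \<subseteq> carrier G" unfolding S(2) by (auto intro: generate.incl)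
  have invpow: "inv x = x [^] (p - 1)" if "x \<in> carrier G" for x
    using that exponent [OF that] p by (metis Suc_pred' inv_equality nat_pow_Suc nat_pow_closed)
  \<comment> \<open>Inverses of generators are positive powers, so stability under left multiplication by generators suffices.\<close>
  have ind: "M = carrier G"
    if M: "M \<subseteq> carrier G" "\<one> \<in> M" and closed: "\<And>s x. \<lbrakk>s \<in> S; x \<in> M\<rbrakk> \<Longrightarrow> s \<otimes> x \<in> M" for M
  proof -
    have pw: "s [^] (n::nat) \<otimes> x \<in> M" if "s \<in> S" "x \<in> M" for s x n
      using that
    proof (induction n)
      case (Suc n)
      have "s [^] Suc n \<otimes> x = s \<otimes> (s [^] n \<otimes> x)"
        using Suc.prems Sc M by (metis m_assoc nat_pow_Suc2 nat_pow_closed subsetD)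
      then show ?case using Suc closed by simp
    qed (use M in auto)
    have "\<forall>x \<in> M. g \<otimes> x \<in> M" if "g \<in> generate G S" for g
      using that
    proof (induction rule: generate.induct)
      case (inv h)
      then show ?case using pw [of h _ "p - 1"] invpow Sc by auto
    next
      case (eng h1 h2)
      then have "h1 \<in> carrier G" "h2 \<in> carrier G" using S(2) by auto
      then show ?case using eng.IH M by (metis m_assoc subsetD)
    qed (use M closed in auto)
    then have "generate G S \<subseteq> M" using M S(2) by (metis r_one subsetI)
    then show ?thesis using M S(2) by blast
  qed
  have "\<exists>T. finite T \<and> T \<subseteq> carrier G \<and> \<one> \<in> T \<and> (\<forall>x \<in> carrier G. \<exists>t \<in> T. \<exists>z \<in> ?Z (c - n). x = t \<otimes> z)"
    if "n \<le> c" for n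
    using that
  proof (induction n)
    case 0
    have "carrier G \<subseteq> ?Z c"
      using lower_central_series_subset_upper_central_series [of c 0] in_variety_lower_central_series [OF V] by simp
    then show ?case by (intro exI [of _ "{\<one>}"]) (auto intro: l_one [symmetric])
  next
    case (Suc n)
    define m where "m = c - Suc n"
    have m: "c - n = Suc m" using Suc.prems unfolding m_def by simp
    interpret N: normal "?Z m" G by (rule upper_central_series_normal)
    have "\<exists>T. finite T \<and> T \<subseteq> carrier G \<and> \<one> \<in> T \<and> (\<forall>x \<in> carrier G. \<exists>t \<in> T. \<exists>z \<in> ?Z (Suc m). x = t \<otimes> z)"
      unfolding m [symmetric] using Suc.prems by (intro Suc.IH) simp
    then obtain T where "finite T \<and> T \<subseteq> carrier G \<and> \<one> \<in> T \<and> (\<forall>x \<in> carrier G. \<exists>t \<in> T. \<exists>z \<in> ?Z (Suc m). x = t \<otimes> z)"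
      by (rule exE)
    then have T: "finite T" "T \<subseteq> carrier G" "\<one> \<in> T"
       "\<And>x. x \<in> carrier G \<Longrightarrow> \<exists>t \<in> T. \<exists>z \<in> ?Z (Suc m). x = t \<otimes> z"
      by blast+
    have "\<exists>t' z. t' \<in> T \<and> z \<in> ?Z (Suc m) \<and> s \<otimes> t = t' \<otimes> z" if "s \<in> S" "t \<in> T" for s t
      using T(4) [of "s \<otimes> t"] that Sc T(2) by blast
    then obtain r y where ry: "\<And>s t. \<lbrakk>s \<in> S; t \<in> T\<rbrakk> \<Longrightarrow> r s t \<in> T \<and> y s t \<in> ?Z (Suc m) \<and> s \<otimes> t = r s t \<otimes> y s t"
      by metis
    define Y where "Y = (\<lambda>(s, t). y s t) ` (S \<times> T)"
    have YZ: "Y \<subseteq> ?Z (Suc m)" using ry unfolding Y_def by auto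
    have Y: "finite Y" "Y \<subseteq> carrier G" "\<And>v g. \<lbrakk>v \<in> Y; g \<in> carrier G\<rbrakk> \<Longrightarrow> commutator G v g \<in> ?Z m"
      using YZ S(1) T(1) by (auto simp: Y_def)
    obtain E where "finite E \<and> E \<subseteq> carrier G \<and> \<one> \<in> E \<and>
        (\<forall>v \<in> Y. \<forall>e \<in> E. \<exists>e' \<in> E. \<exists>z \<in> ?Z m. v \<otimes> e = e' \<otimes> z)"
      using finite_span_modulo [OF upper_central_series_normal Y exponent p] by (rule exE)
    then have E: "finite E" "E \<subseteq> carrier G" "\<one> \<in> E"
      "\<And>v e. \<lbrakk>v \<in> Y; e \<in> E\<rbrakk> \<Longrightarrow> \<exists>e' \<in> E. \<exists>z \<in> ?Z m. v \<otimes> e = e' \<otimes> z"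
      by blast+
    define M where "M = {t \<otimes> e \<otimes> z |t e z. t \<in> T \<and> e \<in> E \<and> z \<in> ?Z m}"
    have "M = carrier G"
    proof (rule ind)
      show "M \<subseteq> carrier G"
      proof
        fix x assume "x \<in> M"
        then obtain t e z where "x = t \<otimes> e \<otimes> z" "t \<in> T" "e \<in> E" "z \<in> ?Z m" unfolding M_def by blast
        then show "x \<in> carrier G" using subsetD [OF T(2)] subsetD [OF E(2)] N.mem_carrier by simp
      qed
      have "\<one> = \<one> \<otimes> \<one> \<otimes> \<one>" by simp
      then show "\<one> \<in> M" unfolding M_def using T(3) E(3) N.one_closed by blast
      fix s x assume s: "s \<in> S" and "x \<in> M"
      then obtain t e z where x: "x = t \<otimes> e \<otimes> z" "t \<in> T" "e \<in> E" "z \<in> ?Z m" unfolding M_def by auto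
      have "y s t \<in> Y" unfolding Y_def using s x by auto
      then obtain e' z' where e': "e' \<in> E" "z' \<in> ?Z m" "y s t \<otimes> e = e' \<otimes> z'" using E(4) x by blast
      have c: "s \<in> carrier G" "t \<in> carrier G" "e \<in> carrier G" "z \<in> carrier G" "e' \<in> carrier G" "z' \<in> carrier G"
        "r s t \<in> carrier G" "y s t \<in> carrier G"
        using s x e' E T Sc N.mem_carrier ry [OF s x(2)] by auto
      have "s \<otimes> x = (s \<otimes> t) \<otimes> e \<otimes> z" using x c by (simp add: m_assoc)
      also have "\<dots> = r s t \<otimes> (y s t \<otimes> e) \<otimes> z" using ry [OF s x(2)] c by (simp add: m_assoc)
      also have "\<dots> = r s t \<otimes> e' \<otimes> (z' \<otimes> z)" unfolding e'(3) using c by (simp add: m_assoc)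
      finally have "s \<otimes> x = r s t \<otimes> e' \<otimes> (z' \<otimes> z)" .
      moreover have "z' \<otimes> z \<in> ?Z m" using e'(2) x(4) by (rule N.m_closed)
      ultimately show "s \<otimes> x \<in> M" unfolding M_def using ry [OF s x(2)] e'(1) by blast
    qed
    then have "\<exists>t \<in> (\<lambda>(t, e). t \<otimes> e) ` (T \<times> E). \<exists>z \<in> ?Z m. x = t \<otimes> z" if "x \<in> carrier G" for x
      using that unfolding M_def by fastforce
    moreover have "\<one> \<in> (\<lambda>(t, e). t \<otimes> e) ` (T \<times> E)" using T(3) E(3) by force
    moreover have "(\<lambda>(t, e). t \<otimes> e) ` (T \<times> E) \<subseteq> carrier G" using T(2) E(2) by auto
    ultimately show ?case unfolding m_def [symmetric] using T(1) E(1)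
      by (intro exI [of _ "(\<lambda>(t, e). t \<otimes> e) ` (T \<times> E)"]) auto
  qed
  from this [of c] obtain T where T: "finite T" "T \<subseteq> carrier G"
     "\<And>x. x \<in> carrier G \<Longrightarrow> \<exists>t \<in> T. \<exists>z \<in> ?Z 0. x = t \<otimes> z" by auto
  have "carrier G \<subseteq> T" using T(2,3) by fastforce
  then show ?thesis using T(1) finite_subset by blast
qed

lemma generate_finite:
  assumes V: "in_variety c p G" and p: "p > 0" and S: "finite S" "S \<subseteq> carrier G"
  shows "finite (generate G S)"
proof -
  interpret group G using V by (rule in_variety_group)
  have sub: "subgroup (generate G S) G" using S(2) by (rule generate_is_subgroup)
  then interpret K: group "G\<lparr>carrier := generate G S\<rparr>" by (rule subgroup_imp_group)
  have "S \<subseteq> generate G S" by (auto intro: generate.incl)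
  then have "generate (G\<lparr>carrier := generate G S\<rparr>) S = generate G S"
    using generate_consistent sub by blast
  then show ?thesis
    using K.finitely_generated_finite [OF in_variety_subgroup [OF V sub] p S(1)] by simp
qed

section \<open>Finite multiples and binomial expansion\<close>

text \<open>
  Abelian groups of exponent \<open>p\<close> with varying \<open>p\<close> are needed as sets inside one
  type, so they cannot be vector spaces over a fixed field.
\<close>

primrec nsm :: "nat \<Rightarrow> 'a::ab_group_add \<Rightarrow> 'a" where
  "nsm 0 x = 0"
| "nsm (Suc n) x = x + nsm n x"

lemma nsm_add_left: "nsm (m + n) x = nsm m x + nsm n x"
  by (induction m) (simp_all add: algebra_simps)

lemma nsm_add_right: "nsm n (x + y) = nsm n x + nsm n y"
  by (induction n) (simp_all add: algebra_simps)

lemma nsm_zero [simp]: "nsm n 0 = 0"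
  by (induction n) simp_all

lemma nsm_diff_right: "nsm n (x - y) = nsm n x - nsm n y"
  by (induction n) (simp_all add: algebra_simps)

lemma nsm_mult: "nsm (m * n) x = nsm m (nsm n x)"
  by (induction m) (simp_all add: nsm_add_left)

lemma nsm_apply: "nsm n f x = nsm n (f x)"
  by (induction n) simp_all

lemma nsm_dvd_eq_0: "\<lbrakk>nsm p x = 0; p dvd n\<rbrakk> \<Longrightarrow> nsm n x = 0"
  by (metis dvd_def mult.commute nsm_mult nsm_zero)

lemma nsm_eq_0_coprime:
  assumes "nsm p x = 0" "nsm t x = 0" "coprime p t"
  shows "x = 0"
proof (cases "t = 0")
  case True
  then have "p = 1" using assms(3) by simp
  then show ?thesis using assms(1) by simp
next
  case False
  then obtain a b where "t * a = p * b + gcd t p" using bezout_nat by blast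
  then have "t * a = p * b + 1" using assms(3) by (simp add: coprime_iff_gcd_eq_1 gcd.commute)
  then have "nsm (a * t) x = nsm (b * p) x + x"
    using nsm_add_left [of "p * b" 1 x] by (simp add: mult.commute)
  then show ?thesis using assms by (simp add: nsm_mult)
qed

text \<open>
  The operator is additive on a set \<open>S\<close> only, since unipotent operators are the identity outside their flag.
\<close>

locale additive_operator =
  fixes S :: "'a::ab_group_add set" and E :: "'a \<Rightarrow> 'a"
  assumes zero_mem: "0 \<in> S" and add_mem: "\<lbrakk>x \<in> S; y \<in> S\<rbrakk> \<Longrightarrow> x + y \<in> S"
    and op_mem: "x \<in> S \<Longrightarrow> E x \<in> S"
    and op_add: "\<lbrakk>x \<in> S; y \<in> S\<rbrakk> \<Longrightarrow> E (x + y) = E x + E y"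
begin

lemma op_zero [simp]: "E 0 = 0"
  using op_add [OF zero_mem zero_mem] by simp

lemma nsm_mem: "x \<in> S \<Longrightarrow> nsm n x \<in> S"
  by (induction n) (simp_all add: zero_mem add_mem)

lemma op_nsm: "x \<in> S \<Longrightarrow> E (nsm n x) = nsm n (E x)"
  by (induction n) (simp_all add: op_add nsm_mem)

lemma op_sum:
  assumes "\<And>i. i \<in> I \<Longrightarrow> g i \<in> S"
  shows "E (sum g I) = (\<Sum>i\<in>I. E (g i))" and "sum g I \<in> S"
proof -
  have "E (sum g I) = (\<Sum>i\<in>I. E (g i)) \<and> sum g I \<in> S"
    using assms by (induction I rule: infinite_finite_induct) (simp_all add: op_add zero_mem add_mem)
  then show "E (sum g I) = (\<Sum>i\<in>I. E (g i))" and "sum g I \<in> S" by auto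
qed

lemma op_funpow_mem: "x \<in> S \<Longrightarrow> (E ^^ n) x \<in> S"
  by (induction n) (simp_all add: op_mem)

lemma funpow_binomial:
  assumes T: "\<And>x. x \<in> S \<Longrightarrow> T x = x + E x" and f: "f \<in> S"
  shows "(T ^^ n) f = (\<Sum>i\<le>n. nsm (n choose i) ((E ^^ i) f))"
proof (induction n)
  case 0
  show ?case by simp
next
  case (Suc n)
  have mem: "nsm (n choose i) ((E ^^ i) f) \<in> S" for i
    by (intro nsm_mem op_funpow_mem f)
  have "(T ^^ Suc n) f = (\<Sum>i\<le>n. nsm (n choose i) ((E ^^ i) f)) + (\<Sum>i\<le>n. nsm (n choose i) ((E ^^ Suc i) f))"
    by (simp add: Suc T op_sum mem op_nsm op_funpow_mem f)
  also have "(\<Sum>i\<le>n. nsm (n choose i) ((E ^^ i) f)) = (\<Sum>i\<le>Suc n. nsm (n choose i) ((E ^^ i) f))"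
    by (simp add: binomial_eq_0)
  also have "\<dots> = f + (\<Sum>i\<le>n. nsm (n choose Suc i) ((E ^^ Suc i) f))"
    unfolding sum.atMost_Suc_shift by simp
  also have "f + (\<Sum>i\<le>n. nsm (n choose Suc i) ((E ^^ Suc i) f)) + (\<Sum>i\<le>n. nsm (n choose i) ((E ^^ Suc i) f))
     = f + (\<Sum>i\<le>n. nsm (Suc n choose Suc i) ((E ^^ Suc i) f))"
    by (simp add: sum.distrib nsm_add_left algebra_simps)
  also have "\<dots> = (\<Sum>i\<le>Suc n. nsm (Suc n choose i) ((E ^^ i) f))"
    unfolding sum.atMost_Suc_shift by simp
  finally show ?case .
qed

text \<open>
  The intermediate binomial coefficients are divisible by \<open>p\<close>.
\<close>

lemma funpow_prime:
  assumes T: "\<And>x. x \<in> S \<Longrightarrow> T x = x + E x" and f: "f \<in> S" and p: "prime p" and torsion: "nsm p f = 0"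
  shows "(T ^^ p) f = f + (E ^^ p) f"
proof -
  have "(T ^^ p) f = (\<Sum>i\<le>p. nsm (p choose i) ((E ^^ i) f))" by (rule funpow_binomial [OF T f])
  also have "\<dots> = (\<Sum>i\<in>{0, p}. nsm (p choose i) ((E ^^ i) f))"
  proof (rule sum.mono_neutral_right)
    show "\<forall>i \<in> {..p} - {0, p}. nsm (p choose i) ((E ^^ i) f) = 0"
    proof
      fix i assume i: "i \<in> {..p} - {0, p}"
      have "nsm p ((E ^^ j) f) = 0" for j
        by (induction j) (simp_all add: torsion op_funpow_mem f flip: op_nsm)
      moreover have "p dvd (p choose i)" using i p by (intro dvd_choose_prime) auto
      ultimately show "nsm (p choose i) ((E ^^ i) f) = 0" by (rule nsm_dvd_eq_0)
    qed
  qed auto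
  also have "\<dots> = f + (E ^^ p) f" using p by (simp add: prime_gt_0_nat)
  finally show ?thesis .
qed

end

section \<open>Unipotent groups of flags\<close>

locale flag =
  fixes W :: "nat \<Rightarrow> 'w::ab_group_add set" and c p :: nat
  assumes zero: "0 \<in> W j"
    and diff: "\<lbrakk>x \<in> W j; y \<in> W j\<rbrakk> \<Longrightarrow> x - y \<in> W j"
    and antimono_Suc: "W (Suc j) \<subseteq> W j"
    and trivial: "W (Suc c) = {0}"
    and torsion: "x \<in> W 0 \<Longrightarrow> nsm p x = 0"
begin

lemma add: "\<lbrakk>x \<in> W j; y \<in> W j\<rbrakk> \<Longrightarrow> x + y \<in> W j"
  using diff [of x j "0 - y"] diff [of 0 j y] zero by simp

lemma antimono: "i \<le> j \<Longrightarrow> W j \<subseteq> W i"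
  by (rule lift_Suc_antimono_le [of W]) (use antimono_Suc in auto)

lemma mem_0: "x \<in> W j \<Longrightarrow> x \<in> W 0"
  using antimono [of 0 j] by auto

text \<open>
  The operators are the identity outside the flag, so that equality and composition are those of functions.
\<close>

definition unipotent :: "('w \<Rightarrow> 'w) monoid" where
  "unipotent = \<lparr>carrier = {d. d permutes W 0 \<and> (\<forall>x \<in> W 0. \<forall>y \<in> W 0. d (x + y) = d x + d y) \<and>
       (\<forall>j. \<forall>x \<in> W j. d x - x \<in> W (Suc j))}, monoid.mult = (\<circ>), one = id\<rparr>"

lemma unipotentD:
  assumes "d \<in> carrier unipotent"
  shows unipotent_permutes: "d permutes W 0"
    and unipotent_add: "\<lbrakk>x \<in> W 0; y \<in> W 0\<rbrakk> \<Longrightarrow> d (x + y) = d x + d y"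
    and unipotent_raises: "x \<in> W j \<Longrightarrow> d x - x \<in> W (Suc j)"
    and unipotent_mem: "x \<in> W j \<Longrightarrow> d x \<in> W j"
proof -
  show 1: "x \<in> W j \<Longrightarrow> d x - x \<in> W (Suc j)" for x j using assms by (simp add: unipotent_def)
  show "x \<in> W j \<Longrightarrow> d x \<in> W j" using add [of "d x - x" j x] 1 [of x j] antimono_Suc [of j] by auto
qed (use assms in \<open>auto simp: unipotent_def\<close>)

lemma unipotent_diff:
  assumes "d \<in> carrier unipotent" "x \<in> W 0" "y \<in> W 0"
  shows "d (x - y) = d x - d y"
  using unipotent_add [OF assms(1) diff [OF assms(2,3)] assms(3)] by (simp add: algebra_simps)

text \<open>
  Climb up the flag: if the preimage \<open>y\<close> of \<open>x\<close> lies in some term, then \<open>x - y\<close> lies in the next one, and so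
  does \<open>y\<close> as long as \<open>x\<close> does.
\<close>

lemma inv_mem:
  assumes "d permutes W 0" "\<And>x j. x \<in> W j \<Longrightarrow> d x - x \<in> W (Suc j)" "x \<in> W j"
  shows "inv_into UNIV d x \<in> W j"
proof -
  define y where "y = inv_into UNIV d x"
  have y: "d y = x" "y \<in> W 0"
    using assms mem_0 permutes_inverses [OF assms(1)] permutes_in_image [OF permutes_inv [OF assms(1)]]
    unfolding y_def by auto
  have "y \<in> W i" if "i \<le> j" for i
    using that
  proof (induction i)
    case (Suc i)
    then have "d y - y \<in> W (Suc i)" using assms(2) by simp
    moreover have "x \<in> W (Suc i)" using assms(3) Suc.prems antimono by blast
    ultimately show ?case using diff [of x "Suc i" "d y - y"] y by simp
  qed (use y in simp)
  then show ?thesis unfolding y_def by simp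
qed

lemma unipotent_group: "group unipotent"
proof (rule groupI)
  fix d d' assume d: "d \<in> carrier unipotent" and d': "d' \<in> carrier unipotent"
  have "d (d' x) - x \<in> W (Suc j)" if x: "x \<in> W j" for x j
    using add [OF unipotent_raises [OF d unipotent_mem [OF d' x]] unipotent_raises [OF d' x]] by simp
  then show "d \<otimes>\<^bsub>unipotent\<^esub> d' \<in> carrier unipotent"
    using permutes_compose [OF unipotent_permutes [OF d'] unipotent_permutes [OF d]]
      unipotent_add [OF d] unipotent_add [OF d'] unipotent_mem [OF d']
    by (simp add: unipotent_def)
next
  show "\<one>\<^bsub>unipotent\<^esub> \<in> carrier unipotent" by (simp add: unipotent_def zero permutes_id)
next
  fix d assume d: "d \<in> carrier unipotent"
  note pd = unipotent_permutes [OF d]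
  let ?e = "inv_into UNIV d"
  have mem: "?e x \<in> W j" if "x \<in> W j" for x j
    using inv_mem [OF pd unipotent_raises [OF d] that] .
  have "?e (x + y) = ?e x + ?e y" if "x \<in> W 0" "y \<in> W 0" for x y
  proof -
    have "d (?e x + ?e y) = x + y"
      using unipotent_add [OF d mem [OF that(1)] mem [OF that(2)]] permutes_inverses(1) [OF pd] by simp
    then show ?thesis using permutes_inverses(2) [OF pd] by metis
  qed
  moreover have "?e x - x \<in> W (Suc j)" if "x \<in> W j" for x j
    using diff [OF zero unipotent_raises [OF d mem [OF that]]] permutes_inverses(1) [OF pd] by simp
  ultimately have "?e \<in> carrier unipotent"
    using permutes_inv [OF pd] by (simp add: unipotent_def)
  moreover have "?e \<otimes>\<^bsub>unipotent\<^esub> d = \<one>\<^bsub>unipotent\<^esub>"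
    using permutes_inv_o(2) [OF pd] by (simp add: unipotent_def)
  ultimately show "\<exists>e \<in> carrier unipotent. e \<otimes>\<^bsub>unipotent\<^esub> d = \<one>\<^bsub>unipotent\<^esub>" by blast
qed (auto simp: unipotent_def)

lemma unipotent_simps [simp]: "d \<otimes>\<^bsub>unipotent\<^esub> d' = d \<circ> d'" "\<one>\<^bsub>unipotent\<^esub> = id"
  by (simp_all add: unipotent_def)

text \<open>
  Operators \<open>d\<close> for which \<open>d - 1\<close> moves every term of the flag by \<open>i + 1\<close> steps. Each further commutator
  gains one step, so these subgroups bound the lower central series.
\<close>

definition level :: "nat \<Rightarrow> ('w \<Rightarrow> 'w) set" where
  "level i = {d \<in> carrier unipotent. \<forall>j. \<forall>x \<in> W j. d x - x \<in> W (j + Suc i)}"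

lemma level_raises: "\<lbrakk>d \<in> level i; x \<in> W j\<rbrakk> \<Longrightarrow> d x - x \<in> W (j + Suc i)"
  and level_carrier: "d \<in> level i \<Longrightarrow> d \<in> carrier unipotent"
  by (auto simp: level_def)

lemma level_subgroup: "subgroup (level i) unipotent"
proof -
  interpret U: group unipotent by (rule unipotent_group)
  show ?thesis
  proof (rule U.subgroupI)
    show "level i \<subseteq> carrier unipotent" by (auto simp: level_def)
    show "level i \<noteq> {}" using U.one_closed by (auto simp: level_def zero intro!: exI [of _ id])
    fix d assume d: "d \<in> level i"
    note dc = level_carrier [OF d]
    let ?e = "inv\<^bsub>unipotent\<^esub> d"
    have ec: "?e \<in> carrier unipotent" using dc by simp
    have "d \<circ> ?e = id" using U.r_inv [OF dc] by simp
    then have de: "d (?e x) = x" for x by (metis comp_apply id_apply)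
    have "?e x - x \<in> W (j + Suc i)" if x: "x \<in> W j" for x j
      using diff [OF zero level_raises [OF d unipotent_mem [OF ec x]]] de by simp
    then show "?e \<in> level i" using ec by (simp add: level_def)
    fix d' assume d': "d' \<in> level i"
    have "d (d' x) - x \<in> W (j + Suc i)" if x: "x \<in> W j" for x j
      using add [OF level_raises [OF d unipotent_mem [OF level_carrier [OF d'] x]] level_raises [OF d' x]] by simp
    then show "d \<otimes>\<^bsub>unipotent\<^esub> d' \<in> level i"
      using U.m_closed [OF dc level_carrier [OF d']] by (simp add: level_def)
  qed
qed

lemma level_commutator:
  assumes d: "d \<in> level i" and e: "e \<in> carrier unipotent"
  shows "commutator unipotent d e \<in> level (Suc i)"
proof -
  interpret U: group unipotent by (rule unipotent_group)
  note dc = level_carrier [OF d]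
  have "commutator unipotent d e x - x \<in> W (j + Suc (Suc i))" if x: "x \<in> W j" for x j
  proof -
    \<comment> \<open>With \<open>x = e (d h)\<close> the difference is \<open>((d - 1) (e - 1) - (e - 1) (d - 1)) h\<close>.\<close>
    define h where "h = (inv\<^bsub>unipotent\<^esub> d) ((inv\<^bsub>unipotent\<^esub> e) x)"
    have h: "h \<in> W j" unfolding h_def by (rule unipotent_mem [OF U.inv_closed [OF dc] unipotent_mem [OF U.inv_closed [OF e] x]])
    have "e \<circ> d \<circ> (inv\<^bsub>unipotent\<^esub> d \<circ> inv\<^bsub>unipotent\<^esub> e) = id"
      using U.r_inv [of "e \<circ> d"] dc e U.m_closed [OF e dc] U.inv_mult_group [OF e dc] by simp
    then have edh: "e (d h) = x" unfolding h_def by (metis comp_apply id_apply)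
    have "commutator unipotent d e x = d (e h)" by (simp add: commutator_def h_def)
    then have eq: "commutator unipotent d e x - x = (d (e h - h) - (e h - h)) - (e (d h - h) - (d h - h))"
      using h dc e edh unipotent_mem mem_0 [OF h] by (simp add: unipotent_diff)
    have "d (e h - h) - (e h - h) \<in> W (j + Suc (Suc i))"
      using level_raises [OF d unipotent_raises [OF e h]] by simp
    moreover have "e (d h - h) - (d h - h) \<in> W (j + Suc (Suc i))"
      using unipotent_raises [OF e level_raises [OF d h]] by simp
    ultimately show ?thesis unfolding eq by (rule diff)
  qed
  then show ?thesis using dc e by (simp add: level_def)
qed

lemma unipotent_in_variety:
  assumes p: "prime p" "p > c"
  shows "in_variety c p unipotent"
proof -
  interpret U: group unipotent by (rule unipotent_group)
  have "lower_central_series unipotent i \<subseteq> level i" for i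
  proof (induction i)
    case 0
    show ?case using unipotent_raises by (auto simp: level_def)
  next
    case (Suc i)
    show ?case unfolding U.lower_central_series_Suc_commutator
      using Suc level_commutator by (intro U.generate_subgroup_incl level_subgroup) auto
  qed
  moreover have "level c \<subseteq> {id}"
  proof
    fix d assume d: "d \<in> level c"
    have "d x = x" for x
    proof (cases "x \<in> W 0")
      case True
      then show ?thesis using level_raises [OF d True] trivial by simp
    next
      case False
      then show ?thesis using unipotent_permutes [OF level_carrier [OF d]] by (simp add: permutes_def)
    qed
    then show "d \<in> {id}" by auto
  qed
  ultimately have "lower_central_series unipotent c = {\<one>\<^bsub>unipotent\<^esub>}"
    using subgroup.one_closed [OF U.lower_central_series_subgroup [of c]] by fastforce
  moreover have "d [^]\<^bsub>unipotent\<^esub> p = \<one>\<^bsub>unipotent\<^esub>" if d: "d \<in> carrier unipotent" for d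
  proof -
    define E where "E x = d x - x" for x
    interpret E: additive_operator "W 0" E
      by unfold_locales
        (use unipotent_add [OF d] unipotent_raises [OF d] antimono_Suc [of 0] zero add in \<open>auto simp: E_def\<close>)
    have pow: "d [^]\<^bsub>unipotent\<^esub> n = d ^^ n" for n :: nat
      by (induction n) (simp_all add: funpow_swap1 fun_eq_iff)
    have "(d ^^ p) x = x" for x
    proof (cases "x \<in> W 0")
      case True
      have "(E ^^ n) x \<in> W n" for n
        by (induction n) (auto simp: True E_def intro: unipotent_raises [OF d])
      then have "(E ^^ p) x \<in> W (Suc c)" using p(2) antimono [of "Suc c" p] by auto
      then have "(E ^^ p) x = 0" using trivial by simp
      then show ?thesis using E.funpow_prime [of d x p] True p torsion by (simp add: E_def)
    next
      case False
      then have "d x = x" using unipotent_permutes [OF d] by (simp add: permutes_def)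
      then have "(d ^^ n) x = x" for n by (induction n) simp_all
      then show ?thesis .
    qed
    then show ?thesis unfolding pow by auto
  qed
  ultimately show ?thesis
    by (simp add: in_variety_iff nilpotent_of_class_le_def satisfies_exponent_def U.is_group)
qed

end

section \<open>The rationals modulo the integers\<close>

text \<open>
  One type of values that contains elements of order \<open>p\<close> for every \<open>p\<close>.
\<close>

definition int_cong :: "rat \<Rightarrow> rat \<Rightarrow> bool" where "int_cong x y \<longleftrightarrow> x - y \<in> \<int>"

quotient_type rat_mod_int = rat / int_cong
proof (rule equivpI)
  show "reflp int_cong" by (simp add: reflp_def int_cong_def)
  show "symp int_cong" unfolding symp_def int_cong_def by (metis Ints_minus minus_diff_eq)
  show "transp int_cong"
    unfolding transp_def int_cong_def by (metis Ints_add diff_add_cancel add_diff_eq)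
qed

instantiation rat_mod_int :: ab_group_add
begin
lift_definition zero_rat_mod_int :: rat_mod_int is 0 .
lift_definition plus_rat_mod_int :: "rat_mod_int \<Rightarrow> rat_mod_int \<Rightarrow> rat_mod_int" is "(+)"
  unfolding int_cong_def by (metis Ints_add add_diff_add)
lift_definition uminus_rat_mod_int :: "rat_mod_int \<Rightarrow> rat_mod_int" is uminus
  unfolding int_cong_def by (metis Ints_minus minus_diff_minus)
lift_definition minus_rat_mod_int :: "rat_mod_int \<Rightarrow> rat_mod_int \<Rightarrow> rat_mod_int" is "(-)"
  unfolding int_cong_def by (metis Ints_diff diff_diff_add diff_diff_eq2 diff_add_eq add.commute add_diff_eq)
instance
  by standard (transfer, simp add: int_cong_def)+
end

lemma exists_nsm_torsion:
  assumes "p > 1"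
  shows "\<exists>u :: rat_mod_int. u \<noteq> 0 \<and> nsm p u = 0"
proof -
  have n: "nsm n (abs_rat_mod_int x) = abs_rat_mod_int (of_nat n * x)" for n x
    by (induction n) (simp_all add: zero_rat_mod_int.abs_eq plus_rat_mod_int.abs_eq algebra_simps)
  let ?u = "abs_rat_mod_int (1 / of_nat p)"
  have "nsm p ?u = 0" unfolding n using assms
    by (simp add: zero_rat_mod_int.abs_eq rat_mod_int.abs_eq_iff int_cong_def)
  moreover have "?u \<noteq> 0"
  proof
    assume "?u = 0"
    then have "(1 :: rat) / of_nat p \<in> \<int>"
      by (simp add: zero_rat_mod_int.abs_eq rat_mod_int.abs_eq_iff int_cong_def)
    then obtain k :: int where "(1 :: rat) / of_nat p = of_int k" by (auto elim: Ints_cases)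
    then have "(1 :: rat) = of_int (k * int p)" using assms by (simp add: field_simps)
    then have "k * int p = 1" by linarith
    then show False using assms by (simp add: zmult_eq_1_iff)
  qed
  ultimately show ?thesis by blast
qed

section \<open>Polynomial functions on filtered groups\<close>

lemma sum_fun_apply: "(\<Sum>i\<in>I. f i) x = (\<Sum>i\<in>I. f i x)"
  by (induction I rule: infinite_finite_induct) simp_all

definition left_diff :: "('a, 'b) monoid_scheme \<Rightarrow> 'a \<Rightarrow> ('a \<Rightarrow> 'k::ab_group_add) \<Rightarrow> 'a \<Rightarrow> 'k" where
  "left_diff G x f = (\<lambda>y. f (x \<otimes>\<^bsub>G\<^esub> y) - f y)"

definition right_diff :: "('a, 'b) monoid_scheme \<Rightarrow> 'a \<Rightarrow> ('a \<Rightarrow> 'k::ab_group_add) \<Rightarrow> 'a \<Rightarrow> 'k" where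
  "right_diff G x f = (\<lambda>y. f (y \<otimes>\<^bsub>G\<^esub> x) - f y)"

text \<open>
  Functions of degree less than \<open>n\<close> on the subgroup \<open>A\<close>, where elements of \<open>P k\<close> have weight \<open>k\<close>:
  a difference along an element of weight \<open>k\<close> lowers the degree by \<open>k\<close>, and degree less than \<open>0\<close> means zero.
  The truncated subtraction \<open>n - j\<close> is \<open>Suc n - Suc j\<close>; it is zero, as it should be, whenever the weight
  exceeds the degree.
\<close>

fun degree_less :: "('a, 'b) monoid_scheme \<Rightarrow> (nat \<Rightarrow> 'a set) \<Rightarrow> 'a set \<Rightarrow> nat \<Rightarrow> ('a \<Rightarrow> 'k::ab_group_add) \<Rightarrow> bool" where
  "degree_less G P A 0 f \<longleftrightarrow> (\<forall>y \<in> A. f y = 0)"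
| "degree_less G P A (Suc n) f \<longleftrightarrow> (\<forall>j. \<forall>x \<in> P (Suc j) \<inter> A. degree_less G P A (n - j) (left_diff G x f))"

lemma (in group) deg_cong: "(\<And>y. y \<in> A \<Longrightarrow> f y = g y) \<Longrightarrow> subgroup A G \<Longrightarrow> degree_less G P A n f \<longleftrightarrow> degree_less G P A n g"
proof (induction n arbitrary: f g rule: less_induct)
  case (less n)
  show ?case
  proof (cases n)
    case (Suc m)
    have "degree_less G P A (m - j) (left_diff G x f) \<longleftrightarrow> degree_less G P A (m - j) (left_diff G x g)" if "x \<in> A" for x j
      by (rule less.IH) (use less.prems that subgroup.m_closed [OF less.prems(2)] Suc in \<open>auto simp: left_diff_def\<close>)
    then show ?thesis using Suc by auto
  qed (use less.prems in auto)
qed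

text \<open>
  The filtration is numbered so that commutators add indices; \<open>P 0\<close> and \<open>P 1\<close> are both the whole group.
\<close>

locale filtered_group = group G for G (structure) +
  fixes P :: "nat \<Rightarrow> 'a set" and c p :: nat
  assumes P_subgroup: "subgroup (P k) G"
    and P_1: "P 1 = carrier G"
    and P_antimono_Suc: "P (Suc k) \<subseteq> P k"
    and P_commutator: "\<lbrakk>x \<in> P i; y \<in> P j\<rbrakk> \<Longrightarrow> commutator G x y \<in> P (i + j)"
    and P_trivial: "P (Suc c) = {\<one>}"
    and exponent: "x \<in> carrier G \<Longrightarrow> x [^] p = \<one>"
    and finite_carrier: "finite (carrier G)"
    and prime_p: "prime p"
begin

abbreviation deg :: "'a set \<Rightarrow> nat \<Rightarrow> ('a \<Rightarrow> 'k::ab_group_add) \<Rightarrow> bool" where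
  "deg \<equiv> degree_less G P"

lemma P_carrier: "x \<in> P k \<Longrightarrow> x \<in> carrier G"
  using subgroup.mem_carrier [OF P_subgroup] .

lemma P_antimono: "i \<le> j \<Longrightarrow> P j \<subseteq> P i"
  by (rule lift_Suc_antimono_le [of P]) (use P_antimono_Suc in auto)

lemma P_conj:
  assumes "x \<in> P k" "y \<in> carrier G"
  shows "y \<otimes> x \<otimes> inv y \<in> P k"
proof -
  have "commutator G y x \<in> P (1 + k)" using assms P_1 P_commutator by blast
  then have "commutator G y x \<in> P k" using P_antimono [of k "1 + k"] by auto
  then show ?thesis
    using assms conj_eq_commutator_mult [OF P_carrier] subgroup.m_closed [OF P_subgroup] by metis
qed

lemma deg_transfer:
  assumes "deg A n f" "\<And>y. y \<in> A \<Longrightarrow> f y = g y" "subgroup A G" "m = n"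
  shows "deg A m g"
  using assms(1,4) deg_cong [OF assms(2,3)] by simp

lemma deg_eq_0: "(\<And>y. y \<in> A \<Longrightarrow> f y = 0) \<Longrightarrow> subgroup A G \<Longrightarrow> deg A n f"
proof (induction n arbitrary: f rule: less_induct)
  case (less n)
  show ?case
  proof (cases n)
    case (Suc m)
    have "deg A (m - j) (left_diff G x f)" if "x \<in> A" for x j
      by (rule less.IH) (use less.prems that subgroup.m_closed [OF less.prems(2)] Suc in \<open>auto simp: left_diff_def\<close>)
    then show ?thesis using Suc by auto
  qed (use less.prems in auto)
qed

lemma deg_add: "\<lbrakk>deg A n f; deg A n g\<rbrakk> \<Longrightarrow> deg A n (f + g)"
proof (induction n arbitrary: f g rule: less_induct)
  case (less n)
  show ?case
  proof (cases n)
    case 0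
    then show ?thesis using less.prems by simp
  next
    case (Suc m)
    have eq: "left_diff G x (f + g) = left_diff G x f + left_diff G x g" for x
      by (simp add: left_diff_def fun_eq_iff)
    show ?thesis
      unfolding Suc degree_less.simps(2) eq using less.prems Suc by (intro allI ballI less.IH) auto
  qed
qed

lemma deg_uminus: "deg A n f \<Longrightarrow> deg A n (- f)"
proof (induction n arbitrary: f rule: less_induct)
  case (less n)
  show ?case
  proof (cases n)
    case 0
    then show ?thesis using less.prems by simp
  next
    case (Suc m)
    have eq: "left_diff G x (- f) = - left_diff G x f" for x
      by (simp add: left_diff_def fun_eq_iff)
    show ?thesis
      unfolding Suc degree_less.simps(2) eq using less.prems Suc by (intro allI ballI less.IH) auto
  qed
qed

lemma deg_diff: "\<lbrakk>deg A n f; deg A n g\<rbrakk> \<Longrightarrow> deg A n (f - g)"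
  using deg_add [of A n f "- g"] deg_uminus [of A n g] by simp

lemma deg_Suc: "deg A n f \<Longrightarrow> subgroup A G \<Longrightarrow> deg A (Suc n) f"
proof (induction n arbitrary: f rule: less_induct)
  case (less n)
  have "deg A (n - j) (left_diff G x f)" if x: "x \<in> P (Suc j) \<inter> A" for j x
  proof (cases n)
    case 0
    then show ?thesis using less.prems x subgroup.m_closed [OF less.prems(2)] by (auto simp: left_diff_def)
  next
    case (Suc m)
    then have d: "deg A (m - j) (left_diff G x f)" using less.prems x by auto
    show ?thesis
    proof (cases "j \<le> m")
      case True
      then show ?thesis using less.IH [OF _ d less.prems(2)] Suc by (simp add: Suc_diff_le)
    next
      case False
      then show ?thesis using d Suc by simp
    qed
  qed
  then show ?case by simp
qed

lemma deg_mono: "\<lbrakk>deg A m f; m \<le> n; subgroup A G\<rbrakk> \<Longrightarrow> deg A n f"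
proof (induction n)
  case (Suc n)
  then show ?case using deg_Suc le_antisym by (cases "m \<le> n") (auto simp: not_le less_eq_Suc_le simp del: degree_less.simps)
qed (simp del: degree_less.simps)

lemma deg_left_diff:
  assumes f: "deg A n f" and A: "subgroup A G" and x: "x \<in> P k" "x \<in> A" and k: "k \<ge> 1"
  shows "deg A (n - k) (left_diff G x f)"
proof (cases n)
  case 0
  then show ?thesis using f x subgroup.m_closed [OF A] by (auto simp: left_diff_def)
next
  case (Suc m)
  then show ?thesis using f x k by (cases k) auto
qed

lemma degI:
  assumes "n = 0 \<Longrightarrow> (\<And>y. y \<in> A \<Longrightarrow> f y = 0)"
    and "\<And>k x. \<lbrakk>n > 0; k \<ge> 1; x \<in> P k; x \<in> A\<rbrakk> \<Longrightarrow> deg A (n - k) (left_diff G x f)"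
  shows "deg A n f"
  using assms(1) assms(2) [of "Suc _"] by (cases n) auto

lemma deg_translate:
  assumes f: "deg A n f" and A: "subgroup A G" and x: "x \<in> A"
  shows "deg A n (\<lambda>y. f (x \<otimes> y))"
proof -
  have "x \<in> P 1" using P_1 subgroup.mem_carrier [OF A x] by simp
  then have "deg A n (left_diff G x f)" using deg_left_diff [OF f A _ x, of 1] deg_mono A by fastforce
  then have "deg A n (left_diff G x f + f)" using deg_add f by blast
  then show ?thesis by (simp add: left_diff_def plus_fun_def)
qed

lemma deg_subset:
  assumes AB: "A \<subseteq> B" shows "deg B n f \<Longrightarrow> deg A n f"
proof (induction n arbitrary: f rule: less_induct)
  case (less n)
  then show ?case using AB by (cases n) (auto intro!: less.IH)
qed

lemma deg_const:
  assumes A: "subgroup A G" shows "deg A (Suc n) (\<lambda>_. u)"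
  by (simp add: left_diff_def deg_eq_0 [OF _ A])

text \<open>
  Right differences are left differences along a conjugate, \<open>y z = (y z y\<inverse>) y\<close>, and they commute with
  all left differences.
\<close>

lemma deg_right_diff:
  assumes B: "subgroup B G" and z: "z \<in> P w" "z \<in> B" and w: "w \<ge> 1"
  shows "deg B n f \<Longrightarrow> deg B (n - w) (right_diff G z f)"
proof (induction n arbitrary: f rule: less_induct)
  case (less n)
  note Bc = subgroup.mem_carrier [OF B]
  show ?case
  proof (rule degI)
    fix y assume n: "n - w = 0" and y: "y \<in> B"
    have "y \<otimes> z \<otimes> inv y \<in> B" using y z subgroup.m_closed [OF B] subgroup.m_inv_closed [OF B] by blast
    then have "deg B (n - w) (left_diff G (y \<otimes> z \<otimes> inv y) f)"
      using deg_left_diff [OF less.prems B P_conj [OF z(1)] _ w] Bc [OF y] by simp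
    then have "left_diff G (y \<otimes> z \<otimes> inv y) f y = 0" using n y by simp
    then show "right_diff G z f y = 0"
      using Bc [OF y] Bc [OF z(2)] by (simp add: left_diff_def right_diff_def m_assoc)
  next
    fix k x assume n: "0 < n - w" and k: "1 \<le> k" and x: "x \<in> P k" "x \<in> B"
    show "deg B (n - w - k) (left_diff G x (right_diff G z f))"
    proof (rule deg_transfer [OF _ _ B])
      show "deg B (n - k - w) (right_diff G z (left_diff G x f))"
        using n k by (intro less.IH deg_left_diff less.prems B x) auto
      show "right_diff G z (left_diff G x f) y = left_diff G x (right_diff G z f) y" if "y \<in> B" for y
        using Bc [OF that] Bc [OF z(2)] Bc [OF x(2)] by (simp add: left_diff_def right_diff_def m_assoc)
    qed simp
  qed
qed

lemma right_diff_operator: "additive_operator UNIV (right_diff G z)"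
  by unfold_locales (auto simp: right_diff_def fun_eq_iff)

lemma right_translation_pow:
  assumes "z \<in> carrier G" "y \<in> carrier G"
  shows "((\<lambda>f y. f (y \<otimes> z)) ^^ t) f y = f (y \<otimes> z [^] (t::nat))"
  using assms(2)
proof (induction t arbitrary: y)
  case (Suc t)
  have "z [^] t \<otimes> z = z \<otimes> z [^] t" using assms(1) by (metis nat_pow_Suc nat_pow_Suc2)
  with Suc show ?case using assms(1) by (simp add: m_assoc)
qed (simp add: assms)

lemma right_diff_Newton:
  assumes z: "z \<in> carrier G" and y: "y \<in> carrier G"
  shows "f (y \<otimes> z [^] (t::nat)) = (\<Sum>i\<le>t. nsm (t choose i) ((right_diff G z ^^ i) f y))"
proof -
  interpret E: additive_operator UNIV "right_diff G z" by (rule right_diff_operator)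
  have "((\<lambda>f y. f (y \<otimes> z)) ^^ t) f = (\<Sum>i\<le>t. nsm (t choose i) ((right_diff G z ^^ i) f))"
    by (rule E.funpow_binomial) (auto simp: right_diff_def fun_eq_iff)
  from fun_cong [OF this, of y] show ?thesis
    by (simp add: right_translation_pow [OF z y] sum_fun_apply nsm_apply)
qed

text \<open>
  Right translation by \<open>z\<close> has order \<open>p\<close>, and in exponent \<open>p\<close> its \<open>p\<close>-th power is one plus the \<open>p\<close>-th
  power of the difference operator.
\<close>

lemma right_diff_prime:
  assumes z: "z \<in> carrier G" and y: "y \<in> carrier G" and torsion: "\<And>y. nsm p (f y) = 0" and i: "i \<ge> p"
  shows "(right_diff G z ^^ i) f y = 0"
proof -
  interpret E: additive_operator UNIV "right_diff G z" by (rule right_diff_operator)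
  have p0: "(right_diff G z ^^ p) f y = 0" if y: "y \<in> carrier G" for y
  proof -
    have "((\<lambda>f y. f (y \<otimes> z)) ^^ p) f = f + (right_diff G z ^^ p) f"
      by (rule E.funpow_prime) (use prime_p torsion in \<open>auto simp: right_diff_def fun_eq_iff nsm_apply\<close>)
    from fun_cong [OF this, of y] show ?thesis
      using exponent [OF z] y by (simp add: right_translation_pow [OF z y])
  qed
  have "(right_diff G z ^^ (n + p)) f y = 0" if y: "y \<in> carrier G" for n y
    using y by (induction n arbitrary: y) (use p0 z in \<open>auto simp: right_diff_def\<close>)
  from this [OF y, of "i - p"] i show ?thesis by simp
qed

lemma right_diff_left_diff:
  assumes "x \<in> carrier G" "z \<in> carrier G" "y \<in> carrier G"
  shows "(right_diff G z ^^ i) (left_diff G x f) y = left_diff G x ((right_diff G z ^^ i) f) y"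
  using assms(3)
proof (induction i arbitrary: y)
  case (Suc i)
  then show ?case using assms(1,2) by (simp add: right_diff_def left_diff_def m_assoc)
qed simp

lemma right_diff_cong:
  assumes "\<And>y. y \<in> carrier G \<Longrightarrow> f y = g y" "z \<in> carrier G" "y \<in> carrier G"
  shows "(right_diff G z ^^ i) f y = (right_diff G z ^^ i) g y"
  using assms(3) by (induction i arbitrary: y) (use assms(1,2) in \<open>auto simp: right_diff_def\<close>)

lemma right_diff_funpow_add: "(right_diff G z ^^ i) (f + g) = (right_diff G z ^^ i) f + (right_diff G z ^^ i) g"
  by (induction i) (auto simp: right_diff_def fun_eq_iff)

end

section \<open>Extension of a subgroup by one element\<close>

text \<open>
  The weight \<open>w\<close> is the largest for which the filtration is not yet contained in \<open>A\<close>. Then \<open>g\<close> normalizes \<open>A\<close>,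
  because its commutators have larger weight.
\<close>

locale cyclic_extension = filtered_group +
  fixes A :: "'a set" and g :: 'a and w :: nat
  assumes A: "subgroup A G" and w: "w \<ge> 1" and gP: "g \<in> P w" and gA: "g \<notin> A" and PA: "P (Suc w) \<subseteq> A"
begin

definition B :: "'a set" where "B = {a \<otimes> g [^] t |a t. a \<in> A \<and> t < p}"

lemma g [simp]: "g \<in> carrier G" using gP by (rule P_carrier)

lemma A_carrier [simp]: "a \<in> A \<Longrightarrow> a \<in> carrier G" using subgroup.mem_carrier [OF A] .

lemmas A_closed = subgroup.m_closed [OF A] subgroup.m_inv_closed [OF A] subgroup.one_closed [OF A]

lemma commutator_g:
  assumes "a \<in> P k" "k \<ge> 1"
  shows "commutator G g a \<in> P (w + k)" "commutator G g a \<in> A"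
proof -
  show 1: "commutator G g a \<in> P (w + k)" using P_commutator gP assms by blast
  have "P (w + k) \<subseteq> P (Suc w)" using assms(2) by (intro P_antimono) simp
  then show "commutator G g a \<in> A" using 1 PA by blast
qed

lemma conj_g: assumes "a \<in> A" shows "g \<otimes> a \<otimes> inv g \<in> A"
proof -
  have "a \<in> P 1" using assms P_1 by simp
  then show ?thesis
    using conj_eq_commutator_mult [of a g] commutator_g(2) [of a 1] A_closed(1) assms by simp
qed

lemma conj_g_pow: "a \<in> A \<Longrightarrow> g [^] (t::nat) \<otimes> a \<otimes> inv (g [^] t) \<in> A"
proof (induction t)
  case (Suc t)
  have "g [^] Suc t \<otimes> a \<otimes> inv (g [^] Suc t) = g \<otimes> (g [^] t \<otimes> a \<otimes> inv (g [^] t)) \<otimes> inv g"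
    using Suc.prems by (simp only: nat_pow_Suc2 [OF g]) (simp add: m_assoc inv_mult_group)
  then show ?case using conj_g Suc by simp
qed simp

lemma g_pow_mod: "g [^] (t::nat) = g [^] (t mod p)"
proof -
  have "g [^] t = g [^] (p * (t div p) + t mod p)" by simp
  also have "\<dots> = (g [^] p) [^] (t div p) \<otimes> g [^] (t mod p)"
    by (simp only: nat_pow_pow [OF g] nat_pow_mult [OF g])
  finally show ?thesis by (simp add: exponent)
qed

lemma p_pos: "p > 0" using prime_p prime_gt_0_nat by blast

lemma B_I: "a \<in> A \<Longrightarrow> a \<otimes> g [^] (t::nat) \<in> B"
  unfolding B_def mem_Collect_eq
  by (rule exI [of _ a], rule exI [of _ "t mod p"]) (use p_pos g_pow_mod [of t] in simp)

lemma A_subset_B: "A \<subseteq> B"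
proof
  fix a assume "a \<in> A"
  then show "a \<in> B" using B_I [of a 0] by simp
qed

lemma g_B: "g \<in> B" using B_I [of \<one> 1] A_closed by simp

lemma B_subgroup: "subgroup B G"
proof (rule subgroupI)
  show Bc: "B \<subseteq> carrier G" unfolding B_def by auto
  show "B \<noteq> {}" using g_B by blast
  have m: "x \<otimes> y \<in> B" if B: "x \<in> B" "y \<in> B" for x y
  proof -
    obtain a t b s where xy: "x = a \<otimes> g [^] t" "y = b \<otimes> g [^] s" "a \<in> A" "b \<in> A" "t < p" "s < p"
      using B unfolding B_def by blast
    have "x \<otimes> y = (a \<otimes> (g [^] t \<otimes> b \<otimes> inv (g [^] t))) \<otimes> g [^] (t + s)"
      unfolding xy using xy(3,4) by (simp add: m_assoc cancel_left cancel_left' flip: nat_pow_mult)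
    then show ?thesis using B_I [OF A_closed(1) [OF xy(3) conj_g_pow [OF xy(4)]]] by metis
  qed
  then show "\<And>x y. \<lbrakk>x \<in> B; y \<in> B\<rbrakk> \<Longrightarrow> x \<otimes> y \<in> B" .
  fix x assume x: "x \<in> B"
  have "x [^] n \<in> B" for n :: nat
    by (induction n) (use m x A_subset_B A_closed(3) in auto)
  moreover have "inv x = x [^] (p - 1)"
    using x Bc exponent [of x] p_pos by (metis Suc_pred' inv_equality nat_pow_Suc nat_pow_closed subsetD)
  ultimately show "inv x \<in> B" by simp
qed

lemma g_pow_mem_A:
  assumes "g [^] (t::nat) \<in> A" shows "p dvd t"
proof (rule ccontr)
  assume "\<not> p dvd t"
  then have cop: "coprime t p" using prime_p by (simp add: coprime_commute prime_imp_coprime)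
  then have "t \<noteq> 0" using prime_p by (metis coprime_0_left_iff not_prime_unit)
  then obtain x y where "t * x = p * y + gcd t p" using bezout_nat by blast
  then have "g [^] (t * x) = g [^] (p * y + 1)" using cop by simp
  also have "\<dots> = g" by (simp add: exponent flip: nat_pow_pow nat_pow_mult)
  finally have "g = (g [^] t) [^] x" by (simp add: nat_pow_pow)
  moreover have "(g [^] t) [^] n \<in> A" for n :: nat
    by (induction n) (use assms A_closed in auto)
  ultimately show False using gA by metis
qed

lemma B_unique:
  assumes "a \<otimes> g [^] t = b \<otimes> g [^] s" "a \<in> A" "b \<in> A" "t < p" "s < p"
  shows "a = b \<and> t = s"
proof -
  have *: "a = b \<and> t = s" if eq: "a \<otimes> g [^] t = b \<otimes> g [^] s" and ab: "a \<in> A" "b \<in> A" and ts: "t \<le> s" "s < p"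
    for a b and t s :: nat
  proof -
    have "a \<otimes> g [^] t = b \<otimes> g [^] (s - t) \<otimes> g [^] t"
      using eq ts ab by (simp add: m_assoc nat_pow_mult)
    then have ab': "a = b \<otimes> g [^] (s - t)" using ab by simp
    then have "g [^] (s - t) = inv b \<otimes> a" using ab by (simp add: cancel_left)
    then have "g [^] (s - t) \<in> A" using ab A_closed by simp
    then have "p dvd s - t" by (rule g_pow_mem_A)
    then have "t = s" using ts by (metis diff_less dvd_imp_le le_antisym le_less_trans diff_is_0_eq diff_le_self not_le zero_less_diff)
    then show ?thesis using ab' ab by simp
  qed
  show ?thesis
  proof (cases "t \<le> s")
    case True
    then show ?thesis using * [OF assms(1-3)] assms by blast
  next
    case False
    then show ?thesis using * [OF assms(1)[symmetric] assms(3,2)] assms by auto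
  qed
qed

text \<open>
  Conjugation by \<open>g\<close> multiplies an argument of weight \<open>k\<close> by a commutator of weight \<open>w + k\<close>. In the induction
  the difference along \<open>x\<close> splits into the same expression for the left difference of \<open>F\<close> along \<open>x\<close> and a left difference along the
  commutator of \<open>g\<close> and \<open>x\<close>.
\<close>

lemma deg_conj_diff:
  "deg A m F \<Longrightarrow> deg A (m - w) (\<lambda>a. F (g \<otimes> a \<otimes> inv g) - F a)"
proof (induction m arbitrary: F rule: less_induct)
  case (less m)
  let ?\<phi> = "\<lambda>a. g \<otimes> a \<otimes> inv g"
  have comp: "deg A l (\<lambda>a. H (?\<phi> a))" if "l < m" "deg A l H" for l and H :: "'a \<Rightarrow> 'c"
  proof -
    have "deg A l (\<lambda>a. H (?\<phi> a) - H a)"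
      by (rule deg_mono [OF less.IH [OF that] diff_le_self A])
    then have "deg A l ((\<lambda>a. H (?\<phi> a) - H a) + H)" using deg_add that(2) by blast
    then show ?thesis by (simp add: plus_fun_def)
  qed
  show ?case
  proof (rule degI)
    fix y assume m: "m - w = 0" and y: "y \<in> A"
    have y1: "y \<in> P 1" using y P_1 by simp
    have "deg A (m - (w + 1)) (left_diff G (commutator G g y) F)"
      using deg_left_diff [OF less.prems A commutator_g [OF y1]] by simp
    then have "left_diff G (commutator G g y) F y = 0" using m y by simp
    then show "F (?\<phi> y) - F y = 0"
      using conj_eq_commutator_mult [of y g] y by (simp add: left_diff_def)
  next
    fix k x assume m: "0 < m - w" and k: "1 \<le> k" and x: "x \<in> P k" "x \<in> A"
    let ?b = "commutator G g x"
    have d1: "deg A (m - k - w) (\<lambda>a. left_diff G x F (?\<phi> a) - left_diff G x F a)"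
      using m k by (intro less.IH deg_left_diff less.prems A x) auto
    have d2: "deg A (m - (w + k)) (left_diff G ?b F)"
      using deg_left_diff [OF less.prems A commutator_g [OF x(1) k]] k by simp
    have "deg A (m - (w + k)) (\<lambda>y. left_diff G ?b F (x \<otimes> y))"
      by (rule deg_translate [OF d2 A x(2)])
    then have d3: "deg A (m - (w + k)) (\<lambda>y. left_diff G ?b F (x \<otimes> ?\<phi> y))"
      using comp [of "m - (w + k)" "\<lambda>y. left_diff G ?b F (x \<otimes> y)"] m k by simp
    show "deg A (m - w - k) (left_diff G x (\<lambda>a. F (?\<phi> a) - F a))"
    proof (rule deg_transfer [OF deg_add [OF d1] _ A])
      show "deg A (m - k - w) (\<lambda>y. left_diff G ?b F (x \<otimes> ?\<phi> y))"
        using d3 by (simp add: diff_diff_left add.commute)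
      show "((\<lambda>a. left_diff G x F (?\<phi> a) - left_diff G x F a) + (\<lambda>y. left_diff G ?b F (x \<otimes> ?\<phi> y))) y
          = left_diff G x (\<lambda>a. F (?\<phi> a) - F a) y" if y: "y \<in> A" for y
      proof -
        have "?b \<otimes> (x \<otimes> ?\<phi> y) = ?\<phi> (x \<otimes> y)"
          using y x by (simp add: commutator_def word_simps)
        then show ?thesis by (simp add: left_diff_def)
      qed
    qed simp
  qed
qed

lemma deg_conj: assumes "deg A m F" shows "deg A m (\<lambda>a. F (g \<otimes> a \<otimes> inv g))"
proof -
  have "deg A m (\<lambda>a. F (g \<otimes> a \<otimes> inv g) - F a)"
    by (rule deg_mono [OF deg_conj_diff [OF assms] diff_le_self A])
  then have "deg A m ((\<lambda>a. F (g \<otimes> a \<otimes> inv g) - F a) + F)" using deg_add assms by blast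
  then show ?thesis by (simp add: plus_fun_def)
qed

text \<open>
  The restriction to \<open>A\<close> of the \<open>i\<close>-th right difference along \<open>g\<close> is the \<open>i\<close>-th coefficient in the binomial
  expansion of \<open>f\<close> along \<open>g\<close>; each step in \<open>i\<close> costs the weight of \<open>g\<close>.
\<close>

definition coeff_deg :: "nat \<Rightarrow> ('a \<Rightarrow> 'k::ab_group_add) \<Rightarrow> bool" where
  "coeff_deg n f \<longleftrightarrow> (\<forall>i. deg A (n - i * w) ((right_diff G g ^^ i) f))"

lemma deg_imp_coeff_deg:
  assumes "deg B n f" shows "coeff_deg n f"
proof -
  have "deg B (n - i * w) ((right_diff G g ^^ i) f)" for i
  proof (induction i)
    case (Suc i)
    then have "deg B (n - i * w - w) (right_diff G g ((right_diff G g ^^ i) f))"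
      by (rule deg_right_diff [OF B_subgroup gP g_B w])
    then show ?case by (simp add: diff_diff_left add.commute)
  qed (use assms in simp)
  then show ?thesis unfolding coeff_deg_def using deg_subset [OF A_subset_B] by blast
qed

lemma coeff_deg_add: "\<lbrakk>coeff_deg n f; coeff_deg n h\<rbrakk> \<Longrightarrow> coeff_deg n (f + h)"
  unfolding coeff_deg_def right_diff_funpow_add using deg_add by blast

lemma coeff_deg_mono: "\<lbrakk>coeff_deg m f; m \<le> n\<rbrakk> \<Longrightarrow> coeff_deg n f"
  unfolding coeff_deg_def using deg_mono [OF _ _ A] diff_le_mono by blast

lemma coeff_deg_cong:
  assumes "\<And>y. y \<in> carrier G \<Longrightarrow> f y = h y" "coeff_deg n f" shows "coeff_deg n h"
  unfolding coeff_deg_def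
proof
  fix i
  have e: "(right_diff G g ^^ i) f y = (right_diff G g ^^ i) h y" if "y \<in> A" for y
    using that by (intro right_diff_cong assms(1)) auto
  have "deg A (n - i * w) ((right_diff G g ^^ i) f)" using assms(2) unfolding coeff_deg_def ..
  then show "deg A (n - i * w) ((right_diff G g ^^ i) h)" by (rule deg_transfer [OF _ e A refl])
qed

lemma coeff_deg_left_diff_A:
  assumes f: "coeff_deg n f" and a: "a \<in> A" "a \<in> P k" and k: "k \<ge> 1"
  shows "coeff_deg (n - k) (left_diff G a f)"
  unfolding coeff_deg_def
proof
  fix i
  have "deg A (n - i * w - k) (left_diff G a ((right_diff G g ^^ i) f))"
    using f unfolding coeff_deg_def by (intro deg_left_diff A a k) auto
  moreover have "left_diff G a ((right_diff G g ^^ i) f) y = (right_diff G g ^^ i) (left_diff G a f) y"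
    if "y \<in> A" for y using that a by (intro right_diff_left_diff [symmetric]) auto
  ultimately show "deg A (n - k - i * w) ((right_diff G g ^^ i) (left_diff G a f))"
    by (rule deg_transfer [OF _ _ A _]) (assumption, rule diff_commute)
qed

lemma coeff_deg_left_diff_g:
  assumes f: "coeff_deg n f" shows "coeff_deg (n - w) (left_diff G g f)"
  unfolding coeff_deg_def
proof
  fix i
  let ?\<phi> = "\<lambda>a. g \<otimes> a \<otimes> inv g"
  let ?F = "\<lambda>i. (right_diff G g ^^ i) f"
  have "deg A (n - i * w - w) (\<lambda>a. ?F i (?\<phi> a) - ?F i a)"
    using f unfolding coeff_deg_def by (intro deg_conj_diff) auto
  moreover have "deg A (n - Suc i * w) (\<lambda>a. ?F (Suc i) (?\<phi> a))"
    by (rule deg_conj) (use f in \<open>unfold coeff_deg_def, blast\<close>)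
  then have "deg A (n - i * w - w) (\<lambda>a. ?F (Suc i) (?\<phi> a))" by (simp add: diff_diff_left add.commute)
  ultimately have "deg A (n - i * w - w) ((\<lambda>a. ?F i (?\<phi> a) - ?F i a) + (\<lambda>a. ?F (Suc i) (?\<phi> a)))"
    by (rule deg_add)
  moreover have "((\<lambda>a. ?F i (?\<phi> a) - ?F i a) + (\<lambda>a. ?F (Suc i) (?\<phi> a))) a = (right_diff G g ^^ i) (left_diff G g f) a"
    if a: "a \<in> A" for a
  proof -
    \<comment> \<open>Left translation by \<open>g\<close> is conjugation followed by right translation, which mixes consecutive coefficients.\<close>
    have "?\<phi> a \<otimes> g = g \<otimes> a" using a by (simp add: m_assoc)
    then have "((\<lambda>a. ?F i (?\<phi> a) - ?F i a) + (\<lambda>a. ?F (Suc i) (?\<phi> a))) a = left_diff G g (?F i) a"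
      by (simp add: right_diff_def left_diff_def)
    then show ?thesis using right_diff_left_diff [of g g a i f] a by simp
  qed
  ultimately show "deg A (n - w - i * w) ((right_diff G g ^^ i) (left_diff G g f))"
    by (rule deg_transfer [OF _ _ A _]) (assumption, rule diff_commute)
qed

lemma left_diff_mult:
  assumes "x \<in> carrier G" "y \<in> carrier G" "z \<in> carrier G"
  shows "(left_diff G y (left_diff G x f) + (left_diff G x f + left_diff G y f)) z = left_diff G (x \<otimes> y) f z"
  using assms by (simp add: left_diff_def m_assoc)

text \<open>
  Elements of weight above \<open>w\<close> lie in \<open>A\<close>, where the claim is immediate. Otherwise \<open>x = a g\<^sup>t\<close> with
  both factors of weight \<open>k\<close>, and the elements with the required property are closed under products.
\<close>

lemma coeff_deg_left_diff:
  fixes f :: "'a \<Rightarrow> 'k::ab_group_add"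
  assumes f: "coeff_deg n f" and x: "x \<in> P k" "x \<in> B" and k: "k \<ge> 1"
  shows "coeff_deg (n - k) (left_diff G x f)"
proof (cases "k > w")
  case True
  then have "P k \<subseteq> P (Suc w)" by (intro P_antimono) simp
  then have "x \<in> A" using x PA by blast
  then show ?thesis using coeff_deg_left_diff_A [OF f _ x(1) k] by simp
next
  case False
  define good where "good x \<longleftrightarrow> x \<in> carrier G \<and> (\<forall>n. \<forall>f::'a \<Rightarrow> 'k. coeff_deg n f \<longrightarrow> coeff_deg (n - k) (left_diff G x f))" for x
  have mult: "good (x \<otimes> y)" if xy: "good x" "good y" for x y
    unfolding good_def
  proof (intro conjI allI impI)
    have c: "x \<in> carrier G" "y \<in> carrier G" using xy by (auto simp: good_def)
    then show "x \<otimes> y \<in> carrier G" by simp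
    fix n and f :: "'a \<Rightarrow> 'k" assume f: "coeff_deg n f"
    have dx: "coeff_deg (n - k) (left_diff G x f)" and dy: "coeff_deg (n - k) (left_diff G y f)"
      using xy f by (auto simp: good_def)
    have "coeff_deg (n - k - k) (left_diff G y (left_diff G x f))" using dx xy(2) unfolding good_def by blast
    then have "coeff_deg (n - k) (left_diff G y (left_diff G x f))" by (rule coeff_deg_mono) simp
    then have "coeff_deg (n - k) (left_diff G y (left_diff G x f) + (left_diff G x f + left_diff G y f))"
      by (intro coeff_deg_add dx dy)
    then show "coeff_deg (n - k) (left_diff G (x \<otimes> y) f)"
      by (rule coeff_deg_cong [OF left_diff_mult [OF c], rotated])
  qed
  have gg: "good g"
    unfolding good_def using coeff_deg_left_diff_g coeff_deg_mono False
    by (metis diff_le_mono2 g linorder_not_less)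
  have ga: "good a" if "a \<in> A" "a \<in> P k" for a
    unfolding good_def by (intro conjI allI impI coeff_deg_left_diff_A [OF _ that k]) (use that in simp_all)
  have gt: "good (g [^] t)" for t :: nat
  proof (induction t)
    case 0
    then show ?case using ga [of \<one>] A_closed(3) subgroup.one_closed [OF P_subgroup] by simp
  qed (use gg mult in simp)
  obtain a t where at: "x = a \<otimes> g [^] (t::nat)" "a \<in> A" using x(2) unfolding B_def by blast
  have "g \<in> P k" using gP P_antimono [of k w] False by auto
  then have "g [^] t \<in> P k" by (induction t) (use subgroup.one_closed [OF P_subgroup] subgroup.m_closed [OF P_subgroup] in auto)
  moreover have "a = x \<otimes> inv (g [^] t)" using at by (simp add: m_assoc)
  ultimately have "a \<in> P k"
    using x(1) subgroup.m_closed [OF P_subgroup] subgroup.m_inv_closed [OF P_subgroup] by blast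
  then have "good x" using ga [OF at(2)] gt mult at(1) by blast
  then show ?thesis using f unfolding good_def by blast
qed

lemma coeff_deg_imp_deg:
  "coeff_deg n f \<Longrightarrow> deg B n f"
proof (induction n arbitrary: f rule: less_induct)
  case (less n)
  show ?case
  proof (rule degI)
    fix y assume n: "n = 0" and "y \<in> B"
    then obtain a t where y: "y = a \<otimes> g [^] (t::nat)" "a \<in> A" unfolding B_def by blast
    have "(right_diff G g ^^ i) f a = 0" for i
      using less.prems y(2) n unfolding coeff_deg_def by auto
    then show "f y = 0" using right_diff_Newton [of g a f t] y by simp
  next
    fix k x assume "0 < n" "1 \<le> k" "x \<in> P k" "x \<in> B"
    then show "deg B (n - k) (left_diff G x f)"
      using coeff_deg_left_diff less.prems by (intro less.IH) auto
  qed
qed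

text \<open>
  Right differences lower the degree, which gives one direction. For the other, the condition on the coefficients is
  stable under left differences with the corresponding loss of degree, and for \<open>n = 0\<close> the Newton expansion
  recovers the function from its vanishing coefficients. Coefficients with \<open>i \<ge> p\<close> vanish in exponent \<open>p\<close>.
\<close>

lemma deg_B_iff:
  assumes torsion: "\<And>y. nsm p (f y) = 0"
  shows "deg B n f \<longleftrightarrow> (\<forall>i < p. deg A (n - i * w) ((right_diff G g ^^ i) f))"
proof
  assume "\<forall>i < p. deg A (n - i * w) ((right_diff G g ^^ i) f)"
  moreover have "deg A (n - i * w) ((right_diff G g ^^ i) f)" if "i \<ge> p" for i
    using right_diff_prime [OF g _ torsion that] by (intro deg_eq_0 A) auto
  ultimately have "coeff_deg n f" unfolding coeff_deg_def using not_le by blast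
  then show "deg B n f" by (rule coeff_deg_imp_deg)
qed (use deg_imp_coeff_deg in \<open>auto simp: coeff_deg_def\<close>)

text \<open>
  The Newton expansion determines \<open>f\<close>, while the iterated differences are the form in which
  \<open>deg_B_iff\<close> measures its degree.
\<close>

definition has_coefficients :: "('a \<Rightarrow> 'k::ab_group_add) \<Rightarrow> (nat \<Rightarrow> 'a \<Rightarrow> 'k) \<Rightarrow> bool" where
  "has_coefficients f v \<longleftrightarrow> (\<forall>y. y \<notin> B \<longrightarrow> f y = 0) \<and>
     (\<forall>a \<in> A. \<forall>t < p. f (a \<otimes> g [^] t) = (\<Sum>i\<le>t. nsm (t choose i) (v i a))) \<and>
     (\<forall>a \<in> A. \<forall>i < p. (right_diff G g ^^ i) f a = v i a)"

lemma has_coefficientsD: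
  assumes "has_coefficients f v"
  shows "y \<notin> B \<Longrightarrow> f y = 0"
    and "\<lbrakk>a \<in> A; t < p\<rbrakk> \<Longrightarrow> f (a \<otimes> g [^] t) = (\<Sum>i\<le>t. nsm (t choose i) (v i a))"
    and "\<lbrakk>a \<in> A; i < p\<rbrakk> \<Longrightarrow> (right_diff G g ^^ i) f a = v i a"
  using assms by (simp_all add: has_coefficients_def)

lemma exists_with_coefficients: "\<exists>f. has_coefficients f v"
proof -
  define f where "f y = (if y \<in> B then (let (a, t) = (SOME (a, t). a \<in> A \<and> t < p \<and> y = a \<otimes> g [^] t)
      in \<Sum>i\<le>t. nsm (t choose i) (v i a)) else 0)" for y
  have f: "f (a \<otimes> g [^] t) = (\<Sum>i\<le>t. nsm (t choose i) (v i a))" if "a \<in> A" "t < p" for a t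
  proof -
    have "(SOME (b, s). b \<in> A \<and> s < p \<and> a \<otimes> g [^] t = b \<otimes> g [^] s) = (a, t)"
      using that B_unique [of a t] by (intro some_equality) (auto dest: sym)
    then show ?thesis using B_I [OF that(1)] by (simp add: f_def)
  qed
  \<comment> \<open>By Pascal's rule a difference shifts the coefficients. Only exponents below \<open>p\<close> occur, where \<open>f\<close> is given by the formula.\<close>
  have E: "(right_diff G g ^^ i) f (a \<otimes> g [^] t) = (\<Sum>j\<le>t. nsm (t choose j) (v (i + j) a))"
    if "a \<in> A" "i + t < p" for i t a
    using that(2)
  proof (induction i arbitrary: t)
    case 0
    then show ?case using f [OF that(1)] by simp
  next
    case (Suc i)
    have "a \<otimes> g [^] t \<otimes> g = a \<otimes> g [^] Suc t" using that(1) by (simp add: m_assoc)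
    then have "(right_diff G g ^^ Suc i) f (a \<otimes> g [^] t)
       = (right_diff G g ^^ i) f (a \<otimes> g [^] Suc t) - (right_diff G g ^^ i) f (a \<otimes> g [^] t)"
      by (simp add: right_diff_def)
    also have "\<dots> = (\<Sum>j\<le>Suc t. nsm (Suc t choose j) (v (i + j) a)) - (\<Sum>j\<le>t. nsm (t choose j) (v (i + j) a))"
      using Suc.IH [of t] Suc.IH [of "Suc t"] Suc.prems by (simp del: nat_pow_Suc)
    also have "(\<Sum>j\<le>t. nsm (t choose j) (v (i + j) a)) = (\<Sum>j\<le>Suc t. nsm (t choose j) (v (i + j) a))"
      by (simp add: binomial_eq_0)
    also have "(\<Sum>j\<le>Suc t. nsm (Suc t choose j) (v (i + j) a)) - (\<Sum>j\<le>Suc t. nsm (t choose j) (v (i + j) a))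
       = (\<Sum>j\<le>t. nsm (t choose j) (v (Suc i + j) a))"
      unfolding sum.atMost_Suc_shift by (simp add: nsm_add_left sum.distrib)
    finally show ?case .
  qed
  have "(right_diff G g ^^ i) f a = v i a" if "a \<in> A" "i < p" for a i
    using E [of a i 0] that by simp
  then show ?thesis using f by (intro exI [of _ f]) (auto simp: f_def has_coefficients_def)
qed

lemma eq_if_coefficients_eq:
  assumes "\<And>y. y \<notin> B \<Longrightarrow> f y = 0" "\<And>y. y \<notin> B \<Longrightarrow> h y = 0"
    and "\<And>a i. \<lbrakk>a \<in> A; i < p\<rbrakk> \<Longrightarrow> (right_diff G g ^^ i) f a = (right_diff G g ^^ i) h a"
  shows "f = h"
proof
  fix y
  show "f y = h y"
  proof (cases "y \<in> B")
    case True
    then obtain a t where "y = a \<otimes> g [^] t" "a \<in> A" "t < p" unfolding B_def by blast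
    then show ?thesis by (simp add: right_diff_Newton [of g a _ t] assms(3))
  qed (use assms in simp)
qed

end

section \<open>Degree bounds with infinite multiplicity\<close>

text \<open>
  A sequence of degree bounds in which each of the numbers \<open>0, \<dots>, c + 1\<close> occurs infinitely often.
  The bound \<open>c + 1\<close> makes the translations faithful; the bound \<open>0\<close> admits only zero and absorbs the
  shifts that are too large.
\<close>

definition top_degree :: "nat \<Rightarrow> nat \<Rightarrow> nat" where
  "top_degree c s = fst (prod_decode s) mod (c + 2)"

lemma top_degree_le: "top_degree c s \<le> Suc c"
  using mod_less_divisor [of "c + 2" "fst (prod_decode s)"] by (simp add: top_degree_def)

lemma infinite_top_degree:
  assumes "m \<le> Suc c" shows "infinite {s. top_degree c s = m}"
proof -
  have "range (\<lambda>k. prod_encode (m, k)) \<subseteq> {s. top_degree c s = m}"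
    using assms by (auto simp: top_degree_def)
  moreover have "inj (\<lambda>k. prod_encode (m, k))" by (auto simp: inj_def)
  ultimately show ?thesis using range_inj_infinite infinite_super by blast
qed

lemma bij_betw_infinite_fibres:
  fixes X :: "'x::countable set" and Y :: "'y::countable set"
  assumes "\<And>x. x \<in> X \<Longrightarrow> \<alpha> x \<in> M" "\<And>y. y \<in> Y \<Longrightarrow> \<beta> y \<in> M"
    and "\<And>m. m \<in> M \<Longrightarrow> infinite {x \<in> X. \<alpha> x = m}" "\<And>m. m \<in> M \<Longrightarrow> infinite {y \<in> Y. \<beta> y = m}"
  shows "\<exists>\<sigma>. bij_betw \<sigma> X Y \<and> (\<forall>x \<in> X. \<beta> (\<sigma> x) = \<alpha> x)"
proof -
  have "\<exists>h. bij_betw h {x \<in> X. \<alpha> x = m} {y \<in> Y. \<beta> y = m}" if "m \<in> M" for m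
    by (rule exI, rule bij_betw_trans [OF bij_betw_from_nat_into [THEN bij_betw_inv_into] bij_betw_from_nat_into])
      (use assms(3,4) [OF that] in auto)
  then have "\<forall>m \<in> M. \<exists>h. bij_betw h {x \<in> X. \<alpha> x = m} {y \<in> Y. \<beta> y = m}" by (rule ballI)
  from bchoice [OF this] obtain h
    where h': "\<forall>m \<in> M. bij_betw (h m) {x \<in> X. \<alpha> x = m} {y \<in> Y. \<beta> y = m}"
    by (rule exE)
  then have h: "\<And>m. m \<in> M \<Longrightarrow> bij_betw (h m) {x \<in> X. \<alpha> x = m} {y \<in> Y. \<beta> y = m}"
    by (rule bspec)
  define \<sigma> where "\<sigma> x = h (\<alpha> x) x" for x
  have \<sigma>: "\<sigma> x \<in> Y \<and> \<beta> (\<sigma> x) = \<alpha> x" if "x \<in> X" for x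
    using bij_betw_apply [OF h [OF assms(1) [OF that]], of x] that unfolding \<sigma>_def by simp
  have "bij_betw \<sigma> X Y"
  proof (rule bij_betwI')
    fix x y assume xy: "x \<in> X" "y \<in> X"
    show "\<sigma> x = \<sigma> y \<longleftrightarrow> x = y"
    proof
      assume eq: "\<sigma> x = \<sigma> y"
      then have "\<alpha> x = \<alpha> y" using \<sigma> xy by metis
      then show "x = y"
        using eq xy bij_betw_imp_inj_on [OF h [OF assms(1) [OF xy(1)]]] unfolding \<sigma>_def inj_on_def by auto
    qed simp
  next
    fix y assume y: "y \<in> Y"
    then have "y \<in> h (\<beta> y) ` {x \<in> X. \<alpha> x = \<beta> y}"
      using bij_betw_imp_surj_on [OF h [OF assms(2) [OF y]]] by simp
    then obtain x where "x \<in> X" "\<alpha> x = \<beta> y" "h (\<beta> y) x = y" by auto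
    then show "\<exists>x \<in> X. y = \<sigma> x" unfolding \<sigma>_def by (intro bexI [of _ x]) simp_all
  qed (use \<sigma> in auto)
  then show ?thesis using \<sigma> by blast
qed

text \<open>
  The shifted bounds again take each of the values infinitely often, already because of the shift by zero.
\<close>

lemma reindex_top_degree:
  assumes "p > 0"
  shows "\<exists>\<sigma>. bij_betw \<sigma> UNIV (UNIV \<times> {..<p}) \<and>
    (\<forall>n. top_degree c (fst (\<sigma> n)) - snd (\<sigma> n) * w = top_degree c n)"
proof -
  have "infinite {y \<in> UNIV \<times> {..<p}. top_degree c (fst y) - snd y * w = m}" if "m \<in> {..Suc c}" for m
  proof -
    have "(\<lambda>s. (s, 0)) ` {s. top_degree c s = m} \<subseteq> {y \<in> UNIV \<times> {..<p}. top_degree c (fst y) - snd y * w = m}"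
      using assms by auto
    moreover have "infinite ((\<lambda>s. (s, 0::nat)) ` {s. top_degree c s = m})"
      using infinite_top_degree [of m c] that by (subst finite_image_iff) (auto simp: inj_on_def)
    ultimately show ?thesis using infinite_super by blast
  qed
  then have "\<exists>\<sigma>. bij_betw \<sigma> UNIV (UNIV \<times> {..<p}) \<and>
      (\<forall>n \<in> UNIV. top_degree c (fst (\<sigma> n)) - snd (\<sigma> n) * w = top_degree c n)"
    by (intro bij_betw_infinite_fibres [where M = "{..Suc c}"])
       (use top_degree_le infinite_top_degree in \<open>auto intro: le_trans [OF diff_le_self]\<close>)
  then show ?thesis by simp
qed

definition flag_iso :: "('v \<Rightarrow> 'w) \<Rightarrow> (nat \<Rightarrow> 'v::ab_group_add set) \<Rightarrow> (nat \<Rightarrow> 'w::ab_group_add set) \<Rightarrow> bool" where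
  "flag_iso \<Theta> V W \<longleftrightarrow> bij_betw \<Theta> (V 0) (W 0) \<and> (\<forall>x \<in> V 0. \<forall>y \<in> V 0. \<Theta> (x + y) = \<Theta> x + \<Theta> y) \<and>
     (\<forall>j. \<forall>x \<in> V 0. \<Theta> x \<in> W j \<longleftrightarrow> x \<in> V j)"

lemma flag_iso_id: "flag_iso id V V"
  by (simp add: flag_iso_def)

lemma flag_iso_mem: "\<lbrakk>flag_iso \<Theta> V W; x \<in> V 0\<rbrakk> \<Longrightarrow> \<Theta> x \<in> W 0"
  by (simp add: flag_iso_def)

lemma flag_iso_comp:
  assumes "flag_iso \<Theta> U V" "flag_iso \<Theta>' V W" shows "flag_iso (\<Theta>' \<circ> \<Theta>) U W"
  using assms flag_iso_mem [OF assms(1)] unfolding flag_iso_def by (auto intro: bij_betw_trans)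

definition transport :: "('v \<Rightarrow> 'w) \<Rightarrow> 'v set \<Rightarrow> 'w set \<Rightarrow> ('v \<Rightarrow> 'v) \<Rightarrow> 'w \<Rightarrow> 'w" where
  "transport \<Theta> V W d = (\<lambda>f. if f \<in> W then \<Theta> (d (inv_into V \<Theta> f)) else f)"

lemma transport_embedding:
  assumes V: "flag V c p" and W: "flag W c p" and iso: "flag_iso \<Theta> V W"
  shows "embedding (transport \<Theta> (V 0) (W 0)) (flag.unipotent V) (flag.unipotent W)"
proof -
  interpret V: flag V c p by fact
  interpret W: flag W c p by fact
  have bij: "bij_betw \<Theta> (V 0) (W 0)" and add: "\<And>x y. \<lbrakk>x \<in> V 0; y \<in> V 0\<rbrakk> \<Longrightarrow> \<Theta> (x + y) = \<Theta> x + \<Theta> y"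
    and lev: "\<And>x j. x \<in> V 0 \<Longrightarrow> \<Theta> x \<in> W j \<longleftrightarrow> x \<in> V j"
    using iso by (auto simp: flag_iso_def)
  let ?\<Psi> = "inv_into (V 0) \<Theta>"
  have bij': "bij_betw ?\<Psi> (W 0) (V 0)" using bij by (rule bij_betw_inv_into)
  have \<Psi>V: "?\<Psi> x \<in> V 0" if "x \<in> W 0" for x using bij' that by (rule bij_betw_apply)
  have \<Theta>\<Psi>: "\<Theta> (?\<Psi> x) = x" if "x \<in> W 0" for x using bij that by (rule bij_betw_inv_into_right)
  have \<Psi>\<Theta>: "?\<Psi> (\<Theta> x) = x" if "x \<in> V 0" for x using bij that by (rule bij_betw_inv_into_left)
  have \<Theta>W: "\<Theta> x \<in> W 0" if "x \<in> V 0" for x using bij that by (rule bij_betw_apply)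
  have \<Psi>add: "?\<Psi> (x + y) = ?\<Psi> x + ?\<Psi> y" if "x \<in> W 0" "y \<in> W 0" for x y
    using add [OF \<Psi>V [OF that(1)] \<Psi>V [OF that(2)]] \<Psi>\<Theta> [OF V.add [OF \<Psi>V [OF that(1)] \<Psi>V [OF that(2)]]]
      \<Theta>\<Psi> that by simp
  have \<Theta>diff: "\<Theta> (x - y) = \<Theta> x - \<Theta> y" if "x \<in> V 0" "y \<in> V 0" for x y
    using add [OF V.diff [OF that] that(2)] by (simp add: algebra_simps)
  let ?T = "transport \<Theta> (V 0) (W 0)"
  have mem: "?T d \<in> carrier W.unipotent" if d: "d \<in> carrier V.unipotent" for d
  proof -
    have "bij_betw d (V 0) (V 0)" using V.unipotent_permutes [OF d] by (rule permutes_imp_bij)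
    then have "bij_betw (\<Theta> \<circ> (d \<circ> ?\<Psi>)) (W 0) (W 0)" using bij bij' by (intro bij_betw_trans)
    then have "bij_betw (?T d) (W 0) (W 0)"
      by (rule bij_betw_cong [THEN iffD1, rotated]) (simp add: transport_def)
    then have "?T d permutes W 0" by (rule bij_imp_permutes) (simp add: transport_def)
    moreover have "?T d (x + y) = ?T d x + ?T d y" if "x \<in> W 0" "y \<in> W 0" for x y
      using that W.add [OF that] by (simp add: transport_def \<Psi>add V.unipotent_add [OF d] \<Psi>V V.unipotent_mem [OF d] add)
    moreover have "?T d x - x \<in> W (Suc j)" if x: "x \<in> W j" for x j
    proof -
      have x0: "x \<in> W 0" using x by (rule W.mem_0)
      have "?\<Psi> x \<in> V j" using lev [OF \<Psi>V [OF x0]] \<Theta>\<Psi> [OF x0] x by simp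
      then have "d (?\<Psi> x) - ?\<Psi> x \<in> V (Suc j)" by (rule V.unipotent_raises [OF d])
      then have "\<Theta> (d (?\<Psi> x) - ?\<Psi> x) \<in> W (Suc j)" using lev V.mem_0 by blast
      then show ?thesis
        using x0 by (simp add: transport_def \<Theta>diff V.unipotent_mem [OF d] \<Psi>V \<Theta>\<Psi>)
    qed
    ultimately show ?thesis by (simp add: W.unipotent_def)
  qed
  have comp: "?T (d \<circ> d') = ?T d \<circ> ?T d'" if "d \<in> carrier V.unipotent" "d' \<in> carrier V.unipotent" for d d'
    using that by (auto simp: transport_def fun_eq_iff \<Psi>V \<Psi>\<Theta> \<Theta>W V.unipotent_mem)
  have inj: "inj_on ?T (carrier V.unipotent)"
  proof (rule inj_onI)
    fix d d' assume d: "d \<in> carrier V.unipotent" "d' \<in> carrier V.unipotent" and eq: "?T d = ?T d'"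
    have "d x = d' x" for x
    proof (cases "x \<in> V 0")
      case True
      have "?\<Psi> (?T d (\<Theta> x)) = ?\<Psi> (?T d' (\<Theta> x))" using eq by simp
      then show ?thesis using True d by (simp add: transport_def \<Theta>W \<Psi>\<Theta> V.unipotent_mem)
    next
      case False
      then show ?thesis
        using permutes_not_in [OF V.unipotent_permutes [OF d(1)] False] permutes_not_in [OF V.unipotent_permutes [OF d(2)] False]
        by simp
    qed
    then show "d = d'" by auto
  qed
  show ?thesis unfolding embedding_def using mem comp inj by (auto simp: hom_def)
qed

text \<open>
  A product of spaces of polynomial functions on \<open>A\<close>, one for each entry of the sequence of bounds. Extension
  by zero outside \<open>A\<close> makes the functions determined by their restriction to \<open>A\<close>.
\<close>

definition degree_flag :: "('a, 'b) monoid_scheme \<Rightarrow> (nat \<Rightarrow> 'a set) \<Rightarrow> nat \<Rightarrow> nat \<Rightarrow> 'a set \<Rightarrow> nat \<Rightarrow>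
    (nat \<Rightarrow> 'a \<Rightarrow> 'k::ab_group_add) set" where
  "degree_flag G P c p A j = {f. \<forall>s. (\<forall>y. y \<notin> A \<longrightarrow> f s y = 0) \<and> (\<forall>y. nsm p (f s y) = 0) \<and>
     degree_less G P A (top_degree c s - j) (f s)}"

definition translate :: "('a, 'b) monoid_scheme \<Rightarrow> 'a set \<Rightarrow> 'a \<Rightarrow> (nat \<Rightarrow> 'a \<Rightarrow> 'k::zero) \<Rightarrow> nat \<Rightarrow> 'a \<Rightarrow> 'k" where
  "translate G A a f = (\<lambda>s y. if y \<in> A then f s (inv\<^bsub>G\<^esub> a \<otimes>\<^bsub>G\<^esub> y) else 0)"

definition translation :: "('a, 'b) monoid_scheme \<Rightarrow> 'a set \<Rightarrow> (nat \<Rightarrow> 'a \<Rightarrow> 'k::zero) set \<Rightarrow> 'a \<Rightarrow>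
    (nat \<Rightarrow> 'a \<Rightarrow> 'k) \<Rightarrow> nat \<Rightarrow> 'a \<Rightarrow> 'k" where
  "translation G A W a = (\<lambda>f. if f \<in> W then translate G A a f else f)"

section \<open>Restriction to a subgroup\<close>

lemma nsm_sum: "nsm n (sum f I) = (\<Sum>i\<in>I. nsm n (f i))"
  by (induction I rule: infinite_finite_induct) (simp_all add: nsm_add_right)

lemma nsm_commute: "nsm m (nsm n x) = nsm n (nsm m x)"
  by (simp add: mult.commute flip: nsm_mult)

context filtered_group begin

lemma degree_flag_is_flag:
  assumes A: "subgroup A G"
  shows "flag (degree_flag G P c p A :: nat \<Rightarrow> (nat \<Rightarrow> 'a \<Rightarrow> 'k::ab_group_add) set) c p"
proof
  fix j and x y :: "nat \<Rightarrow> 'a \<Rightarrow> 'k"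
  show "0 \<in> degree_flag G P c p A j"
    by (auto simp: degree_flag_def intro: deg_eq_0 [OF _ A])
  show "x - y \<in> degree_flag G P c p A j" if "x \<in> degree_flag G P c p A j" "y \<in> degree_flag G P c p A j"
  proof -
    have "x s - y s = (\<lambda>v. x s v - y s v)" for s by (simp add: fun_eq_iff)
    then have "deg A (top_degree c s - j) (\<lambda>v. x s v - y s v)" for s
      using that deg_diff [of A "top_degree c s - j" "x s" "y s"] by (simp add: degree_flag_def)
    then show ?thesis using that by (simp add: degree_flag_def nsm_diff_right fun_diff_def)
  qed
  show "degree_flag G P c p A (Suc j) \<subseteq> (degree_flag G P c p A j :: (nat \<Rightarrow> 'a \<Rightarrow> 'k) set)"
  proof
    fix f :: "nat \<Rightarrow> 'a \<Rightarrow> 'k" assume f: "f \<in> degree_flag G P c p A (Suc j)"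
    then have "deg A (top_degree c s - Suc j) (f s)" for s by (simp add: degree_flag_def)
    then have "deg A (top_degree c s - j) (f s)" for s by (rule deg_mono [OF _ _ A]) simp
    then show "f \<in> degree_flag G P c p A j" using f by (simp add: degree_flag_def)
  qed
  show "nsm p x = 0" if "x \<in> degree_flag G P c p A 0"
    using that by (auto simp: degree_flag_def fun_eq_iff nsm_apply)
next
  show "degree_flag G P c p A (Suc c) = {0 :: nat \<Rightarrow> 'a \<Rightarrow> 'k}"
  proof (intro equalityI subsetI)
    fix f :: "nat \<Rightarrow> 'a \<Rightarrow> 'k" assume f: "f \<in> degree_flag G P c p A (Suc c)"
    have "f s y = 0" for s y
    proof -
      have z: "top_degree c s - Suc c = 0" using top_degree_le by simp
      have "deg A (top_degree c s - Suc c) (f s)" "y \<notin> A \<Longrightarrow> f s y = 0" using f by (auto simp: degree_flag_def)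
      then show ?thesis unfolding z by auto
    qed
    then show "f \<in> {0}" by (simp add: fun_eq_iff)
  qed (simp add: degree_flag_def top_degree_le)
qed

lemma right_diff_torsion:
  assumes "\<And>y. nsm p (f y) = 0" shows "nsm p ((right_diff G z ^^ i) f y) = 0"
  by (induction i arbitrary: y) (use assms in \<open>auto simp: right_diff_def nsm_diff_right\<close>)

lemma right_diff_translate:
  assumes "x \<in> carrier G" "z \<in> carrier G" "y \<in> carrier G"
  shows "(right_diff G z ^^ i) (\<lambda>y. f (x \<otimes> y)) y = (right_diff G z ^^ i) f (x \<otimes> y)"
  using assms(3)
proof (induction i arbitrary: y)
  case (Suc i)
  then show ?case using assms(1,2) by (simp add: right_diff_def m_assoc)
qed simp

end

text \<open>
  The isomorphism sends a family to the family of all its coefficients along \<open>g\<close>. The \<open>i\<close>-th coefficient of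
  a function with bound \<open>n\<close> has bound \<open>n - i w\<close>, and \<open>\<sigma>\<close> renumbers the pairs of a member and a coefficient so
  that the bounds are the standard ones again. Left translations by \<open>A\<close> commute with right
  differences, which makes the map equivariant.
\<close>

lemma (in cyclic_extension) degree_flag_step:
  "\<exists>\<Theta>. flag_iso \<Theta> (degree_flag G P c p B :: nat \<Rightarrow> (nat \<Rightarrow> 'a \<Rightarrow> 'k::ab_group_add) set) (degree_flag G P c p A :: nat \<Rightarrow> (nat \<Rightarrow> 'a \<Rightarrow> 'k) set) \<and>
     (\<forall>a \<in> A. \<forall>f \<in> degree_flag G P c p B 0. \<Theta> (translate G B a f) = translate G A a (\<Theta> f))"
proof -
  obtain \<sigma> where "bij_betw \<sigma> UNIV (UNIV \<times> {..<p}) \<and>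
      (\<forall>n. top_degree c (fst (\<sigma> n)) - snd (\<sigma> n) * w = top_degree c n)"
    using reindex_top_degree [OF p_pos] by (rule exE)
  then have \<sigma>: "bij_betw \<sigma> UNIV (UNIV \<times> {..<p})"
    "\<And>n. top_degree c (fst (\<sigma> n)) - snd (\<sigma> n) * w = top_degree c n"
    by simp_all
  have \<sigma>p: "snd (\<sigma> n) < p" for n using bij_betwE [OF \<sigma>(1)] by (metis UNIV_I lessThan_iff mem_Times_iff)
  have \<sigma>surj: "\<exists>n. \<sigma> n = (s, i)" if "i < p" for s i
  proof -
    have "(s, i) \<in> range \<sigma>" using that bij_betw_imp_surj_on [OF \<sigma>(1)] by simp
    then show ?thesis by (metis rangeE)
  qed
  define \<Theta> :: "(nat \<Rightarrow> 'a \<Rightarrow> 'k) \<Rightarrow> nat \<Rightarrow> 'a \<Rightarrow> 'k"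
    where "\<Theta> f = (\<lambda>n a. if a \<in> A then (right_diff G g ^^ snd (\<sigma> n)) (f (fst (\<sigma> n))) a else 0)" for f
  let ?V = "degree_flag G P c p B :: nat \<Rightarrow> (nat \<Rightarrow> 'a \<Rightarrow> 'k) set"
  let ?W = "degree_flag G P c p A :: nat \<Rightarrow> (nat \<Rightarrow> 'a \<Rightarrow> 'k) set"
  have level: "\<Theta> f \<in> ?W j \<longleftrightarrow> f \<in> ?V j"
    if supp: "\<And>s y. y \<notin> B \<Longrightarrow> f s y = 0" and tors: "\<And>s y. nsm p (f s y) = 0" for f j
  proof -
    have "f \<in> ?V j \<longleftrightarrow> (\<forall>s. deg B (top_degree c s - j) (f s))"
      using that unfolding degree_flag_def by auto
    also have "\<dots> \<longleftrightarrow> (\<forall>s. \<forall>i < p. deg A (top_degree c s - j - i * w) ((right_diff G g ^^ i) (f s)))"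
      using deg_B_iff tors by blast
    also have "\<dots> \<longleftrightarrow> (\<forall>n. deg A (top_degree c n - j) ((right_diff G g ^^ snd (\<sigma> n)) (f (fst (\<sigma> n)))))"
    proof -
      have e: "top_degree c n - j = top_degree c (fst (\<sigma> n)) - j - snd (\<sigma> n) * w" for n
        unfolding \<sigma>(2) [of n, symmetric] by (rule diff_commute)
      have "(\<forall>n. deg A (top_degree c n - j) ((right_diff G g ^^ snd (\<sigma> n)) (f (fst (\<sigma> n))))) \<longleftrightarrow>
          (\<forall>n. deg A (top_degree c (fst (\<sigma> n)) - j - snd (\<sigma> n) * w) ((right_diff G g ^^ snd (\<sigma> n)) (f (fst (\<sigma> n)))))"
        by (intro all_cong1, subst e, rule refl)
      then show ?thesis using \<sigma>p \<sigma>surj by (metis fst_conv snd_conv)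
    qed
    also have "\<dots> \<longleftrightarrow> (\<forall>n. deg A (top_degree c n - j) (\<Theta> f n))"
      by (intro all_cong1 deg_cong A) (simp add: \<Theta>_def)
    also have "\<dots> \<longleftrightarrow> \<Theta> f \<in> ?W j"
      unfolding degree_flag_def by (auto simp: \<Theta>_def right_diff_torsion tors)
    finally show ?thesis by simp
  qed
  have supp: "f s y = 0" if "f \<in> ?V 0" "y \<notin> B" for f s y using that by (simp add: degree_flag_def)
  have tors: "nsm p (f s y) = 0" if "f \<in> ?V 0" for f s y using that by (simp add: degree_flag_def)
  have inj: "inj_on \<Theta> (?V 0)"
  proof (rule inj_onI)
    fix f h assume fh: "f \<in> ?V 0" "h \<in> ?V 0" and eq: "\<Theta> f = \<Theta> h"
    have "f s = h s" for s
    proof (rule eq_if_coefficients_eq)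
      fix a i assume a: "a \<in> A" and i: "i < p"
      obtain n where n: "\<sigma> n = (s, i)" using \<sigma>surj [OF i] by blast
      have "\<Theta> f n a = \<Theta> h n a" using eq by simp
      then show "(right_diff G g ^^ i) (f s) a = (right_diff G g ^^ i) (h s) a" using a n by (simp add: \<Theta>_def)
    qed (use supp fh in auto)
    then show "f = h" by auto
  qed
  have surj: "\<exists>f \<in> ?V 0. \<Theta> f = h" if h: "h \<in> ?W 0" for h
  proof -
    let ?v = "\<lambda>s i. h (inv_into UNIV \<sigma> (s, i))"
    have "\<forall>s. \<exists>f. has_coefficients f (?v s)" using exists_with_coefficients by (rule allI)
    from choice [OF this] obtain f where "\<forall>s. has_coefficients (f s) (?v s)" by (rule exE)
    then have "has_coefficients (f s) (?v s)" for s by (rule spec)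
    note f = has_coefficientsD [OF this]
    have "\<Theta> f n a = h n a" for n a
    proof (cases "a \<in> A")
      case True
      have "inv_into UNIV \<sigma> (\<sigma> n) = n" using \<sigma>(1) by (simp add: bij_betw_def)
      then show ?thesis using f(3) [OF True \<sigma>p] True by (simp add: \<Theta>_def)
    next
      case False
      then show ?thesis using h by (simp add: \<Theta>_def degree_flag_def)
    qed
    then have eq: "\<Theta> f = h" by auto
    have "nsm p (f s y) = 0" for s y
    proof (cases "y \<in> B")
      case True
      then obtain a t where y: "y = a \<otimes> g [^] t" "a \<in> A" "t < p" unfolding B_def by blast
      have "nsm p (?v s i a) = 0" for i using h by (simp add: degree_flag_def)
      then show ?thesis unfolding y(1) f(2) [OF y(2,3)] nsm_sum nsm_commute [of p] by simp
    qed (simp add: f(1))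
    then have "f \<in> ?V 0" using level [of f 0] f(1) eq h by blast
    then show ?thesis using eq by blast
  qed
  have "\<Theta> (translate G B a f) = translate G A a (\<Theta> f)" if a: "a \<in> A" and f: "f \<in> ?V 0" for a f
  proof (intro ext)
    fix n y
    let ?i = "snd (\<sigma> n)" and ?s = "fst (\<sigma> n)"
    show "\<Theta> (translate G B a f) n y = translate G A a (\<Theta> f) n y"
    proof (cases "y \<in> A")
      case True
      have ay: "inv a \<otimes> y \<in> A" using True a A_closed by simp
      have "translate G B a f ?s z = f ?s (inv a \<otimes> z)" if z: "z \<in> carrier G" for z
      proof (cases "z \<in> B")
        case False
        have "inv a \<otimes> z \<notin> B"
        proof
          assume "inv a \<otimes> z \<in> B"
          then have "a \<otimes> (inv a \<otimes> z) \<in> B" by (rule subgroup.m_closed [OF B_subgroup subsetD [OF A_subset_B a]])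
          then show False using False a z by (simp add: cancel_left')
        qed
        then show ?thesis using False supp [OF f] by (simp add: translate_def)
      qed (simp add: translate_def)
      then have "(right_diff G g ^^ ?i) (translate G B a f ?s) y = (right_diff G g ^^ ?i) (\<lambda>z. f ?s (inv a \<otimes> z)) y"
        using True by (intro right_diff_cong) auto
      also have "\<dots> = (right_diff G g ^^ ?i) (f ?s) (inv a \<otimes> y)"
        using True a by (intro right_diff_translate) auto
      finally show ?thesis using True ay by (simp add: \<Theta>_def translate_def)
    qed (simp add: \<Theta>_def translate_def)
  qed
  moreover have "flag_iso \<Theta> ?V ?W"
    unfolding flag_iso_def
  proof (intro conjI allI ballI)
    have "\<Theta> ` ?V 0 = ?W 0" using surj level supp tors by (auto simp: image_iff)
    then show "bij_betw \<Theta> (?V 0) (?W 0)" using inj by (simp add: bij_betw_def)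
    show "\<Theta> (f + h) = \<Theta> f + \<Theta> h" for f h
      by (auto simp: \<Theta>_def fun_eq_iff right_diff_funpow_add)
    show "\<Theta> f \<in> ?W j \<longleftrightarrow> f \<in> ?V j" if "f \<in> ?V 0" for f j
      using level supp tors that by blast
  qed
  ultimately show ?thesis by blast
qed


text \<open>
  A proper subgroup is enlarged by an element \<open>g\<close> of the largest weight that is not yet exhausted. Since
  \<open>G\<close> is finite, the whole group is reached after finitely many steps.
\<close>

lemma (in filtered_group) subgroup_chain_induct [consumes 1, case_names whole extend]:
  assumes A: "subgroup A G" and whole: "Q (carrier G)"
    and extend: "\<And>A g w. \<lbrakk>cyclic_extension G P c p A g w; Q (cyclic_extension.B G p A g)\<rbrakk> \<Longrightarrow> Q A"
  shows "Q A"
  using A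
proof (induction "card (carrier G) - card A" arbitrary: A rule: less_induct)
  case less
  have AG: "A \<subseteq> carrier G" using less.prems subgroup.subset by blast
  show ?case
  proof (cases "A = carrier G")
    case False
    define K where "K = {k. k \<ge> 1 \<and> \<not> P k \<subseteq> A}"
    have "P k \<subseteq> A" if "k \<ge> Suc c" for k
      using P_antimono [OF that] P_trivial subgroup.one_closed [OF less.prems] by auto
    then have K: "K \<subseteq> {..c}" unfolding K_def using not_less_eq_eq by auto
    then have fin: "finite K" using finite_subset by blast
    have "1 \<in> K" unfolding K_def using P_1 False AG by auto
    then have w: "Max K \<in> K" using fin Max_in by blast
    then obtain g where g: "g \<in> P (Max K)" "g \<notin> A" unfolding K_def by blast
    have "Suc (Max K) \<notin> K" using Max_ge [OF fin] not_less_eq_eq by blast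
    then have "P (Suc (Max K)) \<subseteq> A" unfolding K_def by simp
    then interpret E: cyclic_extension G P c p A g "Max K"
      by (intro cyclic_extension.intro cyclic_extension_axioms.intro filtered_group_axioms)
        (use less.prems g w in \<open>simp_all add: K_def\<close>)
    have "E.B \<subseteq> carrier G" using E.B_subgroup subgroup.subset by blast
    then have "finite E.B" using finite_carrier finite_subset by blast
    then have "card A < card E.B" using E.A_subset_B E.g_B g(2) by (intro psubset_card_mono) auto
    moreover have "card E.B \<le> card (carrier G)" using \<open>E.B \<subseteq> carrier G\<close> finite_carrier by (rule card_mono [rotated])
    ultimately have "Q E.B" using E.B_subgroup by (intro less.hyps) linarith+
    then show ?thesis using extend E.cyclic_extension_axioms by blast
  qed (use whole in simp)
qed

lemma (in filtered_group) degree_flag_restrict: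
  assumes "subgroup A G"
  shows "\<exists>\<Theta>. flag_iso \<Theta> (degree_flag G P c p (carrier G) :: nat \<Rightarrow> (nat \<Rightarrow> 'a \<Rightarrow> 'k::ab_group_add) set) (degree_flag G P c p A :: nat \<Rightarrow> (nat \<Rightarrow> 'a \<Rightarrow> 'k) set) \<and>
     (\<forall>a \<in> A. \<forall>f \<in> degree_flag G P c p (carrier G) 0. \<Theta> (translate G (carrier G) a f) = translate G A a (\<Theta> f))"
  using assms
proof (induction rule: subgroup_chain_induct)
  case whole
  show ?case by (intro exI [of _ id] conjI ballI flag_iso_id) simp
next
  case (extend A g w)
  interpret E: cyclic_extension G P c p A g w by (rule extend)
  let ?F = "\<lambda>A. degree_flag G P c p A :: nat \<Rightarrow> (nat \<Rightarrow> 'a \<Rightarrow> 'k::ab_group_add) set"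
  obtain \<Theta> where "flag_iso \<Theta> (?F (carrier G)) (?F E.B) \<and>
     (\<forall>a \<in> E.B. \<forall>f \<in> ?F (carrier G) 0. \<Theta> (translate G (carrier G) a f) = translate G E.B a (\<Theta> f))"
    using extend(2) by (rule exE)
  then have 1: "flag_iso \<Theta> (?F (carrier G)) (?F E.B)"
     "\<And>a f. \<lbrakk>a \<in> E.B; f \<in> ?F (carrier G) 0\<rbrakk> \<Longrightarrow> \<Theta> (translate G (carrier G) a f) = translate G E.B a (\<Theta> f)"
    by simp_all
  obtain \<Theta>' where "flag_iso \<Theta>' (?F E.B) (?F A) \<and>
     (\<forall>a \<in> A. \<forall>f \<in> ?F E.B 0. \<Theta>' (translate G E.B a f) = translate G A a (\<Theta>' f))"
    using E.degree_flag_step by (rule exE)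
  then have 2: "flag_iso \<Theta>' (?F E.B) (?F A)"
     "\<And>a f. \<lbrakk>a \<in> A; f \<in> ?F E.B 0\<rbrakk> \<Longrightarrow> \<Theta>' (translate G E.B a f) = translate G A a (\<Theta>' f)"
    by simp_all
  have "(\<Theta>' \<circ> \<Theta>) (translate G (carrier G) a f) = translate G A a ((\<Theta>' \<circ> \<Theta>) f)"
    if "a \<in> A" "f \<in> ?F (carrier G) 0" for a f
    using 1(2) [OF subsetD [OF E.A_subset_B that(1)] that(2)] 2(2) [OF that(1) flag_iso_mem [OF 1(1) that(2)]]
    by simp
  then show ?case using flag_iso_comp [OF 1(1) 2(1)] by blast
qed

section \<open>Faithfulness of translations\<close>

definition (in filtered_group) separated :: "'k::ab_group_add itself \<Rightarrow> 'a set \<Rightarrow> bool" where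
  "separated TYPE('k) A \<longleftrightarrow> (\<forall>x \<in> A. x \<noteq> \<one> \<longrightarrow> (\<exists>f :: 'a \<Rightarrow> 'k. (\<forall>y. y \<notin> A \<longrightarrow> f y = 0) \<and> (\<forall>y. nsm p (f y) = 0) \<and>
      deg A (Suc c) f \<and> f x \<noteq> f \<one>))"

text \<open>
  Elements of \<open>A\<close> are separated by functions that are constant along \<open>g\<close>. The function \<open>a g\<^sup>t \<mapsto> t u\<close>
  separates the others; its degree is \<open>w\<close>, which is at most \<open>c\<close> because \<open>g\<close> is nontrivial.
\<close>

lemma (in cyclic_extension) separated_step:
  assumes sep: "separated TYPE('k::ab_group_add) A" and u: "(u::'k) \<noteq> 0" "nsm p u = 0"
  shows "separated TYPE('k) B"
  unfolding separated_def
proof (intro ballI impI)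
  fix x assume "x \<in> B" and x1: "x \<noteq> \<one>"
  then obtain a t where x: "x = a \<otimes> g [^] t" "a \<in> A" "t < p" unfolding B_def by blast
  have "\<exists>f0 :: 'a \<Rightarrow> 'k. (\<forall>y. nsm p (f0 y) = 0) \<and> deg A (Suc c) f0 \<and> (t = 0 \<longrightarrow> f0 a \<noteq> f0 \<one>) \<and> (t > 0 \<longrightarrow> f0 = (\<lambda>_. 0))"
  proof (cases "t = 0")
    case True
    then have "a \<noteq> \<one>" using x x1 by auto
    then show ?thesis using sep x(2) True unfolding separated_def by blast
  next
    case False
    then show ?thesis by (intro exI [of _ "\<lambda>_. 0"] conjI deg_eq_0 A) simp_all
  qed
  then obtain f0 :: "'a \<Rightarrow> 'k" where "(\<forall>y. nsm p (f0 y) = 0) \<and> deg A (Suc c) f0 \<and> (t = 0 \<longrightarrow> f0 a \<noteq> f0 \<one>) \<and> (t > 0 \<longrightarrow> f0 = (\<lambda>_. 0))"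
    by (rule exE)
  then have f0: "\<And>y. nsm p (f0 y) = 0" "deg A (Suc c) f0" "t = 0 \<Longrightarrow> f0 a \<noteq> f0 \<one>" "t > 0 \<Longrightarrow> f0 = (\<lambda>_. 0)"
    by (simp_all del: degree_less.simps)
  \<comment> \<open>The coefficients of both kinds of functions at once.\<close>
  define v where "v i = (if i = 0 then f0 else if i = 1 \<and> t > 0 then (\<lambda>_. u) else (\<lambda>_. 0))" for i :: nat
  have vt: "nsm p (v i a) = 0" for i a using f0(1) u(2) by (simp add: v_def)
  obtain f where "has_coefficients f v" using exists_with_coefficients by (rule exE)
  note f = has_coefficientsD [OF this]
  have tors: "nsm p (f y) = 0" for y
  proof (cases "y \<in> B")
    case True
    then obtain b s where y: "y = b \<otimes> g [^] s" "b \<in> A" "s < p" unfolding B_def by blast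
    show ?thesis unfolding y(1) f(2) [OF y(2,3)] nsm_sum nsm_commute [of p] vt by simp
  qed (simp add: f(1))
  have "\<not> P w \<subseteq> A" using gP gA by blast
  then have wc: "w \<le> c"
    using P_antimono [of "Suc c" w] P_trivial A_closed(3) not_less_eq_eq by fastforce
  have "deg A (Suc c - i * w) (v i)" for i
  proof -
    consider "i = 0" | "i = 1" "t > 0" | "i \<noteq> 0" "\<not> (i = 1 \<and> t > 0)" by blast
    then show ?thesis
    proof cases
      case 1
      then show ?thesis using f0(2) by (simp add: v_def del: degree_less.simps)
    next
      case 2
      then show ?thesis using deg_const [OF A, of "c - w" u] wc by (simp add: v_def Suc_diff_le del: degree_less.simps)
    next
      case 3
      then show ?thesis by (intro deg_eq_0 A) (auto simp: v_def)
    qed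
  qed
  then have "deg A (Suc c - i * w) ((right_diff G g ^^ i) f)" if "i < p" for i
    by (rule deg_transfer [OF _ _ A refl]) (simp add: f(3) that)
  then have "deg B (Suc c) f" by (intro iffD2 [OF deg_B_iff [OF tors]] allI impI)
  moreover have "f x \<noteq> f \<one>"
  proof -
    have f1: "f \<one> = f0 \<one>" using f(2) [of \<one> 0] A_closed p_pos by (simp add: v_def)
    show ?thesis
    proof (cases "t = 0")
      case True
      then show ?thesis using f(2) [OF x(2,3)] f0(3) f1 x by (simp add: v_def)
    next
      case False
      then have z: "f0 = (\<lambda>_. 0)" using f0(4) by simp
      have "f x = (\<Sum>i\<in>{1}. nsm (t choose i) (v i a))"
        unfolding x(1) f(2) [OF x(2,3)] using False z by (intro sum.mono_neutral_right) (auto simp: v_def)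
      then have "f x = nsm t u" using False by (simp add: v_def)
      moreover have "coprime p t" using prime_p x(3) False
        by (metis bot_nat_0.not_eq_extremum nat_dvd_not_less prime_imp_coprime)
      ultimately show ?thesis using nsm_eq_0_coprime [OF u(2)] u(1) f1 z by auto
    qed
  qed
  ultimately show "\<exists>f :: 'a \<Rightarrow> 'k. (\<forall>y. y \<notin> B \<longrightarrow> f y = 0) \<and> (\<forall>y. nsm p (f y) = 0) \<and> deg B (Suc c) f \<and> f x \<noteq> f \<one>"
    using f(1) tors by blast
qed

lemma (in filtered_group) separated_carrier:
  assumes u: "(u::'k::ab_group_add) \<noteq> 0" "nsm p u = 0"
  shows "separated TYPE('k) (carrier G)"
proof -
  have "separated TYPE('k) {\<one>} \<longrightarrow> separated TYPE('k) (carrier G)"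
    using triv_subgroup
  proof (induction rule: subgroup_chain_induct)
    case (extend A g w)
    then show ?case using cyclic_extension.separated_step [OF extend(1) _ u] by blast
  qed simp
  then show ?thesis by (simp add: separated_def)
qed


context filtered_group begin

lemma translate_mult:
  assumes "x \<in> carrier G" "y \<in> carrier G"
  shows "translate G (carrier G) x (translate G (carrier G) y f) = translate G (carrier G) (x \<otimes> y) f"
  using assms by (auto simp: translate_def fun_eq_iff inv_mult_group m_assoc)

lemma translate_one:
  assumes "f \<in> degree_flag G P c p (carrier G) j"
  shows "translate G (carrier G) \<one> f = f"
  using assms by (auto simp: translate_def fun_eq_iff degree_flag_def)

lemma translate_mem:
  fixes f :: "nat \<Rightarrow> 'a \<Rightarrow> 'k::ab_group_add"
  assumes f: "f \<in> degree_flag G P c p (carrier G) j" and x: "x \<in> carrier G"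
  shows "translate G (carrier G) x f \<in> degree_flag G P c p (carrier G) j"
    and "translate G (carrier G) x f - f \<in> degree_flag G P c p (carrier G) (Suc j)"
proof -
  have d: "deg (carrier G) (top_degree c s - j) (f s)" for s using f by (simp add: degree_flag_def)
  have "deg (carrier G) (top_degree c s - j) (translate G (carrier G) x f s)" for s
    by (rule deg_transfer [OF deg_translate [OF d subgroup_self] _ subgroup_self refl, of "inv x"])
      (use x in \<open>auto simp: translate_def\<close>)
  then show "translate G (carrier G) x f \<in> degree_flag G P c p (carrier G) j"
    using f by (simp add: degree_flag_def translate_def)
  have "deg (carrier G) (top_degree c s - j - 1) (left_diff G (inv x) (f s))" for s
    by (rule deg_left_diff [OF d subgroup_self]) (use P_1 x in auto)
  then have "deg (carrier G) (top_degree c s - Suc j) ((translate G (carrier G) x f - f) s)" for s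
    by (rule deg_transfer [OF _ _ subgroup_self]) (use x in \<open>auto simp: translate_def left_diff_def\<close>)
  then show "translate G (carrier G) x f - f \<in> degree_flag G P c p (carrier G) (Suc j)"
    using f by (simp add: degree_flag_def translate_def nsm_diff_right fun_diff_def)
qed

lemma translation_embedding:
  assumes u: "(u::'k::ab_group_add) \<noteq> 0" "nsm p u = 0"
  defines "V \<equiv> degree_flag G P c p (carrier G) :: nat \<Rightarrow> (nat \<Rightarrow> 'a \<Rightarrow> 'k) set"
  shows "embedding (translation G (carrier G) (V 0)) G (flag.unipotent V)"
proof -
  interpret V: flag V c p unfolding V_def by (rule degree_flag_is_flag [OF subgroup_self])
  let ?T = "translation G (carrier G) (V 0)"
  have mem: "translate G (carrier G) x f \<in> V j" if "f \<in> V j" "x \<in> carrier G" for f x j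
    using translate_mem(1) that unfolding V_def by blast
  have mult: "?T (x \<otimes> y) = ?T x \<circ> ?T y" if "x \<in> carrier G" "y \<in> carrier G" for x y
    using that by (auto simp: translation_def fun_eq_iff mem translate_mult)
  have one: "?T \<one> = id"
    using translate_one unfolding translation_def V_def by (auto simp: fun_eq_iff)
  have "?T x \<in> carrier V.unipotent" if x: "x \<in> carrier G" for x
  proof -
    have "?T (inv x) \<circ> ?T x = id" "?T x \<circ> ?T (inv x) = id" using mult [of "inv x" x] mult [of x "inv x"] x one by simp_all
    then have "bij (?T x)" by (rule o_bij)
    then have "\<forall>f. \<exists>!h. ?T x h = f" unfolding bij_iff .
    moreover have "\<forall>f. f \<notin> V 0 \<longrightarrow> ?T x f = f" by (simp add: translation_def)
    ultimately have "?T x permutes V 0" by (simp only: permutes_def simp_thms)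
    moreover have "?T x (f + h) = ?T x f + ?T x h" if "f \<in> V 0" "h \<in> V 0" for f h
      using that V.add by (auto simp: translation_def translate_def fun_eq_iff)
    moreover have "?T x f - f \<in> V (Suc j)" if f: "f \<in> V j" for f j
      using translate_mem(2) f x V.mem_0 [OF f] unfolding translation_def V_def by auto
    ultimately show ?thesis by (simp add: V.unipotent_def)
  qed
  moreover have "inj_on ?T (carrier G)"
  proof (rule inj_onI, rule ccontr)
    fix x y assume x: "x \<in> carrier G" and y: "y \<in> carrier G" and eq: "?T x = ?T y" and xy: "x \<noteq> y"
    have "inv x \<noteq> inv y" using xy x y inv_inv by metis
    then have "inv x \<otimes> y \<noteq> \<one>" using x y by (metis inv_closed inv_equality inv_inv)
    then obtain f :: "'a \<Rightarrow> 'k" where f: "\<And>y. y \<notin> carrier G \<Longrightarrow> f y = 0" "\<And>y. nsm p (f y) = 0"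
      "deg (carrier G) (Suc c) f" "f (inv x \<otimes> y) \<noteq> f \<one>"
      using separated_carrier [OF u] x y unfolding separated_def by (metis inv_closed m_closed)
    obtain s where s: "top_degree c s = Suc c"
      using infinite_top_degree [of "Suc c" c] by (metis (mono_tags) finite.emptyI le_refl Collect_empty_eq)
    \<comment> \<open>The separating function is placed at a member with the largest bound.\<close>
    define F where "F = (\<lambda>r. if r = s then f else (\<lambda>_. 0))"
    have "deg (carrier G) (top_degree c r) (F r)" for r
      using s f(3) by (cases "r = s") (simp_all add: F_def deg_eq_0 subgroup_self del: degree_less.simps)
    then have F: "F \<in> V 0" using f(1,2) by (simp add: V_def degree_flag_def F_def)
    have "?T x F s y = ?T y F s y" using eq by simp
    then have "f (inv x \<otimes> y) = f \<one>" using F y by (simp add: translation_def translate_def F_def)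
    then show False using f(4) by simp
  qed
  ultimately show ?thesis unfolding embedding_def using mult by (auto simp: hom_def)
qed

end

section \<open>Amalgamation\<close>

lemma filtered_group_pullback:
  assumes G: "filtered_group G P c p" and H: "group H" and e: "embedding e H G"
  shows "filtered_group H (\<lambda>k. {a \<in> carrier H. e a \<in> P k}) c p"
proof -
  interpret G: filtered_group G P c p by fact
  interpret H: group H by fact
  have one: "e \<one>\<^bsub>H\<^esub> = \<one>\<^bsub>G\<^esub>" using embedding_one [OF e H G.is_group] .
  have inv: "e (inv\<^bsub>H\<^esub> a) = inv\<^bsub>G\<^esub> (e a)" if "a \<in> carrier H" for a
    using embedding_inv [OF e H G.is_group that] .
  note mult = embedding_mult [OF e] and cl = embedding_closed [OF e]
  show ?thesis
  proof (intro filtered_group.intro filtered_group_axioms.intro H)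
    show "subgroup {a \<in> carrier H. e a \<in> P k} H" for k
      using subgroup.one_closed [OF G.P_subgroup, of k] subgroup.m_closed [OF G.P_subgroup, of _ k]
        subgroup.m_inv_closed [OF G.P_subgroup, of _ k]
      by (intro H.subgroupI) (auto simp: one inv mult intro!: exI [of _ "\<one>\<^bsub>H\<^esub>"])
    show "{a \<in> carrier H. e a \<in> P 1} = carrier H" using cl unfolding G.P_1 by auto
    show "{a \<in> carrier H. e a \<in> P (Suc k)} \<subseteq> {a \<in> carrier H. e a \<in> P k}" for k
      using G.P_antimono_Suc by auto
    show "commutator H x y \<in> {a \<in> carrier H. e a \<in> P (i + j)}"
      if "x \<in> {a \<in> carrier H. e a \<in> P i}" "y \<in> {a \<in> carrier H. e a \<in> P j}" for x y i j
      using that G.P_commutator embedding_commutator [OF e H G.is_group] by auto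
    show "{a \<in> carrier H. e a \<in> P (Suc c)} = {\<one>\<^bsub>H\<^esub>}"
      unfolding G.P_trivial using one embedding_eq_iff [OF e _ H.one_closed] by auto
    show "x [^]\<^bsub>H\<^esub> p = \<one>\<^bsub>H\<^esub>" if x: "x \<in> carrier H" for x
    proof -
      have "e (x [^]\<^bsub>H\<^esub> p) = e \<one>\<^bsub>H\<^esub>"
        using embedding_pow [OF e H G.is_group x] G.exponent [OF cl [OF x]] one by simp
      then show ?thesis using embedding_eq_iff [OF e] x by simp
    qed
    show "finite (carrier H)"
      using e G.finite_carrier cl unfolding embedding_def by (metis finite_imageD finite_subset image_subsetI)
    show "prime p" by (rule G.prime_p)
  qed
qed

lemma degree_less_pullback:
  assumes e: "embedding e H G" and H: "group H"
  shows "degree_less H (\<lambda>k. {a \<in> carrier H. e a \<in> P k}) (carrier H) n (\<lambda>a. f (e a)) \<longleftrightarrow>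
    degree_less G P (e ` carrier H) n f"
proof (induction n arbitrary: f rule: less_induct)
  case (less n)
  interpret H: group H by fact
  let ?Q = "\<lambda>k. {a \<in> carrier H. e a \<in> P k}"
  show ?case
  proof (cases n)
    case (Suc m)
    have "degree_less H ?Q (carrier H) (m - j) (left_diff H x (\<lambda>a. f (e a))) \<longleftrightarrow>
        degree_less G P (e ` carrier H) (m - j) (left_diff G (e x) f)" if x: "x \<in> carrier H" for j x
    proof -
      have "degree_less H ?Q (carrier H) (m - j) (left_diff H x (\<lambda>a. f (e a))) \<longleftrightarrow>
          degree_less H ?Q (carrier H) (m - j) (\<lambda>a. left_diff G (e x) f (e a))"
        by (rule H.deg_cong [OF _ H.subgroup_self]) (use x in \<open>simp add: left_diff_def embedding_mult [OF e]\<close>)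
      also have "\<dots> \<longleftrightarrow> degree_less G P (e ` carrier H) (m - j) (left_diff G (e x) f)"
        using Suc by (intro less.IH) auto
      finally show ?thesis .
    qed
    then show ?thesis unfolding Suc degree_less.simps(2) by auto
  qed auto
qed

lemma degree_flag_pullback:
  fixes P :: "nat \<Rightarrow> 'a set" and H :: "('b, 'd) monoid_scheme"
  assumes e: "embedding e H G" and H: "group H" and G: "group G"
  defines "Q \<equiv> \<lambda>k. {a \<in> carrier H. e a \<in> P k}"
  shows "\<exists>\<Theta>. flag_iso \<Theta> (degree_flag G P c p (e ` carrier H) :: nat \<Rightarrow> (nat \<Rightarrow> 'a \<Rightarrow> 'k::ab_group_add) set)
      (degree_flag H Q c p (carrier H) :: nat \<Rightarrow> (nat \<Rightarrow> 'b \<Rightarrow> 'k) set) \<and>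
     (\<forall>a \<in> carrier H. \<forall>f. \<Theta> (translate G (e ` carrier H) (e a) f) = translate H (carrier H) a (\<Theta> f))"
proof -
  interpret H: group H by fact
  define \<Theta> :: "(nat \<Rightarrow> 'a \<Rightarrow> 'k) \<Rightarrow> nat \<Rightarrow> 'b \<Rightarrow> 'k"
    where "\<Theta> f = (\<lambda>s a. if a \<in> carrier H then f s (e a) else 0)" for f
  let ?V = "degree_flag G P c p (e ` carrier H) :: nat \<Rightarrow> (nat \<Rightarrow> 'a \<Rightarrow> 'k) set"
  let ?W = "degree_flag H Q c p (carrier H) :: nat \<Rightarrow> (nat \<Rightarrow> 'b \<Rightarrow> 'k) set"
  let ?e' = "inv_into (carrier H) e"
  have e'e: "?e' (e a) = a" if "a \<in> carrier H" for a using e that unfolding embedding_def by simp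
  have deg: "degree_less H Q (carrier H) n (\<Theta> f s) \<longleftrightarrow> degree_less G P (e ` carrier H) n (f s)" for f n s
  proof -
    have "degree_less H Q (carrier H) n (\<Theta> f s) \<longleftrightarrow> degree_less H Q (carrier H) n (\<lambda>a. f s (e a))"
      by (rule H.deg_cong [OF _ H.subgroup_self]) (simp add: \<Theta>_def)
    then show ?thesis unfolding Q_def using degree_less_pullback [OF e H] by simp
  qed
  have level: "\<Theta> f \<in> ?W j \<longleftrightarrow> f \<in> ?V j"
    if supp: "\<And>s y. y \<notin> e ` carrier H \<Longrightarrow> f s y = 0" and tors: "\<And>s y. nsm p (f s y) = 0" for f j
    using that deg unfolding degree_flag_def by (auto simp: \<Theta>_def)
  have supp: "f s y = 0" if "f \<in> ?V 0" "y \<notin> e ` carrier H" for f s y using that by (simp add: degree_flag_def)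
  have tors: "nsm p (f s y) = 0" if "f \<in> ?V 0" for f s y using that by (simp add: degree_flag_def)
  have "inj_on \<Theta> (?V 0)"
  proof (rule inj_onI, intro ext)
    fix f h s y assume fh: "f \<in> ?V 0" "h \<in> ?V 0" and eq: "\<Theta> f = \<Theta> h"
    show "f s y = h s y"
    proof (cases "y \<in> e ` carrier H")
      case True
      then obtain a where "y = e a" "a \<in> carrier H" by blast
      then show ?thesis using fun_cong [OF fun_cong [OF eq, of s], of a] by (simp add: \<Theta>_def)
    next
      case False
      then show ?thesis using supp [OF fh(1) False] supp [OF fh(2) False] by simp
    qed
  qed
  moreover have surj: "\<exists>f \<in> ?V 0. \<Theta> f = h" if h: "h \<in> ?W 0" for h
  proof -
    define f where "f = (\<lambda>s y. if y \<in> e ` carrier H then h s (?e' y) else 0)"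
    have "\<Theta> f = h" using h by (auto simp: \<Theta>_def f_def fun_eq_iff e'e degree_flag_def)
    moreover have "f \<in> ?V 0"
      using level [of f 0] h \<open>\<Theta> f = h\<close> by (simp add: f_def degree_flag_def)
    ultimately show ?thesis by blast
  qed
  ultimately have "bij_betw \<Theta> (?V 0) (?W 0)"
    using level supp tors unfolding bij_betw_def by (auto simp: image_iff)
  moreover have "\<Theta> (f + h) = \<Theta> f + \<Theta> h" for f h
    by (auto simp: \<Theta>_def fun_eq_iff)
  ultimately have "flag_iso \<Theta> ?V ?W"
    using level supp tors unfolding flag_iso_def by blast
  moreover have "\<Theta> (translate G (e ` carrier H) (e a) f) = translate H (carrier H) a (\<Theta> f)"
    if a: "a \<in> carrier H" for a f
  proof -
    have "inv\<^bsub>G\<^esub> (e a) \<otimes>\<^bsub>G\<^esub> e b = e (inv\<^bsub>H\<^esub> a \<otimes>\<^bsub>H\<^esub> b)" if "b \<in> carrier H" for b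
      using a that by (simp add: embedding_mult [OF e] embedding_inv [OF e H G])
    then show ?thesis using a by (auto simp: \<Theta>_def translate_def fun_eq_iff)
  qed
  ultimately show ?thesis by blast
qed

text \<open>
  The flag on which \<open>G\<close> acts is defined by \<open>H\<close> and the induced filtration alone, and \<open>H\<close> acts on it by its
  own translations.
\<close>

lemma exists_unipotent_representation:
  assumes G: "filtered_group G P c p" and H: "group H" and e: "embedding e H G"
    and u: "(u::'k::ab_group_add) \<noteq> 0" "nsm p u = 0"
  defines "W \<equiv> degree_flag H (\<lambda>k. {a \<in> carrier H. e a \<in> P k}) c p (carrier H) :: nat \<Rightarrow> (nat \<Rightarrow> 'b \<Rightarrow> 'k) set"
  shows "\<exists>\<rho>. embedding \<rho> G (flag.unipotent W) \<and>
     (\<forall>a \<in> carrier H. \<rho> (e a) = translation H (carrier H) (W 0) a)"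
proof -
  interpret G: filtered_group G P c p by fact
  interpret H: group H by fact
  let ?U = "degree_flag G P c p (carrier G) :: nat \<Rightarrow> (nat \<Rightarrow> _ \<Rightarrow> 'k) set"
  let ?V = "degree_flag G P c p (e ` carrier H) :: nat \<Rightarrow> (nat \<Rightarrow> _ \<Rightarrow> 'k) set"
  have sub: "subgroup (e ` carrier H) G"
    using e H.is_group G.is_group unfolding embedding_def
    by (metis group_hom.img_is_subgroup group_hom.intro group_hom_axioms.intro)
  obtain \<Theta> where "flag_iso \<Theta> ?U ?V \<and>
     (\<forall>a \<in> e ` carrier H. \<forall>f \<in> ?U 0. \<Theta> (translate G (carrier G) a f) = translate G (e ` carrier H) a (\<Theta> f))"
    using G.degree_flag_restrict [OF sub] by (rule exE)
  then have 1: "flag_iso \<Theta> ?U ?V"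
     "\<And>a f. \<lbrakk>a \<in> carrier H; f \<in> ?U 0\<rbrakk> \<Longrightarrow> \<Theta> (translate G (carrier G) (e a) f) = translate G (e ` carrier H) (e a) (\<Theta> f)"
    by simp_all
  obtain \<Theta>' where "flag_iso \<Theta>' ?V W \<and>
     (\<forall>a \<in> carrier H. \<forall>f. \<Theta>' (translate G (e ` carrier H) (e a) f) = translate H (carrier H) a (\<Theta>' f))"
    using degree_flag_pullback [OF e H G.is_group] unfolding W_def by (rule exE)
  then have 2: "flag_iso \<Theta>' ?V W"
     "\<And>a f. a \<in> carrier H \<Longrightarrow> \<Theta>' (translate G (e ` carrier H) (e a) f) = translate H (carrier H) a (\<Theta>' f)"
    by simp_all
  define \<Psi> where "\<Psi> = \<Theta>' \<circ> \<Theta>"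
  have iso: "flag_iso \<Psi> ?U W" unfolding \<Psi>_def by (rule flag_iso_comp [OF 1(1) 2(1)])
  have equiv: "\<Psi> (translate G (carrier G) (e a) f) = translate H (carrier H) a (\<Psi> f)"
    if "a \<in> carrier H" "f \<in> ?U 0" for a f
    unfolding \<Psi>_def using 1(2) 2(2) that by simp
  interpret HQ: filtered_group H "\<lambda>k. {a \<in> carrier H. e a \<in> P k}" c p
    by (rule filtered_group_pullback [OF G H e])
  have flags: "flag ?U c p" "flag W c p"
    unfolding W_def by (rule G.degree_flag_is_flag G.subgroup_self HQ.degree_flag_is_flag H.subgroup_self)+
  let ?\<rho> = "transport \<Psi> (?U 0) (W 0) \<circ> translation G (carrier G) (?U 0)"
  have "embedding ?\<rho> G (flag.unipotent W)"
    by (rule embedding_comp [OF G.translation_embedding [OF u] transport_embedding [OF flags iso]])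
  moreover have "?\<rho> (e a) = translation H (carrier H) (W 0) a" if a: "a \<in> carrier H" for a
  proof
    fix f
    have bij: "bij_betw \<Psi> (?U 0) (W 0)" using iso by (simp add: flag_iso_def)
    show "?\<rho> (e a) f = translation H (carrier H) (W 0) a f"
    proof (cases "f \<in> W 0")
      case True
      let ?h = "inv_into (?U 0) \<Psi> f"
      have h: "?h \<in> ?U 0" "\<Psi> ?h = f"
        using bij True by (simp_all add: bij_betw_imp_surj_on inv_into_into f_inv_into_f)
      have "?\<rho> (e a) f = \<Psi> (translate G (carrier G) (e a) ?h)"
        using True h(1) by (simp add: transport_def translation_def)
      also have "\<dots> = translate H (carrier H) a f" using equiv [OF a h(1)] h(2) by simp
      finally show ?thesis using True by (simp add: translation_def)
    qed (simp add: transport_def translation_def)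
  qed
  ultimately show ?thesis by blast
qed

text \<open>
  The shift of the index restores the usual numbering, in which commutators add indices.
\<close>

lemma lower_central_series_filtered_group:
  assumes V: "in_variety c p G" and fin: "finite (carrier G)" and p: "prime p"
  shows "filtered_group G (\<lambda>k. lower_central_series G (k - 1)) c p"
proof -
  interpret group G using V by (rule in_variety_group)
  show ?thesis
  proof (intro filtered_group.intro filtered_group_axioms.intro is_group)
    show "subgroup (lower_central_series G (k - 1)) G" for k by (rule lower_central_series_subgroup)
    show "lower_central_series G (Suc k - 1) \<subseteq> lower_central_series G (k - 1)" for k
      using lower_central_series_antimono [of "k - 1"] by (cases k) auto
    show "commutator G x y \<in> lower_central_series G (i + j - 1)"
      if "x \<in> lower_central_series G (i - 1)" "y \<in> lower_central_series G (j - 1)" for x y i j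
    proof -
      have "commutator G x y \<in> lower_central_series G (Suc ((i - 1) + (j - 1)))"
        using that by (rule lower_central_series_commutator_le)
      moreover have "lower_central_series G (Suc ((i - 1) + (j - 1))) \<subseteq> lower_central_series G (i + j - 1)"
        by (rule lift_Suc_antimono_le [of "lower_central_series G"]) (use lower_central_series_antimono in auto)
      ultimately show ?thesis by blast
    qed
    show "lower_central_series G (Suc c - 1) = {\<one>\<^bsub>G\<^esub>}" using in_variety_lower_central_series [OF V] by simp
    show "x [^]\<^bsub>G\<^esub> p = \<one>\<^bsub>G\<^esub>" if "x \<in> carrier G" for x using in_variety_exponent [OF V that] .
  qed (use fin p in auto)
qed

text \<open>
  Since the induced filtrations agree, the two representations live on the same flag, and their images generate
  a finite group of unipotent operators.
\<close>

theorem amalgamation: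
  fixes A :: "('a, 'd) monoid_scheme"
  assumes V1: "in_variety c p C1" "finite (carrier C1)" and V2: "in_variety c p C2" "finite (carrier C2)"
    and A: "group A" and e1: "embedding e1 A C1" and e2: "embedding e2 A C2"
    and lcs: "\<And>a n. a \<in> carrier A \<Longrightarrow> e1 a \<in> lower_central_series C1 n \<longleftrightarrow> e2 a \<in> lower_central_series C2 n"
    and p: "prime p" "p > c"
  shows "\<exists>(D :: ((nat \<Rightarrow> 'a \<Rightarrow> rat_mod_int) \<Rightarrow> (nat \<Rightarrow> 'a \<Rightarrow> rat_mod_int)) monoid) g1 g2.
    in_variety c p D \<and> finite (carrier D) \<and> embedding g1 C1 D \<and> embedding g2 C2 D \<and>
    (\<forall>a \<in> carrier A. g1 (e1 a) = g2 (e2 a))"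
proof -
  obtain u :: rat_mod_int where u: "u \<noteq> 0" "nsm p u = 0" using exists_nsm_torsion p(1) prime_gt_1_nat by blast
  let ?Q = "\<lambda>k. {a \<in> carrier A. e1 a \<in> lower_central_series C1 (k - 1)}"
  have Q: "?Q = (\<lambda>k. {a \<in> carrier A. e2 a \<in> lower_central_series C2 (k - 1)})" using lcs by auto
  define W where "W = (degree_flag A ?Q c p (carrier A) :: nat \<Rightarrow> (nat \<Rightarrow> 'a \<Rightarrow> rat_mod_int) set)"
  note F1 = lower_central_series_filtered_group [OF V1 p(1)]
  note F2 = lower_central_series_filtered_group [OF V2 p(1)]
  obtain r1 where "embedding r1 C1 (flag.unipotent W) \<and> (\<forall>a \<in> carrier A. r1 (e1 a) = translation A (carrier A) (W 0) a)"
    using exists_unipotent_representation [OF F1 A e1 u] unfolding W_def by (rule exE)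
  moreover obtain r2 where "embedding r2 C2 (flag.unipotent W) \<and> (\<forall>a \<in> carrier A. r2 (e2 a) = translation A (carrier A) (W 0) a)"
    using exists_unipotent_representation [OF F2 A e2 u] unfolding W_def Q by (rule exE)
  ultimately have r: "embedding r1 C1 (flag.unipotent W)" "embedding r2 C2 (flag.unipotent W)"
    "\<And>a. a \<in> carrier A \<Longrightarrow> r1 (e1 a) = r2 (e2 a)"
    by simp_all
  interpret A: filtered_group A ?Q c p by (rule filtered_group_pullback [OF F1 A e1])
  interpret W: flag W c p unfolding W_def by (rule A.degree_flag_is_flag [OF A.subgroup_self])
  interpret U: group W.unipotent by (rule W.unipotent_group)
  let ?S = "r1 ` carrier C1 \<union> r2 ` carrier C2"
  let ?D = "W.unipotent\<lparr>carrier := generate W.unipotent ?S\<rparr>"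
  have S: "finite ?S" "?S \<subseteq> carrier W.unipotent"
    using V1(2) V2(2) embedding_closed [OF r(1)] embedding_closed [OF r(2)] by auto
  have UV: "in_variety c p W.unipotent" by (rule W.unipotent_in_variety [OF p])
  have "in_variety c p ?D" by (rule in_variety_subgroup [OF UV U.generate_is_subgroup [OF S(2)]])
  moreover have "finite (carrier ?D)" using generate_finite [OF UV _ S] p(1) prime_gt_0_nat by simp
  moreover have "embedding r1 C1 ?D" "embedding r2 C2 ?D"
    using r(1,2) generate.incl [of _ ?S W.unipotent] unfolding embedding_def by (auto simp: hom_def)
  ultimately show ?thesis using r(3) by blast
qed

section \<open>Enumerated supergroups\<close>

definition image_group :: "('a \<Rightarrow> 'b) \<Rightarrow> ('a, 'c) monoid_scheme \<Rightarrow> 'b monoid" where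
  "image_group h G = \<lparr>carrier = h ` carrier G,
     monoid.mult = \<lambda>x y. h (inv_into (carrier G) h x \<otimes>\<^bsub>G\<^esub> inv_into (carrier G) h y), one = h \<one>\<^bsub>G\<^esub>\<rparr>"

lemma image_group:
  assumes G: "group G" and h: "inj_on h (carrier G)"
  shows group_image_group: "group (image_group h G)"
    and embedding_image_group: "embedding h G (image_group h G)"
    and in_variety_image_group: "in_variety c p G \<Longrightarrow> in_variety c p (image_group h G)"
proof -
  interpret group G by fact
  show 1: "group (image_group h G)"
  proof (rule groupI)
    fix x assume "x \<in> carrier (image_group h G)"
    then obtain a where a: "x = h a" "a \<in> carrier G" by (auto simp: image_group_def)
    show "\<exists>y \<in> carrier (image_group h G). y \<otimes>\<^bsub>image_group h G\<^esub> x = \<one>\<^bsub>image_group h G\<^esub>"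
      by (rule bexI [of _ "h (inv\<^bsub>G\<^esub> a)"]) (use a h in \<open>auto simp: image_group_def\<close>)
  qed (use h in \<open>auto simp: image_group_def m_assoc\<close>)
  show "embedding h G (image_group h G)"
    using h by (auto simp: embedding_def image_group_def hom_def)
  have "embedding (inv_into (carrier G) h) (image_group h G) G"
    using h inj_on_inv_into [of "h ` carrier G" h "carrier G"]
    by (auto simp: embedding_def image_group_def hom_def)
  then show "in_variety c p G \<Longrightarrow> in_variety c p (image_group h G)"
    using in_variety_embedding 1 by blast
qed

definition finite_in_variety :: "nat \<Rightarrow> nat \<Rightarrow> ('a, 'b) monoid_scheme \<Rightarrow> bool" where
  "finite_in_variety c p G \<longleftrightarrow> in_variety c p G \<and> finite (carrier G)"

lemma finite_in_variety_nat:
  assumes "finite_in_variety c p D"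
  shows "\<exists>(D' :: nat monoid) f. finite_in_variety c p D' \<and> embedding f D D'"
proof -
  obtain f :: "_ \<Rightarrow> nat" where "inj_on f (carrier D)"
    using assms finite_imp_inj_to_nat_seg unfolding finite_in_variety_def by metis
  moreover have "finite (carrier (image_group f D))"
    using assms by (simp add: finite_in_variety_def image_group_def)
  ultimately show ?thesis
    using assms in_variety_group image_group unfolding finite_in_variety_def by blast
qed

text \<open>
  Finitely supported sequences modulo \<open>p\<close>: an infinite countable group of the variety, which supplies the
  remaining elements when a finite group is enlarged to an enumerated one.
\<close>

definition elementary_abelian :: "nat \<Rightarrow> (nat \<Rightarrow> nat) monoid" where
  "elementary_abelian p = \<lparr>carrier = {f. (\<forall>x. f x < p) \<and> finite {x. f x \<noteq> 0}},
     monoid.mult = \<lambda>f g x. (f x + g x) mod p, one = \<lambda>_. 0\<rparr>"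

lemma elementary_abelian_comm_group:
  assumes "p > 0" shows "comm_group (elementary_abelian p)"
proof (rule comm_groupI)
  fix f g assume fg: "f \<in> carrier (elementary_abelian p)" "g \<in> carrier (elementary_abelian p)"
  have "{x. (f x + g x) mod p \<noteq> 0} \<subseteq> {x. f x \<noteq> 0} \<union> {x. g x \<noteq> 0}"
  proof
    fix x assume "x \<in> {x. (f x + g x) mod p \<noteq> 0}"
    then show "x \<in> {x. f x \<noteq> 0} \<union> {x. g x \<noteq> 0}" by (cases "f x = 0"; cases "g x = 0") auto
  qed
  then have "finite {x. (f x + g x) mod p \<noteq> 0}" using fg by (auto simp: elementary_abelian_def intro: finite_subset)
  then show "f \<otimes>\<^bsub>elementary_abelian p\<^esub> g \<in> carrier (elementary_abelian p)"
    using assms by (simp add: elementary_abelian_def)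
next
  fix f assume f: "f \<in> carrier (elementary_abelian p)"
  have "{x. (p - f x) mod p \<noteq> 0} \<subseteq> {x. f x \<noteq> 0}"
  proof
    fix x assume "x \<in> {x. (p - f x) mod p \<noteq> 0}"
    then show "x \<in> {x. f x \<noteq> 0}" by (cases "f x = 0") auto
  qed
  moreover have "finite {x. f x \<noteq> 0}" using f by (simp add: elementary_abelian_def)
  ultimately have "finite {x. (p - f x) mod p \<noteq> 0}" by (rule finite_subset)
  then have inv: "(\<lambda>x. (p - f x) mod p) \<in> carrier (elementary_abelian p)"
    using assms by (simp add: elementary_abelian_def)
  have "((p - f x) mod p + f x) mod p = 0" for x
  proof -
    have "((p - f x) mod p + f x) mod p = (p - f x + f x) mod p" by (rule mod_add_left_eq)
    also have "p - f x + f x = p" using f by (simp add: elementary_abelian_def less_imp_le)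
    finally show ?thesis by simp
  qed
  with inv show "\<exists>g \<in> carrier (elementary_abelian p). g \<otimes>\<^bsub>elementary_abelian p\<^esub> f = \<one>\<^bsub>elementary_abelian p\<^esub>"
    by (intro bexI [of _ "\<lambda>x. (p - f x) mod p"]) (auto simp: elementary_abelian_def)
qed (use assms in \<open>auto simp: elementary_abelian_def fun_eq_iff add_ac mod_simps\<close>)

lemma elementary_abelian_exponent:
  assumes "p > 0" "f \<in> carrier (elementary_abelian p)"
  shows "f [^]\<^bsub>elementary_abelian p\<^esub> p = \<one>\<^bsub>elementary_abelian p\<^esub>"
proof -
  have "f [^]\<^bsub>elementary_abelian p\<^esub> n = (\<lambda>x. (n * f x) mod p)" for n :: nat
    by (induction n) (use assms in \<open>auto simp: nat_pow_def elementary_abelian_def fun_eq_iff mod_simps add.commute\<close>)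
  then show ?thesis by (simp add: elementary_abelian_def)
qed

lemma elementary_abelian_countable: "countable (carrier (elementary_abelian p))"
proof -
  have "carrier (elementary_abelian p) \<subseteq> range (\<lambda>(l :: nat list) i. if i < length l then l ! i else 0)"
  proof
    fix f assume "f \<in> carrier (elementary_abelian p)"
    then have "finite {x. f x \<noteq> 0}" by (simp add: elementary_abelian_def)
    then obtain n where "{x. f x \<noteq> 0} \<subseteq> {..<n}" using finite_nat_bounded by blast
    then have n: "x < n" if "f x \<noteq> 0" for x using that by auto
    have "f = (\<lambda>i. if i < length (map f [0..<n]) then map f [0..<n] ! i else 0)"
      using n by (auto simp: fun_eq_iff)
    then show "f \<in> range (\<lambda>(l :: nat list) i. if i < length l then l ! i else 0)" by (rule range_eqI)
  qed
  then show ?thesis by (rule countable_subset) simp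
qed

lemma elementary_abelian_infinite:
  assumes "p > 1" shows "infinite (carrier (elementary_abelian p))"
proof -
  let ?\<delta> = "\<lambda>i x :: nat. if x = i then 1 else 0 :: nat"
  have "range ?\<delta> \<subseteq> carrier (elementary_abelian p)"
    using assms by (auto simp: elementary_abelian_def)
  moreover have "inj ?\<delta>" by (auto simp: inj_def fun_eq_iff split: if_splits)
  ultimately show ?thesis using range_inj_infinite infinite_super by blast
qed

lemma in_variety_comm_group:
  assumes G: "comm_group G" and c: "c > 0" and e: "\<And>x. x \<in> carrier G \<Longrightarrow> x [^]\<^bsub>G\<^esub> p = \<one>\<^bsub>G\<^esub>"
  shows "in_variety c p G"
proof -
  interpret comm_group G by fact
  have comm: "commutator G x y = \<one>\<^bsub>G\<^esub>" if "x \<in> carrier G" "y \<in> carrier G" for x y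
  proof -
    have "commutator G x y = y \<otimes>\<^bsub>G\<^esub> x \<otimes>\<^bsub>G\<^esub> inv\<^bsub>G\<^esub> x \<otimes>\<^bsub>G\<^esub> inv\<^bsub>G\<^esub> y" using that by (simp add: commutator_def m_comm [of x y])
    then show ?thesis using that by (simp add: m_assoc)
  qed
  have one: "set ys \<subseteq> carrier G \<Longrightarrow> foldl (commutator G) \<one>\<^bsub>G\<^esub> ys = \<one>\<^bsub>G\<^esub>" for ys
    by (induction ys) simp_all
  have "foldl (commutator G) x ys = \<one>\<^bsub>G\<^esub>" if "x \<in> carrier G" "set ys \<subseteq> carrier G" "length ys = c" for x ys
    using that c by (cases ys) (simp_all add: comm one)
  then show ?thesis using e by (simp add: in_variety_def is_group)
qed

lemma in_variety_DirProd:
  assumes G: "in_variety c p G" and H: "in_variety c p H"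
  shows "in_variety c p (G \<times>\<times> H)"
proof -
  interpret G: group G using G by (rule in_variety_group)
  interpret H: group H using H by (rule in_variety_group)
  interpret GH: group "G \<times>\<times> H" by (rule DirProd_group) (rule G.is_group H.is_group)+
  have comm: "commutator (G \<times>\<times> H) x y = (commutator G (fst x) (fst y), commutator H (snd x) (snd y))"
    if "x \<in> carrier (G \<times>\<times> H)" "y \<in> carrier (G \<times>\<times> H)" for x y
    using that by (auto simp: commutator_def inv_DirProd G.is_group H.is_group)
  have fold: "foldl (commutator (G \<times>\<times> H)) x ys = (foldl (commutator G) (fst x) (map fst ys), foldl (commutator H) (snd x) (map snd ys))"
    if "x \<in> carrier (G \<times>\<times> H)" "set ys \<subseteq> carrier (G \<times>\<times> H)" for x ys
    using that
  proof (induction ys arbitrary: x)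
    case (Cons y ys)
    then show ?case using comm [of x y] GH.commutator_closed [of x y] by simp
  qed simp
  have pow: "x [^]\<^bsub>G \<times>\<times> H\<^esub> n = (fst x [^]\<^bsub>G\<^esub> n, snd x [^]\<^bsub>H\<^esub> n)" if "x \<in> carrier (G \<times>\<times> H)" for x and n :: nat
    by (induction n) (use that in \<open>auto\<close>)
  show ?thesis
    unfolding in_variety_def
  proof (intro conjI allI impI ballI)
    show "group (G \<times>\<times> H)" by (rule GH.is_group)
    fix x ys assume a: "x \<in> carrier (G \<times>\<times> H) \<and> set ys \<subseteq> carrier (G \<times>\<times> H) \<and> length ys = c"
    then have "fst x \<in> carrier G" "snd x \<in> carrier H" "set (map fst ys) \<subseteq> carrier G" "set (map snd ys) \<subseteq> carrier H"
      "length (map fst ys) = c" "length (map snd ys) = c"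
      by auto
    then have "foldl (commutator G) (fst x) (map fst ys) = \<one>\<^bsub>G\<^esub>" "foldl (commutator H) (snd x) (map snd ys) = \<one>\<^bsub>H\<^esub>"
      using G H unfolding in_variety_def by blast+
    then show "foldl (commutator (G \<times>\<times> H)) x ys = \<one>\<^bsub>G \<times>\<times> H\<^esub>" using fold a by simp
  next
    fix x assume "x \<in> carrier (G \<times>\<times> H)"
    then show "x [^]\<^bsub>G \<times>\<times> H\<^esub> p = \<one>\<^bsub>G \<times>\<times> H\<^esub>"
      using pow in_variety_exponent [OF G, of "fst x"] in_variety_exponent [OF H, of "snd x"] by auto
  qed
qed

lemma carrier_group_of [simp]: "carrier (group_of H) = UNIV"
  and mult_group_of [simp]: "x \<otimes>\<^bsub>group_of H\<^esub> y = enum_mult H x y"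
  and one_group_of [simp]: "\<one>\<^bsub>group_of H\<^esub> = enum_one H"
  by (simp_all add: group_of_def)

lemma enum_nil_groups_iff: "H \<in> enum_nil_groups c p \<longleftrightarrow> H \<in> enum_groups \<and> in_variety c p (group_of H)"
  by (simp add: enum_nil_groups_def in_variety_iff)

lemma exists_enumeration:
  fixes K :: "nat monoid"
  assumes "group K" "carrier K = UNIV"
  shows "\<exists>H \<in> enum_groups. group_of H = K"
proof -
  let ?H = "(\<lambda>(x, y). x \<otimes>\<^bsub>K\<^esub> y, m_inv K, \<one>\<^bsub>K\<^esub>)"
  have "group_of ?H = K" using assms(2) by (cases K) (simp add: group_of_def fun_eq_iff)
  moreover have "?H \<in> enum_groups" unfolding enum_groups_def using calculation assms(1) by simp
  ultimately show ?thesis by blast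
qed

lemma extend_to_bijection:
  assumes X: "countable X" "infinite X" and K: "finite K" "inj_on e K" "e ` K \<subseteq> X"
  shows "\<exists>\<beta> :: 'x \<Rightarrow> nat. bij_betw \<beta> X UNIV \<and> (\<forall>x \<in> K. \<beta> (e x) = x)"
proof -
  have "countable (X - e ` K)" "infinite (X - e ` K)" "countable (UNIV - K)" "infinite (UNIV - K)"
    using X K by (auto simp: countable_Diff)
  then obtain \<gamma> where \<gamma>: "bij_betw \<gamma> (X - e ` K) (UNIV - K)"
    using bij_betw_trans [OF to_nat_on_infinite bij_betw_from_nat_into] by blast
  define \<beta> where "\<beta> y = (if y \<in> e ` K then inv_into K e y else \<gamma> y)" for y
  have "bij_betw (inv_into K e) (e ` K) K" using K(2) by (simp add: bij_betw_inv_into inj_on_imp_bij_betw)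
  then have "bij_betw \<beta> (e ` K) K"
    by (rule bij_betw_cong [THEN iffD1, rotated]) (simp add: \<beta>_def)
  moreover have "bij_betw \<beta> (X - e ` K) (UNIV - K)"
    by (rule bij_betw_cong [THEN iffD1, OF _ \<gamma>]) (simp add: \<beta>_def)
  ultimately have "bij_betw \<beta> (e ` K \<union> (X - e ` K)) (K \<union> (UNIV - K))" by (rule bij_betw_combine) auto
  moreover have "e ` K \<union> (X - e ` K) = X" using K(3) by auto
  ultimately have "bij_betw \<beta> X UNIV" by simp
  moreover have "\<beta> (e x) = x" if "x \<in> K" for x using that K(2) by (simp add: \<beta>_def)
  ultimately show ?thesis by blast
qed

text \<open>
  Enumerate the product of \<open>D\<close> with an infinite elementary abelian group so that the numbers already
  assigned to elements of \<open>D\<close> are kept.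
\<close>

lemma exists_enumerated_supergroup:
  fixes D :: "('a, 'b) monoid_scheme"
  assumes D: "finite_in_variety c p D" and c: "c > 0" and p: "prime p"
    and K: "finite K" "inj_on e K" "e ` K \<subseteq> carrier D"
  shows "\<exists>H \<in> enum_nil_groups c p. \<exists>h. embedding h D (group_of H) \<and> (\<forall>x \<in> K. h (e x) = x)"
proof -
  let ?E = "elementary_abelian p"
  have p1: "p > 1" using p prime_gt_1_nat by blast
  then have E: "in_variety c p ?E"
    using elementary_abelian_exponent c by (intro in_variety_comm_group elementary_abelian_comm_group) auto
  have DV: "in_variety c p D" "finite (carrier D)" using D by (auto simp: finite_in_variety_def)
  interpret D: group D by (rule in_variety_group [OF DV(1)])
  interpret E: group ?E by (rule in_variety_group [OF E])
  let ?X = "D \<times>\<times> ?E"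
  have X: "in_variety c p ?X" by (rule in_variety_DirProd [OF DV(1) E])
  have i: "embedding (\<lambda>d. (d, \<one>\<^bsub>?E\<^esub>)) D ?X" by (auto simp: embedding_def hom_def inj_on_def)
  have "countable (carrier ?X)"
    using DV(2) elementary_abelian_countable by (auto simp: DirProd_def countable_finite)
  moreover have "infinite (carrier ?X)"
    using elementary_abelian_infinite [OF p1] D.one_closed by (auto simp: DirProd_def finite_cartesian_product_iff)
  moreover have "inj_on (\<lambda>x. (e x, \<one>\<^bsub>?E\<^esub>)) K" using K(2) by (auto simp: inj_on_def)
  moreover have "(\<lambda>x. (e x, \<one>\<^bsub>?E\<^esub>)) ` K \<subseteq> carrier ?X" using K(3) by auto
  ultimately obtain \<beta> :: "'a \<times> (nat \<Rightarrow> nat) \<Rightarrow> nat" where "bij_betw \<beta> (carrier ?X) UNIV \<and> (\<forall>x \<in> K. \<beta> (e x, \<one>\<^bsub>?E\<^esub>) = x)"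
    by (rule exE [OF extend_to_bijection [OF _ _ K(1)]])
  then have \<beta>: "bij_betw \<beta> (carrier ?X) UNIV" "\<And>x. x \<in> K \<Longrightarrow> \<beta> (e x, \<one>\<^bsub>?E\<^esub>) = x"
    by simp_all
  have inj: "inj_on \<beta> (carrier ?X)" and UN: "carrier (image_group \<beta> ?X) = UNIV"
    using \<beta>(1) by (auto simp: bij_betw_def image_group_def)
  note img = image_group [OF in_variety_group [OF X] inj]
  obtain H where H: "H \<in> enum_groups" "group_of H = image_group \<beta> ?X"
    using exists_enumeration [OF img(1) UN] by blast
  have "H \<in> enum_nil_groups c p" unfolding enum_nil_groups_iff using H img(3) [OF X] by simp
  moreover have "embedding (\<beta> \<circ> (\<lambda>d. (d, \<one>\<^bsub>?E\<^esub>))) D (group_of H)"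
    unfolding H(2) by (rule embedding_comp [OF i img(2)])
  ultimately show ?thesis using \<beta>(2) by (intro bexI exI conjI) auto
qed

section \<open>Weak amalgamation\<close>

definition has_amalgam :: "nat \<Rightarrow> nat \<Rightarrow> nat set \<Rightarrow> nat monoid \<Rightarrow> (nat \<Rightarrow> nat) \<Rightarrow>
    nat monoid \<Rightarrow> (nat \<Rightarrow> nat) \<Rightarrow> bool" where
  "has_amalgam c p K C1 f1 C2 f2 \<longleftrightarrow> (\<exists>(D :: nat monoid) g1 g2. finite_in_variety c p D \<and> embedding g1 C1 D \<and> embedding g2 C2 D \<and>
        (\<forall>a \<in> K. g1 (f1 a) = g2 (f2 a)))"

definition amalgamates :: "nat \<Rightarrow> nat \<Rightarrow> nat set \<Rightarrow> nat monoid \<Rightarrow> bool" where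
  "amalgamates c p K B \<longleftrightarrow> (\<forall>(C1 :: nat monoid) (C2 :: nat monoid) f1 f2.
     finite_in_variety c p C1 \<and> finite_in_variety c p C2 \<and> embedding f1 B C1 \<and> embedding f2 B C2 \<longrightarrow>
     has_amalgam c p K C1 f1 C2 f2)"

lemma amalgamates_image:
  assumes "amalgamates c p K B" "embedding i B B'"
  shows "amalgamates c p (i ` K) B'"
  unfolding amalgamates_def
proof (intro allI impI, elim conjE)
  fix C1 C2 :: "nat monoid" and f1 f2
  assume f: "finite_in_variety c p C1" "finite_in_variety c p C2" "embedding f1 B' C1" "embedding f2 B' C2"
  have "finite_in_variety c p C1 \<and> finite_in_variety c p C2 \<and> embedding (f1 \<circ> i) B C1 \<and> embedding (f2 \<circ> i) B C2"
    using f assms(2) embedding_comp by blast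
  from assms(1) [unfolded amalgamates_def, rule_format, OF this]
  show "has_amalgam c p (i ` K) C1 f1 C2 f2" by (simp add: has_amalgam_def)
qed

lemma amalgamates_subset: "\<lbrakk>amalgamates c p K B; L \<subseteq> K\<rbrakk> \<Longrightarrow> amalgamates c p L B"
  unfolding amalgamates_def has_amalgam_def by (meson subsetD)

text \<open>
  Only the terms below the class have to be compared, as the later ones are trivial.
\<close>

lemma amalgamation_nat:
  fixes C1 C2 A :: "nat monoid"
  assumes C: "finite_in_variety c p C1" "finite_in_variety c p C2"
    and A: "group A" and e1: "embedding e1 A C1" and e2: "embedding e2 A C2"
    and lcs: "\<And>a n. \<lbrakk>a \<in> carrier A; n < c\<rbrakk> \<Longrightarrow> e1 a \<in> lower_central_series C1 n \<longleftrightarrow> e2 a \<in> lower_central_series C2 n"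
    and p: "prime p" "p > c"
  shows "has_amalgam c p (carrier A) C1 e1 C2 e2"
proof -
  have V: "in_variety c p C1" "finite (carrier C1)" "in_variety c p C2" "finite (carrier C2)"
    using C by (auto simp: finite_in_variety_def)
  have triv: "e a \<in> lower_central_series C n \<longleftrightarrow> a = \<one>\<^bsub>A\<^esub>"
    if "n \<ge> c" "a \<in> carrier A" "in_variety c p C" "embedding e A C" for e a n and C :: "nat monoid"
  proof -
    interpret C: group C by (rule in_variety_group [OF that(3)])
    interpret A: group A by fact
    have "lower_central_series C n \<subseteq> lower_central_series C c"
      by (rule lift_Suc_antimono_le [of "lower_central_series C"]) (use C.lower_central_series_antimono that(1) in auto)
    then have "lower_central_series C n = {\<one>\<^bsub>C\<^esub>}"
      using in_variety_lower_central_series [OF that(3)] subgroup.one_closed [OF C.lower_central_series_subgroup, of n] by blast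
    then show ?thesis
      using embedding_one [OF that(4) A C.is_group] embedding_eq_iff [OF that(4,2) A.one_closed] by simp
  qed
  have lcs': "e1 a \<in> lower_central_series C1 n \<longleftrightarrow> e2 a \<in> lower_central_series C2 n" if "a \<in> carrier A" for a n
    using lcs that triv [OF _ that V(1) e1] triv [OF _ that V(3) e2] by (cases "n < c") auto
  have "\<exists>(D :: ((nat \<Rightarrow> nat \<Rightarrow> rat_mod_int) \<Rightarrow> (nat \<Rightarrow> nat \<Rightarrow> rat_mod_int)) monoid) g1 g2.
    in_variety c p D \<and> finite (carrier D) \<and> embedding g1 C1 D \<and> embedding g2 C2 D \<and>
    (\<forall>a \<in> carrier A. g1 (e1 a) = g2 (e2 a))"
    by (rule amalgamation [OF V A e1 e2 _ p]) (rule lcs')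
  then obtain D :: "((nat \<Rightarrow> nat \<Rightarrow> rat_mod_int) \<Rightarrow> (nat \<Rightarrow> nat \<Rightarrow> rat_mod_int)) monoid" and g1 g2
    where D: "finite_in_variety c p D" "embedding g1 C1 D" "embedding g2 C2 D" "\<forall>a \<in> carrier A. g1 (e1 a) = g2 (e2 a)"
    unfolding finite_in_variety_def by blast
  obtain D' :: "nat monoid" and f where f: "finite_in_variety c p D'" "embedding f D D'"
    using finite_in_variety_nat [OF D(1)] by blast
  show ?thesis
    unfolding has_amalgam_def using f(1) embedding_comp [OF D(2) f(2)] embedding_comp [OF D(3) f(2)] D(4)
    by (intro exI [of _ D'] exI [of _ "f \<circ> g1"] exI [of _ "f \<circ> g2"]) simp
qed

text \<open>
  The sets \<open>S B f n\<close> form the filtration that the extension \<open>f\<close> of \<open>A\<close> to \<open>B\<close> induces, and they can only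
  grow when \<open>B\<close> is extended. Choose \<open>B\<close> with the largest total size \<open>\<mu>\<close>. Then every extension of \<open>B\<close>
  induces the same filtration on \<open>A\<close>, which is what amalgamation over \<open>A\<close> requires.
\<close>

lemma weak_amalgamation:
  fixes A :: "nat monoid"
  assumes A: "finite_in_variety c p A" and p: "prime p" "p > c"
  shows "\<exists>(B :: nat monoid) f. finite_in_variety c p B \<and> embedding f A B \<and> amalgamates c p (f ` carrier A) B"
proof -
  have A': "group A" "finite (carrier A)" using A in_variety_group by (auto simp: finite_in_variety_def)
  define S where "S B f n = {a \<in> carrier A. f a \<in> lower_central_series B n}" for B :: "nat monoid" and f n
  define \<mu> where "\<mu> = (\<lambda>(B, f). \<Sum>n<c. card (S B f n))"
  define ok where "ok = (\<lambda>(B :: nat monoid, f). finite_in_variety c p B \<and> embedding f A B)"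
  have fin: "finite (S B f n)" for B f n using A'(2) by (simp add: S_def)
  have "\<mu> x \<le> c * card (carrier A)" for x
  proof -
    have "card (S B f n) \<le> card (carrier A)" for B f n by (rule card_mono [OF A'(2)]) (auto simp: S_def)
    then show ?thesis using sum_bounded_above [of "{..<c}" _ "card (carrier A)"] unfolding \<mu>_def by (cases x) simp
  qed
  then have bound: "\<forall>y. ok y \<longrightarrow> \<mu> y < Suc (c * card (carrier A))" by (simp add: less_Suc_eq_le)
  have "ok (A, id)" using A by (auto simp: ok_def embedding_def hom_def)
  from ex_has_greatest_nat [OF this bound] obtain B f where Bf: "ok (B, f)" and max: "\<And>C h. ok (C, h) \<Longrightarrow> \<mu> (C, h) \<le> \<mu> (B, f)"
    by auto
  have B: "finite_in_variety c p B" "embedding f A B" using Bf by (auto simp: ok_def)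
  have stable: "S C (h \<circ> f) n = S B f n"
    if C: "finite_in_variety c p C" "embedding h B C" and n: "n < c" for C :: "nat monoid" and h n
  proof -
    have g: "group B" "group C" using B(1) C(1) in_variety_group by (auto simp: finite_in_variety_def)
    have sub: "S B f m \<subseteq> S C (h \<circ> f) m" for m
      unfolding S_def using lower_central_series_embedding [OF C(2) g] by auto
    have "\<mu> (C, h \<circ> f) \<le> \<mu> (B, f)" using C embedding_comp [OF B(2) C(2)] by (intro max) (simp add: ok_def)
    moreover have "card (S B f m) \<le> card (S C (h \<circ> f) m)" for m using card_mono [OF fin sub] .
    ultimately have "card (S C (h \<circ> f) n) \<le> card (S B f n)"
      unfolding \<mu>_def using n sum_strict_mono_ex1 [of "{..<c}" "\<lambda>m. card (S B f m)" "\<lambda>m. card (S C (h \<circ> f) m)"]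
      by (force simp: not_less [symmetric])
    then show ?thesis by (rule card_seteq [OF fin sub, symmetric])
  qed
  have "amalgamates c p (f ` carrier A) B"
    unfolding amalgamates_def
  proof (intro allI impI, elim conjE)
    fix C1 C2 :: "nat monoid" and f1 f2
    assume C: "finite_in_variety c p C1" "finite_in_variety c p C2" "embedding f1 B C1" "embedding f2 B C2"
    have "(f1 \<circ> f) a \<in> lower_central_series C1 n \<longleftrightarrow> (f2 \<circ> f) a \<in> lower_central_series C2 n"
      if "a \<in> carrier A" "n < c" for a n
      using stable [OF C(1,3) that(2)] stable [OF C(2,4) that(2)] that(1) unfolding S_def by blast
    then have "has_amalgam c p (carrier A) C1 (f1 \<circ> f) C2 (f2 \<circ> f)"
      by (rule amalgamation_nat [OF C(1,2) A'(1) embedding_comp [OF B(2) C(3)] embedding_comp [OF B(2) C(4)] _ p])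
    then show "has_amalgam c p (f ` carrier A) C1 f1 C2 f2" by (simp add: has_amalgam_def)
  qed
  then show ?thesis using B by blast
qed

lemma amalgamates_trivial:
  assumes B: "group B" "carrier B = {\<one>\<^bsub>B\<^esub>}" and p: "prime p" "p > c"
  shows "amalgamates c p (carrier B) B"
  unfolding amalgamates_def
proof (intro allI impI, elim conjE)
  fix C1 C2 :: "nat monoid" and f1 f2
  assume C: "finite_in_variety c p C1" "finite_in_variety c p C2" "embedding f1 B C1" "embedding f2 B C2"
  have one: "f a \<in> lower_central_series C n"
    if "a \<in> carrier B" "finite_in_variety c p C" "embedding f B C" for a f n and C :: "nat monoid"
  proof -
    have g: "group C" using that(2) in_variety_group by (auto simp: finite_in_variety_def)
    then have "f a = \<one>\<^bsub>C\<^esub>" using embedding_one [OF that(3) B(1) g] that(1) B(2) by auto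
    then show ?thesis using subgroup.one_closed [OF group.lower_central_series_subgroup [OF g]] by simp
  qed
  show "has_amalgam c p (carrier B) C1 f1 C2 f2"
    by (rule amalgamation_nat [OF C(1,2) B(1) C(3,4) _ p]) (use one C in blast)
qed

section \<open>Continuity of words and closedness\<close>

lemma continuous_on_nat_iff:
  fixes f :: "'a::topological_space \<Rightarrow> nat"
  shows "continuous_on UNIV f \<longleftrightarrow> (\<forall>k. open {x. f x = k})"
proof
  assume f: "continuous_on UNIV f"
  show "\<forall>k. open {x. f x = k}"
    using open_vimage [OF open_discrete f, of "{_}"] by (simp add: vimage_def)
next
  assume o: "\<forall>k. open {x. f x = k}"
  have "open (f -` B)" for B
  proof -
    have "f -` B = (\<Union>k \<in> B. {x. f x = k})" by auto
    then show ?thesis using o by auto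
  qed
  then show "continuous_on UNIV f" by (simp add: continuous_on_open_vimage)
qed

lemma enum_mult_conv: "enum_mult H x y = fst H (x, y)" and enum_inv_conv: "enum_inv H x = fst (snd H) x"
  and enum_one_conv: "enum_one H = snd (snd H)"
  by (cases H; simp)+

lemma continuous_enum_mult_const: "continuous_on UNIV (\<lambda>H. enum_mult H x y)"
  unfolding enum_mult_conv
  by (rule continuous_on_product_then_coordinatewise [OF continuous_on_fst [OF continuous_on_id]])

lemma continuous_enum_inv_const: "continuous_on UNIV (\<lambda>H. enum_inv H x)"
  unfolding enum_inv_conv
  by (rule continuous_on_product_then_coordinatewise [OF continuous_on_fst [OF continuous_on_snd [OF continuous_on_id]]])

lemma continuous_enum_one: "continuous_on UNIV enum_one"
proof -
  have "enum_one = (\<lambda>H. snd (snd H))" by (simp add: fun_eq_iff enum_one_conv)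
  then show ?thesis
    by (rule ssubst) (rule continuous_on_snd [OF continuous_on_snd [OF continuous_on_id]])
qed

text \<open>
  The arguments may depend on the structure, since they are locally constant.
\<close>

lemma continuous_enum_mult:
  assumes "continuous_on UNIV a" "continuous_on UNIV b"
  shows "continuous_on UNIV (\<lambda>H. enum_mult H (a H) (b H))"
  unfolding continuous_on_nat_iff
proof
  fix k
  have "{H. enum_mult H (a H) (b H) = k} = (\<Union>x y. {H. a H = x} \<inter> {H. b H = y} \<inter> {H. enum_mult H x y = k})" by auto
  moreover have "open ({H. a H = x} \<inter> {H. b H = y} \<inter> {H. enum_mult H x y = k})" for x y
    using assms continuous_enum_mult_const [of x y] unfolding continuous_on_nat_iff by (intro open_Int) auto
  ultimately show "open {H. enum_mult H (a H) (b H) = k}" by (auto intro!: open_UN)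
qed

lemma continuous_enum_inv:
  assumes "continuous_on UNIV a"
  shows "continuous_on UNIV (\<lambda>H. enum_inv H (a H))"
  unfolding continuous_on_nat_iff
proof
  fix k
  have "{H. enum_inv H (a H) = k} = (\<Union>x. {H. a H = x} \<inter> {H. enum_inv H x = k})" by auto
  moreover have "open ({H. a H = x} \<inter> {H. enum_inv H x = k})" for x
    using assms continuous_enum_inv_const [of x] unfolding continuous_on_nat_iff by (intro open_Int) auto
  ultimately show "open {H. enum_inv H (a H) = k}" by (auto intro!: open_UN)
qed

definition enum_commutator :: "enum_structure \<Rightarrow> nat \<Rightarrow> nat \<Rightarrow> nat" where
  "enum_commutator H x y = enum_mult H (enum_mult H (enum_mult H x y) (enum_inv H x)) (enum_inv H y)"

primrec enum_pow :: "enum_structure \<Rightarrow> nat \<Rightarrow> nat \<Rightarrow> nat" where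
  "enum_pow H x 0 = enum_one H"
| "enum_pow H x (Suc n) = enum_mult H (enum_pow H x n) x"

lemma enum_commutator: "H \<in> enum_groups \<Longrightarrow> commutator (group_of H) = enum_commutator H"
  by (auto simp: fun_eq_iff commutator_def enum_commutator_def enum_groups_def)

lemma enum_pow: "x [^]\<^bsub>group_of H\<^esub> (n::nat) = enum_pow H x n"
  by (induction n) (simp_all add: nat_pow_def)

lemma closedin_enum_nil_groups: "closedin (top_of_set enum_groups) (enum_nil_groups c p)"
proof -
  have fold: "continuous_on UNIV (\<lambda>H. foldl (enum_commutator H) (a H) ys)" if "continuous_on UNIV a" for a ys
    using that
  proof (induction ys arbitrary: a)
    case (Cons y ys)
    have "continuous_on UNIV (\<lambda>H. enum_commutator H (a H) y)"
      unfolding enum_commutator_def using Cons.prems by (intro continuous_enum_mult continuous_enum_inv) auto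
    then show ?case using Cons.IH by simp
  qed simp
  have pow: "continuous_on UNIV (\<lambda>H. enum_pow H x n)" for x n
    by (induction n) (auto simp: continuous_enum_one intro: continuous_enum_mult)
  let ?C = "(\<Inter>x. \<Inter>ys \<in> {ys. length ys = c}. {H. foldl (enum_commutator H) x ys = enum_one H}) \<inter> (\<Inter>x. {H. enum_pow H x p = enum_one H})"
  have "closed ?C"
    by (intro closed_Int closed_INT ballI closed_Collect_eq fold pow continuous_enum_one continuous_on_const)
  moreover have "enum_nil_groups c p = enum_groups \<inter> ?C"
    unfolding enum_nil_groups_iff set_eq_iff in_variety_def Int_iff
    by (auto simp: enum_pow enum_commutator) (auto simp: enum_groups_def)
  ultimately show ?thesis by (auto simp: closedin_closed)
qed

text \<open>
  A basic open set of a product constrains finitely many coordinates.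
\<close>

lemma open_enum_structure_finite_dependence:
  assumes "open U" "H0 \<in> U"
  shows "\<exists>F. finite F \<and> (\<forall>H. (\<forall>x \<in> F. \<forall>y \<in> F. enum_mult H x y = enum_mult H0 x y) \<and>
    (\<forall>x \<in> F. enum_inv H x = enum_inv H0 x) \<and> enum_one H = enum_one H0 \<longrightarrow> H \<in> U)"
proof -
  have dep: "\<exists>F. finite F \<and> (\<forall>g. (\<forall>x \<in> F. g x = f x) \<longrightarrow> g \<in> V)" if "open V" "f \<in> V" for V and f :: "'i \<Rightarrow> nat"
  proof -
    have "openin (product_topology (\<lambda>i. euclidean) UNIV) V" using that(1) by (simp add: open_fun_def)
    from product_topology_open_contains_basis [OF this that(2)]
    obtain X where X: "f \<in> (\<Pi>\<^sub>E i\<in>UNIV. X i)" "finite {i. X i \<noteq> topspace euclidean}" "(\<Pi>\<^sub>E i\<in>UNIV. X i) \<subseteq> V"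
      by blast
    have "g \<in> V" if "\<forall>i \<in> {i. X i \<noteq> topspace euclidean}. g i = f i" for g
    proof -
      have "g i \<in> X i" for i using X(1) that by (cases "X i = UNIV") (auto simp: PiE_def)
      then show ?thesis using X(3) by auto
    qed
    then show ?thesis using X(2) by blast
  qed
  obtain m i e where H0: "H0 = (m, i, e)" by (cases H0)
  obtain A B where AB: "open A" "open B" "m \<in> A" "(i, e) \<in> B" "A \<times> B \<subseteq> U"
    using assms unfolding H0 by (auto elim: open_prod_elim)
  obtain B1 B2 where B: "open B1" "i \<in> B1" "e \<in> B2" "B1 \<times> B2 \<subseteq> B"
    using AB(2,4) by (auto elim: open_prod_elim)
  obtain F1 where F1: "finite F1" "\<And>g. (\<forall>x \<in> F1. g x = m x) \<Longrightarrow> g \<in> A" using dep [OF AB(1,3)] by blast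
  obtain F2 where F2: "finite F2" "\<And>g. (\<forall>x \<in> F2. g x = i x) \<Longrightarrow> g \<in> B1" using dep [OF B(1,2)] by blast
  define F where "F = fst ` F1 \<union> snd ` F1 \<union> F2"
  have "H \<in> U" if H: "\<forall>x \<in> F. \<forall>y \<in> F. enum_mult H x y = enum_mult H0 x y"
    "\<forall>x \<in> F. enum_inv H x = enum_inv H0 x" "enum_one H = enum_one H0" for H
  proof -
    obtain m' i' e' where H': "H = (m', i', e')" by (cases H)
    have "m' x = m x" if "x \<in> F1" for x
      using H(1) that unfolding F_def H' H0 by (cases x) force
    then have "m' \<in> A" using F1(2) by blast
    moreover have "i' \<in> B1" using F2(2) H(2) unfolding F_def H' H0 by auto
    moreover have "e' = e" using H(3) by (simp add: H' H0)
    ultimately show ?thesis using AB(5) B(3,4) unfolding H' by blast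
  qed
  moreover have "finite F" using F1 F2 by (simp add: F_def)
  ultimately show ?thesis by blast
qed

section \<open>Comeagre sets\<close>

lemma openin_subspaceI:
  assumes "S \<subseteq> P" "\<And>x. x \<in> S \<Longrightarrow> \<exists>N. open N \<and> x \<in> N \<and> N \<inter> P \<subseteq> S"
  shows "openin (top_of_set P) S"
proof (subst openin_subopen, intro ballI)
  fix x assume x: "x \<in> S"
  then obtain N where "open N" "x \<in> N" "N \<inter> P \<subseteq> S" using assms(2) by blast
  then show "\<exists>T. openin (top_of_set P) T \<and> x \<in> T \<and> T \<subseteq> S"
    using assms(1) x by (intro exI [of _ "P \<inter> N"]) (auto simp: openin_open)
qed

lemma comeagre_inI:
  assumes "countable \<O>" "\<And>U. U \<in> \<O> \<Longrightarrow> openin (top_of_set P) U"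
    and dense: "\<And>U x N. \<lbrakk>U \<in> \<O>; x \<in> P; open N; x \<in> N\<rbrakk> \<Longrightarrow> N \<inter> U \<noteq> {}"
    and S: "S \<subseteq> P" "P \<inter> \<Inter>\<O> \<subseteq> S"
  shows "comeagre_in (top_of_set P) S"
proof -
  let ?X = "top_of_set P"
  have nd: "nowhere_dense_in ?X ((P - U) \<inter> (P - S))" if U: "U \<in> insert P \<O>" for U
  proof -
    have oU: "openin ?X U" using U assms(2) by auto
    have "?X closure_of U = P"
    proof (cases "U = P")
      case True
      then show ?thesis using closure_of_topspace [of ?X] by simp
    next
      case False
      then have UO: "U \<in> \<O>" using U by simp
      have "x \<in> ?X closure_of U" if x: "x \<in> P" for x
        unfolding in_closure_of
      proof (intro conjI allI impI)
        show "x \<in> topspace ?X" using x by simp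
        fix T assume T: "x \<in> T \<and> openin ?X T"
        then obtain N where N: "open N" "T = P \<inter> N" by (auto simp: openin_open)
        then have "N \<inter> U \<noteq> {}" using dense [OF UO x N(1)] T by auto
        moreover have "U \<subseteq> P" using openin_subset [OF oU] by simp
        ultimately show "\<exists>y. y \<in> U \<and> y \<in> T" using N by auto
      qed
      then show ?thesis using closure_of_subset_topspace [of ?X U] by auto
    qed
    then have "?X interior_of (P - U) = {}"
      using interior_of_complement [of ?X U] by simp
    moreover have "closedin ?X (P - U)" using oU by (metis closedin_diff closedin_topspace topspace_euclidean_subtopology)
    then have "?X closure_of ((P - U) \<inter> (P - S)) \<subseteq> P - U" by (rule closure_of_minimal [rotated]) auto
    ultimately show ?thesis
      unfolding nowhere_dense_in_def using interior_of_mono by fastforce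
  qed
  \<comment> \<open>Inserting the whole space makes the family nonempty, so that it can be enumerated.\<close>
  define F where "F n = (P - from_nat_into (insert P \<O>) n) \<inter> (P - S)" for n
  have "P - S = (\<Union>n. F n)"
  proof -
    have "range (from_nat_into (insert P \<O>)) = insert P \<O>" using assms(1) by (intro range_from_nat_into) auto
    then have "(\<Union>n. F n) = (\<Union>U \<in> insert P \<O>. (P - U) \<inter> (P - S))" unfolding F_def by blast
    also have "\<dots> = P - S" using S by auto
    finally show ?thesis by simp
  qed
  moreover have "nowhere_dense_in ?X (F n)" for n
    unfolding F_def by (rule nd) (rule from_nat_into, simp)
  ultimately show ?thesis unfolding comeagre_in_def meagre_in_def using S by auto
qed

section \<open>Agreement on finite subgroups\<close>

definition agree :: "nat set \<Rightarrow> enum_structure \<Rightarrow> enum_structure \<Rightarrow> bool" where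
  "agree S H H' \<longleftrightarrow> (\<forall>x \<in> S. \<forall>y \<in> S. enum_mult H x y = enum_mult H' x y)"

lemma agree_sym: "agree S H H' \<Longrightarrow> agree S H' H" by (simp add: agree_def)

lemma agree_subset: "\<lbrakk>agree S H H'; T \<subseteq> S\<rbrakk> \<Longrightarrow> agree T H H'" by (auto simp: agree_def)

lemma open_agree:
  assumes "finite S" shows "open {H. agree S H H0}"
proof -
  have "{H. agree S H H0} = (\<Inter>x \<in> S. \<Inter>y \<in> S. {H. enum_mult H x y = enum_mult H0 x y})"
    by (auto simp: agree_def)
  moreover have "open {H. enum_mult H x y = k}" for x y k
    using continuous_enum_mult_const unfolding continuous_on_nat_iff by blast
  ultimately show ?thesis using assms by (auto intro!: open_INT)
qed

abbreviation restrict_group :: "enum_structure \<Rightarrow> nat set \<Rightarrow> nat monoid" where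
  "restrict_group H S \<equiv> (group_of H)\<lparr>carrier := S\<rparr>"

lemma enum_groups_group: "H \<in> enum_groups \<Longrightarrow> group (group_of H)"
  by (simp add: enum_groups_def)

text \<open>
  The identity is the only idempotent, so the multiplication on a subgroup determines identity and inverses.
\<close>

lemma agree_one_inv:
  assumes H: "H \<in> enum_groups" "H' \<in> enum_groups" and S: "subgroup S (group_of H)" and agree: "agree S H H'"
  shows "enum_one H' = enum_one H" and "x \<in> S \<Longrightarrow> enum_inv H' x = enum_inv H x"
proof -
  interpret H: group "group_of H" using H(1) by (rule enum_groups_group)
  interpret H': group "group_of H'" using H(2) by (rule enum_groups_group)
  have eS: "enum_one H \<in> S" using subgroup.one_closed [OF S] by simp
  then have "enum_mult H' (enum_one H) (enum_one H) = enum_one H"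
    using agree H.l_one [of "enum_one H"] by (simp add: agree_def)
  then have "enum_one H = \<one>\<^bsub>group_of H'\<^esub>"
    using H'.l_cancel_one [of "enum_one H" "enum_one H"] by simp
  then show one: "enum_one H' = enum_one H" by simp
  show "enum_inv H' x = enum_inv H x" if x: "x \<in> S"
  proof -
    have i: "enum_inv H x = inv\<^bsub>group_of H\<^esub> x" "enum_inv H' x = inv\<^bsub>group_of H'\<^esub> x"
      using H by (simp_all add: enum_groups_def)
    have "inv\<^bsub>group_of H\<^esub> x \<in> S" using subgroup.m_inv_closed [OF S x] .
    then have "enum_mult H' (inv\<^bsub>group_of H\<^esub> x) x = enum_one H'"
      using agree x one H.l_inv [of x] by (simp add: agree_def)
    then have "inv\<^bsub>group_of H'\<^esub> x = inv\<^bsub>group_of H\<^esub> x" using H'.inv_equality by simp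
    then show ?thesis using i by simp
  qed
qed

lemma agree_subgroup:
  assumes H: "H \<in> enum_groups" "H' \<in> enum_groups" and S: "subgroup S (group_of H)" and agree: "agree S H H'"
  shows "subgroup S (group_of H')"
proof -
  interpret H': group "group_of H'" using H(2) by (rule enum_groups_group)
  have i: "enum_inv H x = inv\<^bsub>group_of H\<^esub> x" "enum_inv H' x = inv\<^bsub>group_of H'\<^esub> x" for x
    using H by (simp_all add: enum_groups_def)
  show ?thesis
  proof (rule H'.subgroupI)
    show "S \<noteq> {}" using subgroup.one_closed [OF S] by auto
    show "inv\<^bsub>group_of H'\<^esub> x \<in> S" if "x \<in> S" for x
      using agree_one_inv(2) [OF H S agree that] subgroup.m_inv_closed [OF S that] i by simp
    show "x \<otimes>\<^bsub>group_of H'\<^esub> y \<in> S" if "x \<in> S" "y \<in> S" for x y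
      using subgroup.m_closed [OF S that] agree that by (simp add: agree_def)
  qed simp
qed

lemma agree_embedding:
  assumes "subgroup S (group_of H)" "agree S H H'" "S \<subseteq> T"
  shows "embedding id (restrict_group H S) (restrict_group H' T)"
  using assms subgroup.m_closed [OF assms(1)] by (auto simp: embedding_def hom_def agree_def)

text \<open>
  By the preceding lemmas the multiplication on a large enough subgroup controls all three components.
\<close>

lemma agree_neighbourhood:
  assumes "open U" "H0 \<in> U" "H0 \<in> enum_groups"
  shows "\<exists>F. finite F \<and> (\<forall>S H. F \<subseteq> S \<and> subgroup S (group_of H0) \<and> H \<in> enum_groups \<and> agree S H0 H \<longrightarrow> H \<in> U)"
proof -
  obtain F where F: "finite F" "\<And>H. (\<forall>x \<in> F. \<forall>y \<in> F. enum_mult H x y = enum_mult H0 x y) \<and>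
    (\<forall>x \<in> F. enum_inv H x = enum_inv H0 x) \<and> enum_one H = enum_one H0 \<Longrightarrow> H \<in> U"
    using open_enum_structure_finite_dependence [OF assms(1,2)] by blast
  have "H \<in> U" if H: "F \<subseteq> S" "subgroup S (group_of H0)" "H \<in> enum_groups" "agree S H0 H" for S H
    using agree_one_inv [OF assms(3) H(3,2,4)] H(1,4) by (intro F(2)) (auto simp: agree_def subset_iff)
  then show ?thesis using F(1) by blast
qed


section \<open>Rich groups\<close>

text \<open>
  The two kinds of requirements. The first provides, around every finite set, a subgroup all of whose
  extensions amalgamate over that set. The second says that such an extension is realized over the set. There the extension
  is presented as a pair of subgroups \<open>S \<subseteq> T\<close> of an enumerated group \<open>G\<close>; when \<open>G\<close> ranges over a countable dense
  set, this leaves countably many requirements and still covers all finite extensions.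
\<close>

definition determined :: "nat \<Rightarrow> nat \<Rightarrow> nat set \<Rightarrow> enum_structure set" where
  "determined c p K = {H \<in> enum_nil_groups c p. \<exists>S. finite S \<and> subgroup S (group_of H) \<and> K \<subseteq> S \<and>
     amalgamates c p K (restrict_group H S)}"

definition realizing :: "nat \<Rightarrow> nat \<Rightarrow> nat set \<Rightarrow> nat set \<Rightarrow> nat set \<Rightarrow> enum_structure \<Rightarrow> enum_structure set" where
  "realizing c p K S T G = {H \<in> enum_nil_groups c p.
     agree S G H \<and> K \<subseteq> S \<and> S \<subseteq> T \<and> subgroup S (group_of G) \<and> subgroup T (group_of G) \<and>
     amalgamates c p K (restrict_group G S) \<longrightarrow>
     (\<exists>g. embedding g (restrict_group G T) (group_of H) \<and> (\<forall>a \<in> K. g a = a))}"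

locale generic_setting =
  fixes c p :: nat
  assumes c: "c > 0" and p: "prime p" "p > c"
begin

abbreviation "P \<equiv> enum_nil_groups c p"

lemma P_D:
  assumes "H \<in> P"
  shows "H \<in> enum_groups" "in_variety c p (group_of H)" "group (group_of H)"
  using assms enum_nil_groups_iff in_variety_group by blast+

lemma finite_restrict_group:
  assumes "H \<in> P" "subgroup S (group_of H)" "finite S"
  shows "finite_in_variety c p (restrict_group H S)"
  using in_variety_subgroup [OF P_D(2) [OF assms(1)] assms(2)] assms(3) by (simp add: finite_in_variety_def)

lemma exists_finite_subgroup:
  assumes "H \<in> P" "finite K"
  shows "\<exists>S. finite S \<and> subgroup S (group_of H) \<and> K \<subseteq> S"
proof -
  interpret group "group_of H" by (rule P_D(3) [OF assms(1)])
  have "finite (generate (group_of H) K)"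
    using generate_finite [OF P_D(2) [OF assms(1)] prime_gt_0_nat [OF p(1)] assms(2)] by simp
  moreover have "subgroup (generate (group_of H) K) (group_of H)" by (rule generate_is_subgroup) simp
  moreover have "K \<subseteq> generate (group_of H) K" by (auto intro: generate.incl)
  ultimately show ?thesis by blast
qed

lemma agree_if_retraction:
  assumes "embedding f (restrict_group H S) D" "embedding h D (group_of H')" "\<And>x. x \<in> S \<Longrightarrow> h (f x) = x"
    "subgroup S (group_of H)"
  shows "agree S H H'"
  unfolding agree_def
proof (intro ballI)
  fix x y assume xy: "x \<in> S" "y \<in> S"
  have "f x \<in> carrier D" "f y \<in> carrier D" using xy embedding_closed [OF assms(1)] by auto
  then have "enum_mult H' x y = h (f x \<otimes>\<^bsub>D\<^esub> f y)"
    using embedding_mult [OF assms(2)] assms(3) xy by simp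
  also have "f x \<otimes>\<^bsub>D\<^esub> f y = f (enum_mult H x y)" using embedding_mult [OF assms(1)] xy by simp
  also have "h \<dots> = enum_mult H x y" using assms(3) subgroup.m_closed [OF assms(4) xy] by simp
  finally show "enum_mult H x y = enum_mult H' x y" by simp
qed

lemma embedding_onto_image:
  assumes h: "embedding h D (group_of H)" and D: "group D" and H: "H \<in> P"
  shows "subgroup (h ` carrier D) (group_of H)" and "embedding h D (restrict_group H (h ` carrier D))"
proof -
  show "subgroup (h ` carrier D) (group_of H)"
    using h D P_D(3) [OF H] unfolding embedding_def
    by (metis group_hom.img_is_subgroup group_hom.intro group_hom_axioms.intro)
  show "embedding h D (restrict_group H (h ` carrier D))"
    using h by (auto simp: embedding_def hom_def)
qed

text \<open>
  Renaming the elements of a finite extension of \<open>S\<close> so that \<open>S\<close> keeps its numbers.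
\<close>

lemma realize_over:
  assumes D: "finite_in_variety c p D" and f: "embedding f (restrict_group H S) D"
    and S: "subgroup S (group_of H)" "finite S"
  shows "\<exists>H' \<in> P. \<exists>h. embedding h D (group_of H') \<and> (\<forall>x \<in> S. h (f x) = x) \<and> agree S H H'"
proof -
  have "inj_on f S" "f ` S \<subseteq> carrier D" using f embedding_closed [OF f] by (auto simp: embedding_def)
  then obtain H' h where h: "H' \<in> P" "embedding h D (group_of H')" "\<forall>x \<in> S. h (f x) = x"
    using exists_enumerated_supergroup [OF D c p(1) S(2), of f] by blast
  then show ?thesis using agree_if_retraction [OF f h(2) _ S(1)] by blast
qed

lemma openin_determined: "openin (top_of_set P) (determined c p K)"
proof (rule openin_subspaceI)
  fix H assume "H \<in> determined c p K"
  then obtain S where H: "H \<in> P" and S: "finite S" "subgroup S (group_of H)" "K \<subseteq> S" "amalgamates c p K (restrict_group H S)"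
    by (auto simp: determined_def)
  have "H' \<in> determined c p K" if "agree S H' H" "H' \<in> P" for H'
  proof -
    have a: "agree S H H'" using that(1) by (rule agree_sym)
    have "amalgamates c p (id ` K) (restrict_group H' S)"
      by (rule amalgamates_image [OF S(4) agree_embedding [OF S(2) a order_refl]])
    then show ?thesis
      using agree_subgroup [OF P_D(1) [OF H] P_D(1) [OF that(2)] S(2) a] S that(2) by (auto simp: determined_def)
  qed
  then show "\<exists>N. open N \<and> H \<in> N \<and> N \<inter> P \<subseteq> determined c p K"
    using open_agree [OF S(1), of H] by (intro exI [of _ "{H'. agree S H' H}"]) (auto simp: agree_def)
qed (auto simp: determined_def)

text \<open>
  Near \<open>H0\<close> only the multiplication on some finite subgroup \<open>S\<close> is prescribed; realize over \<open>S\<close> the extension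
  that weak amalgamation provides.
\<close>

lemma dense_determined:
  assumes K: "finite K" and H0: "H0 \<in> P" and U: "open U" "H0 \<in> U"
  shows "U \<inter> determined c p K \<noteq> {}"
proof -
  obtain F where F: "finite F" "\<And>S H. \<lbrakk>F \<subseteq> S; subgroup S (group_of H0); H \<in> enum_groups; agree S H0 H\<rbrakk> \<Longrightarrow> H \<in> U"
    using agree_neighbourhood [OF U P_D(1) [OF H0]] by blast
  obtain S where S: "finite S" "subgroup S (group_of H0)" "F \<union> K \<subseteq> S"
    using exists_finite_subgroup [OF H0, of "F \<union> K"] F(1) K by auto
  obtain B :: "nat monoid" and f where B: "finite_in_variety c p B" "embedding f (restrict_group H0 S) B" "amalgamates c p (f ` S) B"
    using weak_amalgamation [OF finite_restrict_group [OF H0 S(2,1)] p] by auto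
  obtain H h where H: "H \<in> P" and h: "embedding h B (group_of H)" "\<forall>x \<in> S. h (f x) = x" "agree S H0 H"
    using realize_over [OF B(1,2) S(2,1)] by blast
  have Bg: "group B" "finite (carrier B)" using B(1) in_variety_group by (auto simp: finite_in_variety_def)
  note T = embedding_onto_image [OF h(1) Bg(1) H]
  have "f ` S \<subseteq> carrier B" using embedding_closed [OF B(2)] by auto
  then have ST: "S \<subseteq> h ` carrier B" using h(2) by force
  have "amalgamates c p (h ` f ` S) (restrict_group H (h ` carrier B))"
    by (rule amalgamates_image [OF B(3) T(2)])
  then have "amalgamates c p K (restrict_group H (h ` carrier B))"
    by (rule amalgamates_subset) (use S(3) h(2) in force)
  then have "H \<in> determined c p K"
    using H T(1) ST S(3) Bg(2) by (auto simp: determined_def intro!: exI [of _ "h ` carrier B"])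
  moreover have "H \<in> U" using F(2) [OF _ S(2) P_D(1) [OF H] h(3)] S(3) by auto
  ultimately show ?thesis by blast
qed

lemma openin_realizing:
  assumes fin: "finite S" "finite T"
  shows "openin (top_of_set P) (realizing c p K S T G)"
proof (rule openin_subspaceI)
  fix H assume H: "H \<in> realizing c p K S T G"
  show "\<exists>N. open N \<and> H \<in> N \<and> N \<inter> P \<subseteq> realizing c p K S T G"
  proof (cases "\<exists>g. embedding g (restrict_group G T) (group_of H) \<and> (\<forall>a \<in> K. g a = a)")
    case True
    then obtain g where g: "embedding g (restrict_group G T) (group_of H)" "\<forall>a \<in> K. g a = a" by blast
    have "embedding g (restrict_group G T) (group_of H')" if "agree (g ` T) H' H" for H'
      using g(1) that by (auto simp: embedding_def hom_def agree_def)
    then show ?thesis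
      using open_agree [of "g ` T" H] fin(2) g(2)
      by (intro exI [of _ "{H'. agree (g ` T) H' H}"]) (auto simp: agree_def realizing_def)
  next
    case False
    then have n: "\<not> (agree S G H \<and> K \<subseteq> S \<and> S \<subseteq> T \<and> subgroup S (group_of G) \<and> subgroup T (group_of G) \<and>
        amalgamates c p K (restrict_group G S))"
      using H by (auto simp: realizing_def)
    have "agree S G H' \<longleftrightarrow> agree S G H" if "agree S H' H" for H' using that by (auto simp: agree_def)
    then show ?thesis
      using open_agree [OF fin(1), of H] n
      by (intro exI [of _ "{H'. agree S H' H}"]) (auto simp: agree_def realizing_def)
  qed
qed (auto simp: realizing_def)

text \<open>
  Let \<open>R\<close> be a finite subgroup of \<open>H0\<close> whose multiplication is prescribed. Both \<open>R\<close> and \<open>T\<close> extend \<open>S\<close>, so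
  they amalgamate over \<open>K\<close>, and the amalgam is realized over \<open>R\<close>.
\<close>

lemma dense_realizing:
  assumes fin: "finite S" "finite T" and G: "G \<in> P" and H0: "H0 \<in> P" and U: "open U" "H0 \<in> U"
  shows "U \<inter> realizing c p K S T G \<noteq> {}"
proof (cases "agree S G H0 \<and> K \<subseteq> S \<and> S \<subseteq> T \<and> subgroup S (group_of G) \<and> subgroup T (group_of G) \<and>
     amalgamates c p K (restrict_group G S)")
  case False
  then have "H0 \<in> realizing c p K S T G" using H0 unfolding realizing_def by blast
  then show ?thesis using U(2) by blast
next
  case True
  obtain F where F: "finite F" "\<And>S H. \<lbrakk>F \<subseteq> S; subgroup S (group_of H0); H \<in> enum_groups; agree S H0 H\<rbrakk> \<Longrightarrow> H \<in> U"
    using agree_neighbourhood [OF U P_D(1) [OF H0]] by blast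
  obtain R where R: "finite R" "subgroup R (group_of H0)" "F \<union> S \<subseteq> R"
    using exists_finite_subgroup [OF H0, of "F \<union> S"] F(1) fin by auto
  have 1: "embedding id (restrict_group G S) (restrict_group H0 R)"
    using True R(3) by (intro agree_embedding) auto
  have 2: "embedding id (restrict_group G S) (restrict_group G T)"
    using True by (intro agree_embedding) (auto simp: agree_def)
  have "finite_in_variety c p (restrict_group H0 R)" "finite_in_variety c p (restrict_group G T)"
    using finite_restrict_group H0 R G True fin by auto
  then have "has_amalgam c p K (restrict_group H0 R) id (restrict_group G T) id"
    using True 1 2 unfolding amalgamates_def by blast
  then obtain D :: "nat monoid" and g1 g2 where D: "finite_in_variety c p D"
    "embedding g1 (restrict_group H0 R) D" "embedding g2 (restrict_group G T) D" "\<And>a. a \<in> K \<Longrightarrow> g1 a = g2 a"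
    by (auto simp: has_amalgam_def)
  obtain H h where H: "H \<in> P" and h: "embedding h D (group_of H)" "\<forall>x \<in> R. h (g1 x) = x" "agree R H0 H"
    using realize_over [OF D(1,2) R(2,1)] by blast
  have "embedding (h \<circ> g2) (restrict_group G T) (group_of H)" by (rule embedding_comp [OF D(3) h(1)])
  moreover have "(h \<circ> g2) a = a" if "a \<in> K" for a
  proof -
    have "a \<in> R" using that True R(3) by auto
    then show ?thesis using h(2) D(4) [OF that, symmetric] by simp
  qed
  ultimately have "H \<in> realizing c p K S T G" using H by (auto simp: realizing_def)
  moreover have "H \<in> U" using F(2) [OF _ R(2) P_D(1) [OF H] h(3)] R(3) by auto
  ultimately show ?thesis by blast
qed

text \<open>
  The second condition quantifies over all finite extensions, so that it can be applied without
  reference to the countable dense set.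
\<close>

definition rich :: "enum_structure \<Rightarrow> bool" where
  "rich H \<longleftrightarrow> H \<in> P \<and> (\<forall>K. finite K \<longrightarrow> (\<exists>S. finite S \<and> subgroup S (group_of H) \<and> K \<subseteq> S \<and>
       amalgamates c p K (restrict_group H S))) \<and>
     (\<forall>S K (C :: nat monoid) f. finite S \<and> subgroup S (group_of H) \<and> K \<subseteq> S \<and> amalgamates c p K (restrict_group H S) \<and>
       finite_in_variety c p C \<and> embedding f (restrict_group H S) C \<longrightarrow>
       (\<exists>g. embedding g C (group_of H) \<and> (\<forall>a \<in> K. g (f a) = a)))"

lemma richD:
  assumes "rich H"
  shows rich_mem: "H \<in> P"
    and rich_determined: "finite K \<Longrightarrow> \<exists>S. finite S \<and> subgroup S (group_of H) \<and> K \<subseteq> S \<and>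
       amalgamates c p K (restrict_group H S)"
    and rich_realizing: "\<lbrakk>finite S; subgroup S (group_of H); K \<subseteq> S; amalgamates c p K (restrict_group H S);
       finite_in_variety c p (C :: nat monoid); embedding f (restrict_group H S) C\<rbrakk>
       \<Longrightarrow> \<exists>g. embedding g C (group_of H) \<and> (\<forall>a \<in> K. g (f a) = a)"
proof -
  note r = assms [unfolded rich_def]
  show "H \<in> P" by (rule r [THEN conjunct1])
  show "finite K \<Longrightarrow> \<exists>S. finite S \<and> subgroup S (group_of H) \<and> K \<subseteq> S \<and>
       amalgamates c p K (restrict_group H S)"
    by (rule r [THEN conjunct2, THEN conjunct1, rule_format])
  show "\<lbrakk>finite S; subgroup S (group_of H); K \<subseteq> S; amalgamates c p K (restrict_group H S);
       finite_in_variety c p C; embedding f (restrict_group H S) C\<rbrakk>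
       \<Longrightarrow> \<exists>g. embedding g C (group_of H) \<and> (\<forall>a \<in> K. g (f a) = a)"
    by (rule r [THEN conjunct2, THEN conjunct2, rule_format]) simp
qed

lemma exists_countable_dense_subset:
  "\<exists>Q. countable Q \<and> Q \<subseteq> P \<and> (\<forall>U. open U \<and> U \<inter> P \<noteq> {} \<longrightarrow> U \<inter> Q \<noteq> {})"
proof -
  obtain \<B> :: "enum_structure set set" where \<B>: "countable \<B>" "topological_basis \<B>"
    using ex_countable_basis by blast
  define Q where "Q = (\<lambda>V. SOME H. H \<in> V \<inter> P) ` {V \<in> \<B>. V \<inter> P \<noteq> {}}"
  have some: "(SOME H. H \<in> V \<inter> P) \<in> V \<inter> P" if "V \<inter> P \<noteq> {}" for V
    using that by (metis some_in_eq)
  have "U \<inter> Q \<noteq> {}" if U: "open U" "U \<inter> P \<noteq> {}" for U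
  proof -
    obtain H where H: "H \<in> U" "H \<in> P" using U by blast
    then obtain V where V: "V \<in> \<B>" "H \<in> V" "V \<subseteq> U" using topological_basisE [OF \<B>(2) U(1)] by metis
    then have "V \<inter> P \<noteq> {}" using H by blast
    then show ?thesis using some [of V] V unfolding Q_def by blast
  qed
  moreover have "countable Q" unfolding Q_def using \<B>(1) by simp
  moreover have "Q \<subseteq> P" unfolding Q_def using some by blast
  ultimately show ?thesis by blast
qed

lemma richI:
  assumes H: "H \<in> P" and Q: "Q \<subseteq> P" "\<And>U. \<lbrakk>open U; U \<inter> P \<noteq> {}\<rbrakk> \<Longrightarrow> U \<inter> Q \<noteq> {}"
    and det: "\<And>K. finite K \<Longrightarrow> H \<in> determined c p K"
    and real: "\<And>K S T G. \<lbrakk>finite K; finite S; finite T; G \<in> Q\<rbrakk> \<Longrightarrow> H \<in> realizing c p K S T G"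
  shows "rich H"
  unfolding rich_def
proof (intro conjI allI impI; (elim conjE)?)
  show "H \<in> P" by (rule H)
  show "\<exists>S. finite S \<and> subgroup S (group_of H) \<and> K \<subseteq> S \<and> amalgamates c p K (restrict_group H S)" if "finite K" for K
    using det [OF that] by (simp add: determined_def)
  fix S K f and C :: "nat monoid"
  assume S: "finite S" "subgroup S (group_of H)" "K \<subseteq> S" "amalgamates c p K (restrict_group H S)"
    and C: "finite_in_variety c p C" "embedding f (restrict_group H S) C"
  obtain H1 h where H1: "H1 \<in> P" and h: "embedding h C (group_of H1)" "\<forall>x \<in> S. h (f x) = x" "agree S H H1"
    using realize_over [OF C S(2,1)] by blast
  have Cg: "group C" "finite (carrier C)" using C(1) in_variety_group by (auto simp: finite_in_variety_def)
  define T where "T = h ` carrier C"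
  note T = embedding_onto_image [OF h(1) Cg(1) H1, folded T_def]
  have finT: "finite T" unfolding T_def using Cg(2) by simp
  have "f ` S \<subseteq> carrier C" using embedding_closed [OF C(2)] by auto
  then have ST: "S \<subseteq> T" unfolding T_def using h(2) by force
  \<comment> \<open>Replace \<open>H1\<close> by a member of the dense set that has the same multiplication on \<open>T\<close>.\<close>
  have "H1 \<in> {G. agree T G H1} \<inter> P" using H1 by (simp add: agree_def)
  then have "{G. agree T G H1} \<inter> Q \<noteq> {}" using Q(2) [OF open_agree [OF finT]] by blast
  then obtain G where G: "G \<in> Q" "agree T G H1" by blast
  have GP: "G \<in> P" using G(1) Q(1) by blast
  have aT: "agree T H1 G" using G(2) by (rule agree_sym)
  have subT: "subgroup T (group_of G)" by (rule agree_subgroup [OF P_D(1) [OF H1] P_D(1) [OF GP] T(1) aT])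
  have aS: "agree S H G" using h(3) agree_subset [OF aT ST] by (simp add: agree_def)
  have subS: "subgroup S (group_of G)" by (rule agree_subgroup [OF P_D(1) [OF H] P_D(1) [OF GP] S(2) aS])
  have "amalgamates c p (id ` K) (restrict_group G S)"
    by (rule amalgamates_image [OF S(4) agree_embedding [OF S(2) aS order_refl]])
  moreover have "finite K" using S(1,3) finite_subset by blast
  ultimately obtain g where g: "embedding g (restrict_group G T) (group_of H)" "\<forall>a \<in> K. g a = a"
    using real [OF _ S(1) finT G(1), of K] agree_sym [OF aS] S(3) ST subS subT by (auto simp: realizing_def)
  have "embedding (id \<circ> h) C (restrict_group G T)"
    by (rule embedding_comp [OF T(2) agree_embedding [OF T(1) aT order_refl]])
  then have "embedding (g \<circ> (id \<circ> h)) C (group_of H)" by (rule embedding_comp [OF _ g(1)])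
  moreover have "(g \<circ> (id \<circ> h)) (f a) = a" if "a \<in> K" for a
    using that g(2) h(2) S(3) by (auto simp: subset_iff)
  ultimately show "\<exists>g. embedding g C (group_of H) \<and> (\<forall>a \<in> K. g (f a) = a)" by blast
qed

lemma comeagre_rich:
  assumes S: "S \<subseteq> P" "\<And>H. rich H \<Longrightarrow> H \<in> S"
  shows "comeagre_in (top_of_set P) S"
proof -
  obtain Q where "countable Q \<and> Q \<subseteq> P \<and> (\<forall>U. open U \<and> U \<inter> P \<noteq> {} \<longrightarrow> U \<inter> Q \<noteq> {})"
    using exists_countable_dense_subset by (rule exE)
  then have Q: "countable Q" "Q \<subseteq> P" "\<And>U. \<lbrakk>open U; U \<inter> P \<noteq> {}\<rbrakk> \<Longrightarrow> U \<inter> Q \<noteq> {}"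
    by simp_all
  let ?Fin = "Collect finite :: nat set set"
  define \<O> where "\<O> = determined c p ` ?Fin \<union> (\<lambda>(K, S, T, G). realizing c p K S T G) ` (?Fin \<times> ?Fin \<times> ?Fin \<times> Q)"
  show ?thesis
  proof (rule comeagre_inI)
    show "countable \<O>" unfolding \<O>_def using Q(1) countable_Collect_finite by auto
    show "openin (top_of_set P) U" if "U \<in> \<O>" for U
      using that openin_determined openin_realizing unfolding \<O>_def by auto
    show "N \<inter> U \<noteq> {}" if U: "U \<in> \<O>" and N: "x \<in> P" "open N" "x \<in> N" for U x N
    proof -
      consider K where "U = determined c p K" "finite K"
        | K S T G where "U = realizing c p K S T G" "finite S" "finite T" "G \<in> Q"
        using U unfolding \<O>_def by auto
      then show ?thesis
      proof cases
        case 1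
        then show ?thesis using dense_determined N by simp
      next
        case 2
        then show ?thesis using dense_realizing [OF 2(2,3) subsetD [OF Q(2) 2(4)] N] by simp
      qed
    qed
    show "S \<subseteq> P" by (rule S(1))
    show "P \<inter> \<Inter>\<O> \<subseteq> S"
    proof
      fix H assume H: "H \<in> P \<inter> \<Inter>\<O>"
      have det: "H \<in> determined c p K" if "finite K" for K
        using H that unfolding \<O>_def by blast
      have real: "H \<in> realizing c p K S T G" if "finite K" "finite S" "finite T" "G \<in> Q" for K S T G
      proof -
        have "realizing c p K S T G \<in> \<O>" 
          unfolding \<O>_def by (rule UnI2, rule image_eqI [of _ _ "(K, S, T, G)"]) (use that in auto)
        then show ?thesis using H by blast
      qed
      show "H \<in> S" using H by (intro S(2) richI [OF _ Q(2,3) det real]) auto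
    qed
  qed
qed

section \<open>Back and forth\<close>

text \<open>
  The map is defined on \<open>S\<close> but only its restriction to \<open>K\<close> will be kept, because extensions of \<open>S\<close> are
  realized over \<open>K\<close> only.
\<close>

definition partial_map :: "enum_structure \<Rightarrow> enum_structure \<Rightarrow> nat set \<times> nat set \<times> (nat \<Rightarrow> nat) \<Rightarrow> bool" where
  "partial_map H H' = (\<lambda>(K, S, \<phi>). finite S \<and> subgroup S (group_of H) \<and> K \<subseteq> S \<and> amalgamates c p K (restrict_group H S) \<and>
     embedding \<phi> (restrict_group H S) (group_of H'))"

text \<open>
  A subgroup \<open>S'\<close> of \<open>H'\<close> around the image of \<open>S\<close> is an extension of \<open>S\<close>, hence realized in \<open>H\<close> over \<open>K\<close>. The
  realization inverts \<open>\<phi>\<close> on \<open>K\<close>.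
\<close>

lemma back_step:
  assumes H: "rich H" and H': "rich H'" and \<phi>: "partial_map H H' (K, S, \<phi>)" and X: "finite X"
  shows "\<exists>K' S' \<psi>. partial_map H' H (K', S', \<psi>) \<and> \<phi> ` S \<union> X \<subseteq> K' \<and> (\<forall>a \<in> K. \<psi> (\<phi> a) = a)"
proof -
  have S: "finite S" "subgroup S (group_of H)" "K \<subseteq> S" "amalgamates c p K (restrict_group H S)"
    and e: "embedding \<phi> (restrict_group H S) (group_of H')"
    using \<phi> by (auto simp: partial_map_def)
  have P: "H' \<in> P" using H' by (simp add: rich_def)
  have "finite (\<phi> ` S \<union> X)" using S(1) X by simp
  from rich_determined [OF H' this] obtain S' where "finite S' \<and> subgroup S' (group_of H') \<and> \<phi> ` S \<union> X \<subseteq> S' \<and>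
      amalgamates c p (\<phi> ` S \<union> X) (restrict_group H' S')"
    by (rule exE)
  then have S': "finite S'" "subgroup S' (group_of H')" "\<phi> ` S \<union> X \<subseteq> S'" "amalgamates c p (\<phi> ` S \<union> X) (restrict_group H' S')"
    by simp_all
  have "embedding \<phi> (restrict_group H S) (restrict_group H' S')"
    using e S'(3) by (auto simp: embedding_def hom_def)
  moreover have "finite_in_variety c p (restrict_group H' S')" by (rule finite_restrict_group [OF P S'(2,1)])
  ultimately obtain \<psi> where "embedding \<psi> (restrict_group H' S') (group_of H) \<and> (\<forall>a \<in> K. \<psi> (\<phi> a) = a)"
    using rich_realizing [OF H S] by blast
  then have "partial_map H' H (\<phi> ` S \<union> X, S', \<psi>) \<and> \<phi> ` S \<union> X \<subseteq> \<phi> ` S \<union> X \<and> (\<forall>a \<in> K. \<psi> (\<phi> a) = a)"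
    using S' by (simp add: partial_map_def)
  then show ?thesis by blast
qed

lemma back_and_forth_step:
  assumes H: "rich H" and H': "rich H'" and \<phi>: "partial_map H H' (K, S, \<phi>)"
  shows "\<exists>K2 S2 \<phi>2. partial_map H H' (K2, S2, \<phi>2) \<and> insert n K \<subseteq> K2 \<and> n \<in> \<phi>2 ` K2 \<and> (\<forall>a \<in> K. \<phi>2 a = \<phi> a)"
proof -
  obtain K' S' \<psi> where 1: "partial_map H' H (K', S', \<psi>)" "\<phi> ` S \<union> {n} \<subseteq> K'" "\<And>a. a \<in> K \<Longrightarrow> \<psi> (\<phi> a) = a"
    using back_step [OF H H' \<phi>, of "{n}"] by auto
  obtain K2 S2 \<phi>2 where 2: "partial_map H H' (K2, S2, \<phi>2)" "\<psi> ` S' \<union> {n} \<subseteq> K2" "\<And>b. b \<in> K' \<Longrightarrow> \<phi>2 (\<psi> b) = b"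
    using back_step [OF H' H 1(1), of "{n}"] by auto
  have KS: "K \<subseteq> S" "K' \<subseteq> S'" using \<phi> 1(1) by (auto simp: partial_map_def)
  have "a \<in> K2 \<and> \<phi>2 a = \<phi> a" if "a \<in> K" for a
  proof -
    have "\<phi> a \<in> K'" using that KS 1(2) by auto
    then have "\<psi> (\<phi> a) \<in> K2" "\<phi>2 (\<psi> (\<phi> a)) = \<phi> a" using KS(2) 2(2,3) by auto
    then show ?thesis using 1(3) [OF that] by simp
  qed
  moreover have "n \<in> \<phi>2 ` K2"
  proof (rule image_eqI)
    show "n = \<phi>2 (\<psi> n)" using 1(2) 2(3) by simp
    have "n \<in> S'" using 1(2) KS(2) by auto
    then show "\<psi> n \<in> K2" using 2(2) by auto
  qed
  ultimately show ?thesis using 2(1,2) by blast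
qed

text \<open>
  The maps obtained by repeating the double step agree on the growing sets \<open>K\<close>, which exhaust the
  domain; their images exhaust the range. The start uses that the trivial group is an amalgamation base.
\<close>

lemma rich_isomorphic:
  assumes H: "rich H" and H': "rich H'"
  shows "group_of H \<cong> group_of H'"
proof -
  have PH: "H \<in> P" "H' \<in> P" using H H' by (auto simp: rich_def)
  interpret G: group "group_of H" by (rule P_D(3) [OF PH(1)])
  interpret G': group "group_of H'" by (rule P_D(3) [OF PH(2)])
  have "amalgamates c p {enum_one H} (restrict_group H {enum_one H})"
    using amalgamates_trivial [of "restrict_group H {enum_one H}", OF _ _ p] G.subgroup_imp_group [OF G.triv_subgroup]
    by simp
  moreover have "embedding (\<lambda>_. enum_one H') (restrict_group H {enum_one H}) (group_of H')"
    using G'.l_one [of "enum_one H'"] by (auto simp: embedding_def hom_def)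
  ultimately have start: "partial_map H H' ({enum_one H}, {enum_one H}, \<lambda>_. enum_one H')"
    using G.triv_subgroup by (simp add: partial_map_def)
  define next_map where "next_map n = (\<lambda>(K, S :: nat set, \<phi> :: nat \<Rightarrow> nat) (K2, S2 :: nat set, \<phi>2 :: nat \<Rightarrow> nat).
     insert n K \<subseteq> K2 \<and> n \<in> \<phi>2 ` K2 \<and> (\<forall>a \<in> K. \<phi>2 a = \<phi> a))" for n :: nat
  have "\<exists>f. \<forall>n. partial_map H H' (f n) \<and> next_map n (f n) (f (Suc n))"
  proof (rule dependent_nat_choice)
    show "\<exists>x. partial_map H H' x" using start by blast
    show "\<exists>y. partial_map H H' y \<and> next_map n x y" if "partial_map H H' x" for x n
    proof -
      obtain K S \<phi> where x: "x = (K, S, \<phi>)" by (cases x)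
      show ?thesis using back_and_forth_step [OF H H', of K S \<phi> n] that unfolding x next_map_def by auto
    qed
  qed
  then obtain f where f: "\<And>n. partial_map H H' (f n)" "\<And>n. next_map n (f n) (f (Suc n))" by blast
  define K where "K n = fst (f n)" for n
  define \<phi> where "\<phi> n = snd (snd (f n))" for n
  have K_step: "insert n (K n) \<subseteq> K (Suc n)" and onto: "n \<in> \<phi> (Suc n) ` K (Suc n)"
    and \<phi>_step: "a \<in> K n \<Longrightarrow> \<phi> (Suc n) a = \<phi> n a" for n a
    using f(2) [of n] by (auto simp: next_map_def K_def \<phi>_def split: prod.splits)
  have K_mono: "K m \<subseteq> K n" if "m \<le> n" for m n
    by (rule lift_Suc_mono_le [OF _ that]) (use K_step in blast)
  have \<phi>_mono: "\<phi> n a = \<phi> m a" if "m \<le> n" "a \<in> K m" for m n a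
    using that(1)
  proof (induction n rule: dec_induct)
    case (step n)
    then show ?case using \<phi>_step [of a n] K_mono [OF step(1)] that(2) by auto
  qed simp
  have emb: "\<phi> n (enum_mult H a b) = enum_mult H' (\<phi> n a) (\<phi> n b)" "\<phi> n a = \<phi> n b \<longleftrightarrow> a = b"
    if ab: "a \<in> K n" "b \<in> K n" for n a b
  proof -
    obtain S where S: "f n = (K n, S, \<phi> n)" by (metis K_def \<phi>_def prod.collapse)
    then have e: "K n \<subseteq> S" "embedding (\<phi> n) (restrict_group H S) (group_of H')"
      using f(1) [of n] by (auto simp: partial_map_def)
    show "\<phi> n (enum_mult H a b) = enum_mult H' (\<phi> n a) (\<phi> n b)"
      using embedding_mult [OF e(2), of a b] e(1) ab by auto
    show "\<phi> n a = \<phi> n b \<longleftrightarrow> a = b" using embedding_eq_iff [OF e(2), of a b] e(1) ab by auto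
  qed
  define \<Phi> where "\<Phi> a = \<phi> (Suc a) a" for a
  have KS: "a \<in> K (Suc a)" for a using K_step by blast
  have \<Phi>: "\<Phi> a = \<phi> n a" if "a \<in> K n" for a n
  proof -
    have "\<phi> (max n (Suc a)) a = \<phi> n a" by (rule \<phi>_mono [OF _ that]) simp
    moreover have "\<phi> (max n (Suc a)) a = \<phi> (Suc a) a" by (rule \<phi>_mono [OF _ KS]) simp
    ultimately show ?thesis by (simp add: \<Phi>_def)
  qed
  have common: "\<exists>n. a \<in> K n \<and> b \<in> K n \<and> d \<in> K n" for a b d
    using KS [of a] KS [of b] KS [of d] K_mono [of "Suc a" "Suc (a + b + d)"] K_mono [of "Suc b" "Suc (a + b + d)"]
      K_mono [of "Suc d" "Suc (a + b + d)"] by (intro exI [of _ "Suc (a + b + d)"]) auto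
  have "\<Phi> \<in> hom (group_of H) (group_of H')"
  proof (rule homI)
    fix a b
    obtain n where "a \<in> K n" "b \<in> K n" "enum_mult H a b \<in> K n" using common by blast
    then show "\<Phi> (a \<otimes>\<^bsub>group_of H\<^esub> b) = \<Phi> a \<otimes>\<^bsub>group_of H'\<^esub> \<Phi> b" using \<Phi> emb(1) by simp
  qed simp
  moreover have "inj \<Phi>"
  proof (rule injI)
    fix a b assume eq: "\<Phi> a = \<Phi> b"
    obtain n where n: "a \<in> K n" "b \<in> K n" using common by blast
    then show "a = b" using emb(2) [OF n] \<Phi> eq by simp
  qed
  moreover have "surj \<Phi>"
    unfolding surj_def
  proof
    fix n
    obtain a where "a \<in> K (Suc n)" "n = \<phi> (Suc n) a" using onto [of n] by blast
    then have "n = \<Phi> a" using \<Phi> by simp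
    then show "\<exists>a. n = \<Phi> a" by (rule exI)
  qed
  ultimately have "\<Phi> \<in> iso (group_of H) (group_of H')" by (simp add: iso_def bij_betw_def)
  then show ?thesis by (auto simp: is_iso_def)
qed

lemma P_nonempty: "P \<noteq> {}"
proof -
  have E: "comm_group (elementary_abelian p)"
    by (rule elementary_abelian_comm_group [OF prime_gt_0_nat [OF p(1)]])
  then interpret E: comm_group "elementary_abelian p" .
  let ?T = "(elementary_abelian p)\<lparr>carrier := {\<one>\<^bsub>elementary_abelian p\<^esub>}\<rparr>"
  have "in_variety c p (elementary_abelian p)"
    by (rule in_variety_comm_group [OF E c elementary_abelian_exponent [OF prime_gt_0_nat [OF p(1)]]])
  then have "finite_in_variety c p ?T"
    unfolding finite_in_variety_def using in_variety_subgroup E.triv_subgroup by auto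
  then show ?thesis using exists_enumerated_supergroup [OF _ c p(1), of ?T "{}"] by auto
qed

theorem exists_generic_group: "\<exists>G. generic_group_in P G"
proof -
  \<comment> \<open>Rich groups exist by the Baire category theorem. It is enough to take \<open>G\<close> rich if possible: without rich groups
    every subset would be comeagre by \<open>comeagre_rich\<close>.\<close>
  obtain G where G: "G \<in> P" "\<And>H. rich H \<Longrightarrow> rich G"
  proof (cases "\<exists>G. rich G")
    case True
    then obtain G where "rich G" by (rule exE)
    then show thesis using that [of G] rich_mem by simp
  next
    case False
    obtain G where "G \<in> P" using P_nonempty by auto
    then show thesis by (rule that) (use False in \<open>simp only: not_ex\<close>)
  qed
  have "comeagre_in (top_of_set P) {H \<in> P. group_of H \<cong> group_of G}"
  proof (rule comeagre_rich)
    fix H assume H: "rich H"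
    then have "group_of H \<cong> group_of G" using G(2) rich_isomorphic by simp
    then show "H \<in> {H \<in> P. group_of H \<cong> group_of G}" using rich_mem [OF H] by simp
  qed simp
  then show ?thesis using G(1) unfolding generic_group_in_def by blast
qed

end

theorem theorem2p9:
  fixes c p :: nat
  assumes "c \<notin> {0, 1}" and "p \<notin> {0, 1}"
    and "prime p" and "p > max 2 c"
  shows "closedin (top_of_set enum_groups) (enum_nil_groups c p) \<and>
    (\<exists>G. generic_group_in (enum_nil_groups c p) G)"
proof -
  interpret generic_setting c p by unfold_locales (use assms in auto)
  show ?thesis using closedin_enum_nil_groups exists_generic_group by blast
qed

end
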